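(* For $R>0$ let $B_R\subset\mathbb{H}^2$ be the geodesic disk of radius $R$. Assume that $0<R<\overline{R}$ and that $\alpha<\alpha_\star(B_R^{\mathrm{ext}})$. Then $$\lambda_1^\alpha(B_R^{\mathrm{ext}})>\lambda_1^\alpha(B_{\overline{R}}^{\mathrm{ext}}).$$
   Context: $\mathbb{H}^2$ is the hyperbolic plane (simply-connected, complete, two-dimensional, constant Gaussian curvature $-1$), with Riemannian measure $\mu$. For a bounded Lipschitz domain $\Omega\subset\mathbb{H}^2$ put $\Omega^{\mathrm{ext}}:=\mathbb{H}^2\setminus\overline\Omega$, let $\sigma$ be the one-dimensional Hausdorff measure on $\partial\Omega$, and for $\alpha\in\mathbb{R}$ define $$\lambda_1^\alpha(\Omega^{\mathrm{ext}}):=\inf_{u\in W^{1,2}(\Omega^{\mathrm{ext}})\setminus\{0\}}\frac{\int_{\Omega^{\mathrm{ext}}}|\nabla u|^2\,d\mu+\alpha\int_{\partial\Omega^{\mathrm{ext}}}|u|^2\,d\sigma}{\int_{\Omega^{\mathrm{ext}}}|u|^2\,d\mu},$$ with boundary values understood as traces. This is the lowest spectral point of the Robin Laplacian in $L^2(\Omega^{\mathrm{ext}})$ (the self-adjoint operator associated with the quadratic form in the numerator, with domain $W^{1,2}(\Omega^{\mathrm{ext}})$). The critical boundary parameter is $$\alpha_\star(\Omega^{\mathrm{ext}}):=\sup\left\{\alpha\in\mathbb{R}:\ \lambda_1^\alpha(\Omega^{\mathrm{ext}})<\tfrac14\right\};$$ equivalently, it is the supremum of those $\alpha\in\mathbb{R}$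 for which $\lambda_1^\alpha(\Omega^{\mathrm{ext}})$ is a discrete eigenvalue. *)

theory Defs
  imports "HOL-Analysis.Analysis"
begin

section \<open>The hyperbolic plane (Poincare disk model)\<close>

text \<open>The unit disk with the metric \<open>conf z ^ 2 * (dx ^ 2 + dy ^ 2)\<close>, of constant curvature -1.\<close>

definition hplane :: "complex set" where
  "hplane = ball 0 1"

definition conf :: "complex \<Rightarrow> real" where
  "conf z = 2 / (1 - (cmod z)\<^sup>2)"

definition hdist :: "complex \<Rightarrow> complex \<Rightarrow> real" where
  "hdist z w = arcosh (1 + 2 * (cmod (z - w))\<^sup>2 / ((1 - (cmod z)\<^sup>2) * (1 - (cmod w)\<^sup>2)))"

definition geodesic_disk :: "complex \<Rightarrow> real \<Rightarrow> complex set" where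
  "geodesic_disk p R = {z \<in> hplane. hdist p z < R}"

definition exterior :: "complex set \<Rightarrow> complex set" where
  "exterior \<Omega> = hplane - closure \<Omega>"

text \<open>The boundary is taken inside the hyperbolic plane; the unit circle does not belong to it.\<close>

definition hboundary :: "complex set \<Rightarrow> complex set" where
  "hboundary U = frontier U \<inter> hplane"

definition hyp_area :: "complex measure" where
  "hyp_area = density (restrict_space lborel hplane) (\<lambda>z. ennreal ((conf z)\<^sup>2))"

subsection \<open>One-dimensional Hausdorff measure of the hyperbolic distance\<close>

definition hdiam :: "complex set \<Rightarrow> ennreal" where
  "hdiam S = (SUP z\<in>S. SUP w\<in>S. ennreal (hdist z w))"

definition hausdorff_content :: "real \<Rightarrow> complex set \<Rightarrow> ennreal" where
  "hausdorff_content \<delta> A =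
     Inf {(\<Sum>i. hdiam (C i)) | C :: nat \<Rightarrow> complex set.
            A \<subseteq> (\<Union>i. C i) \<and> (\<forall>i. C i \<subseteq> hplane \<and> hdiam (C i) \<le> ennreal \<delta>)}"

definition hausdorff_outer :: "complex set \<Rightarrow> ennreal" where
  "hausdorff_outer A = (SUP \<delta>\<in>{0<..}. hausdorff_content \<delta> A)"

definition hyp_hausdorff :: "complex measure" where
  "hyp_hausdorff = measure_of hplane (sets (restrict_space borel hplane)) hausdorff_outer"

section \<open>Smooth compactly supported functions\<close>

definition partial :: "complex \<Rightarrow> (complex \<Rightarrow> complex) \<Rightarrow> complex \<Rightarrow> complex" where
  "partial b f z = frechet_derivative f (at z) b"

text \<open>The directions \<open>1\<close> and \<open>\<i>\<close> are those of the real coordinates \<open>x\<close> and \<open>y\<close>;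
  differentiability is real differentiability throughout.\<close>

primrec Ck :: "nat \<Rightarrow> (complex \<Rightarrow> complex) \<Rightarrow> bool" where
  "Ck 0 f \<longleftrightarrow> continuous_on UNIV f"
| "Ck (Suc k) f \<longleftrightarrow> (\<forall>z. f differentiable (at z)) \<and> Ck k (partial 1 f) \<and> Ck k (partial \<i> f)"

text \<open>The space of smooth functions with compact support in \<open>U\<close>, extended by zero.\<close>

definition test_functions :: "complex set \<Rightarrow> (complex \<Rightarrow> complex) set" where
  "test_functions U =
     {\<phi>. (\<forall>k. Ck k \<phi>) \<and> (\<exists>K. compact K \<and> K \<subseteq> U \<and> (\<forall>z. z \<notin> K \<longrightarrow> \<phi> z = 0))}"

definition grad :: "(complex \<Rightarrow> complex) \<Rightarrow> complex \<Rightarrow> complex \<times> complex" where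
  "grad f z = (partial 1 f z, partial \<i> f z)"

section \<open>Sobolev functions and traces\<close>

definition L2_on :: "'a measure \<Rightarrow> 'a set \<Rightarrow> ('a \<Rightarrow> 'b::real_normed_vector) \<Rightarrow> bool" where
  "L2_on M A f \<longleftrightarrow> set_borel_measurable M A f \<and> (\<integral>\<^sup>+z\<in>A. ennreal ((norm (f z))\<^sup>2) \<partial>M) < \<infinity>"

definition L2_tendsto ::
    "'a measure \<Rightarrow> 'a set \<Rightarrow> (nat \<Rightarrow> 'a \<Rightarrow> 'b::real_normed_vector) \<Rightarrow> ('a \<Rightarrow> 'b) \<Rightarrow> bool" where
  "L2_tendsto M A f g \<longleftrightarrow>
     (\<lambda>n. \<integral>\<^sup>+z\<in>A. ennreal ((norm (f n z - g z))\<^sup>2) \<partial>M) \<longlonglongrightarrow> 0"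

text \<open>If \<open>G\<close> collects the coordinate partial derivatives of \<open>u\<close>, then \<open>hframe G\<close> collects its
  derivatives along an orthonormal frame of the hyperbolic metric, so that the Riemannian norm of
  the gradient of \<open>u\<close> at \<open>z\<close> is the Euclidean norm of \<open>hframe G z\<close>.\<close>

definition hframe :: "(complex \<Rightarrow> complex \<times> complex) \<Rightarrow> complex \<Rightarrow> complex \<times> complex" where
  "hframe G z = G z /\<^sub>R conf z"

definition weak_grad ::
    "complex set \<Rightarrow> (complex \<Rightarrow> complex) \<Rightarrow> (complex \<Rightarrow> complex \<times> complex) \<Rightarrow> bool" where
  "weak_grad U u G \<longleftrightarrow>
     (\<forall>\<phi>\<in>test_functions U.
        (LINT z:U|lborel. u z * partial 1 \<phi> z) = - (LINT z:U|lborel. fst (G z) * \<phi> z) \<and>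
        (LINT z:U|lborel. u z * partial \<i> \<phi> z) = - (LINT z:U|lborel. snd (G z) * \<phi> z))"

text \<open>\<open>W12 U u G\<close>: the function \<open>u\<close> belongs to the Sobolev space on \<open>U\<close>, with weak
  derivatives \<open>G\<close>, which are determined by \<open>u\<close> almost everywhere. Functions are complex-valued.
  Square integrability makes the integrands above integrable, as \<open>conf\<close> is bounded on compact
  subsets of the disk.\<close>

definition W12 ::
    "complex set \<Rightarrow> (complex \<Rightarrow> complex) \<Rightarrow> (complex \<Rightarrow> complex \<times> complex) \<Rightarrow> bool" where
  "W12 U u G \<longleftrightarrow> L2_on hyp_area U u \<and> L2_on hyp_area U (hframe G) \<and> weak_grad U u G"

text \<open>The trace is the continuous extension of the restriction map
  \<open>\<phi> \<mapsto> \<phi>\<close> on \<open>hboundary U\<close> from the smooth functions, compactly supported in the whole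
  hyperbolic plane, to the Sobolev space on \<open>U\<close>. When \<open>U\<close> is the exterior of a bounded Lipschitz
  domain, these functions are dense and the restriction map is bounded, so every Sobolev function
  has a trace, and it is unique almost everywhere on the boundary.\<close>

definition has_trace ::
    "complex set \<Rightarrow> (complex \<Rightarrow> complex) \<Rightarrow> (complex \<Rightarrow> complex \<times> complex)
       \<Rightarrow> (complex \<Rightarrow> complex) \<Rightarrow> bool" where
  "has_trace U u G v \<longleftrightarrow>
     L2_on hyp_hausdorff (hboundary U) v \<and>
     (\<exists>\<phi>. (\<forall>n. \<phi> n \<in> test_functions hplane) \<and>
          L2_tendsto hyp_area U \<phi> u \<and>
          L2_tendsto hyp_area U (\<lambda>n. hframe (grad (\<phi> n))) (hframe G) \<and>
          L2_tendsto hyp_hausdorff (hboundary U) \<phi> v)"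

section \<open>The lowest Robin spectral point and the critical parameter\<close>

definition robin_quotient ::
    "real \<Rightarrow> complex set \<Rightarrow> (complex \<Rightarrow> complex) \<Rightarrow> (complex \<Rightarrow> complex \<times> complex)
       \<Rightarrow> (complex \<Rightarrow> complex) \<Rightarrow> real" where
  "robin_quotient \<alpha> U u G v =
     ((LINT z:U|hyp_area. (norm (hframe G z))\<^sup>2)
        + \<alpha> * (LINT z:hboundary U|hyp_hausdorff. (cmod (v z))\<^sup>2))
     / (LINT z:U|hyp_area. (cmod (u z))\<^sup>2)"

definition robin_lambda :: "real \<Rightarrow> complex set \<Rightarrow> ereal" where
  "robin_lambda \<alpha> U =
     Inf {ereal (robin_quotient \<alpha> U u G v) | u G v.
            W12 U u G \<and> has_trace U u G v \<and> \<not> (AE z in hyp_area. z \<in> U \<longrightarrow> u z = 0)}"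

definition robin_critical :: "complex set \<Rightarrow> ereal" where
  "robin_critical U = Sup (ereal ` {\<alpha>. robin_lambda \<alpha> U < ereal (1/4)})"

end

theory Submission
  imports Defs "HOL-Complex_Analysis.Complex_Analysis"
begin

text \<open>Write \<open>r\<close> for the distance from the common centre, \<open>\<lambda>(R)\<close> for the lowest spectral point outside the disk of radius
\<open>R\<close>, and let \<open>R < R'\<close>. Everything rests on the pointwise inequality
\<open>\<bar>\<partial>\<^sub>r u - w u\<bar>\<^sup>2 \<ge> 0\<close> for a function \<open>w\<close> of \<open>r\<close>. Integrated over an annulus with respect to
\<open>sinh r dr d\<theta>\<close> it bounds the Dirichlet energy from below by boundary terms \<open>w \<bar>u\<bar>\<^sup>2\<close> and by the
potential \<open>- w' - w\<^sup>2 - w coth r\<close> (lemma \<open>barta\<close>).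

The constant \<open>w = \<alpha>\<close> on \<open>R < r < R'\<close> produces exactly the Robin terms on both circles. Hence the Robin
energy outside the small disk is at least the Robin energy outside the large one plus the integral of
\<open>(- \<alpha>\<^sup>2 - \<alpha> coth r) \<bar>u\<bar>\<^sup>2\<close> over the annulus. On the other hand the trial function \<open>exp (\<alpha> r)\<close>, cut
off at a large distance, shows \<open>\<lambda>(R') < - \<alpha>\<^sup>2 - \<alpha> coth R'\<close>
(lemma \<open>trial_beats_exponential_rate\<close>): completing the square gives it the same potential
\<open>- \<alpha>\<^sup>2 - \<alpha> coth r\<close>, which decreases with \<open>r\<close> as \<open>\<alpha>\<close> is negative. So the potential gained on the annulus
exceeds \<open>\<lambda>(R')\<close> by some \<open>\<delta> > 0\<close>, and \<open>\<lambda>(R) \<ge> \<lambda>(R')\<close> follows.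

This gain is useless for a function that lives far away from the annulus. Such a function pays in another
way. The choice \<open>w = - 1 / 2\<close> has a potential of at least \<open>1 / 4\<close>, so with \<open>w\<close> interpolating between \<open>\<alpha>\<close> and
\<open>- 1 / 2\<close> on the annulus the energy is at least \<open>1 / 4\<close> of the outer mass minus a multiple of the mass in the
annulus. A convex combination of the two bounds, with little weight on the second, improves
\<open>\<lambda>(R')\<close> by a fixed amount for all functions at once, provided the comparison level is below \<open>1 / 4\<close>
(lemma \<open>enlarging_gains\<close>). The same choice \<open>w = - 1 / 2\<close> shows that a value below \<open>1 / 4\<close> forces
\<open>\<alpha> < - 1 / 2\<close>, so subcritical parameters are negative (lemma \<open>subcritical\<close>).

To connect this one-dimensional argument with the definitions, traces and weak derivatives are first removed:
the Rayleigh quotient is continuous for the convergence that defines traces, so the infimum may be taken over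
smooth functions of compact support (theorem \<open>robin_lambda_eq_INF_test\<close>). Moebius transformations preserve
area, Hausdorff measure and Dirichlet energy, so every disk may be centred at the origin
(theorem \<open>robin_lambda_centre\<close>). There the exponential map gives polar coordinates \<open>exp (s + \<i> \<theta>)\<close> with
\<open>exp s = tanh (r / 2)\<close>, in which the metric is \<open>sinh\<^sup>2 r (ds\<^sup>2 + d\<theta>\<^sup>2)\<close> and \<open>coth r = cosh s\<close>, and the Hausdorff
measure of a circle is its arc length (lemma \<open>nn_integral_hyp_hausdorff_circle\<close>). Averaging over the
circles turns the three integrals of the quotient into integrals over \<open>s\<close> (lemma \<open>forms_radial\<close>).\<close>

section \<open>Smooth functions on open sets\<close>

text \<open>Compositions with Moebius transformations and functions of the distance are smooth on an open subset
of the plane only; a cutoff extends them afterwards (\<open>Ck_if_compact_support\<close>).\<close>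

primrec Ck_on :: "nat \<Rightarrow> complex set \<Rightarrow> (complex \<Rightarrow> complex) \<Rightarrow> bool" where
  "Ck_on 0 U f \<longleftrightarrow> continuous_on U f"
| "Ck_on (Suc k) U f \<longleftrightarrow>
     (\<forall>z\<in>U. f differentiable (at z)) \<and> Ck_on k U (partial 1 f) \<and> Ck_on k U (partial \<i> f)"

lemma Ck_eq_Ck_on_UNIV: "Ck k f \<longleftrightarrow> Ck_on k UNIV f"
  by (induction k arbitrary: f) auto

lemma partial_eqI: "(f has_derivative f') (at z) \<Longrightarrow> partial b f z = f' b"
  unfolding partial_def using frechet_derivative_at by metis

lemma has_derivative_partial:
  assumes "f differentiable (at z)"
  shows "(f has_derivative (\<lambda>v. Re v *\<^sub>R partial 1 f z + Im v *\<^sub>R partial \<i> f z)) (at z)"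
proof -
  from assms obtain f' where f': "(f has_derivative f') (at z)"
    unfolding differentiable_def by blast
  interpret f': bounded_linear f' using f' by (rule has_derivative_bounded_linear)
  have "f' v = Re v *\<^sub>R partial 1 f z + Im v *\<^sub>R partial \<i> f z" for v
  proof -
    have "v = Re v *\<^sub>R 1 + Im v *\<^sub>R \<i>" by (simp add: complex_eq_iff)
    then have "f' v = f' (Re v *\<^sub>R 1 + Im v *\<^sub>R \<i>)" by simp
    also have "\<dots> = Re v *\<^sub>R f' 1 + Im v *\<^sub>R f' \<i>" by (simp only: f'.add f'.scaleR)
    finally show ?thesis by (simp add: partial_eqI[OF f'])
  qed
  then show ?thesis using f' by (metis (no_types, lifting) ext)
qed

lemma partial_cong_open:
  assumes "open U" "z \<in> U" "\<And>w. w \<in> U \<Longrightarrow> f w = g w"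
  shows "partial b f z = partial b g z"
proof -
  have "(f has_derivative f') (at z) \<longleftrightarrow> (g has_derivative f') (at z)" for f'
    using assms has_derivative_transform_within_open[of f f' z UNIV U g]
      has_derivative_transform_within_open[of g f' z UNIV U f] by auto
  then show ?thesis by (simp add: partial_def frechet_derivative_def)
qed

lemma Ck_on_cong:
  assumes "open U" "\<And>w. w \<in> U \<Longrightarrow> f w = g w" "Ck_on k U f"
  shows "Ck_on k U g"
  using assms(2,3)
proof (induction k arbitrary: f g)
  case 0
  then show ?case using continuous_on_cong[of U U f g] by simp
next
  case (Suc k)
  have "g differentiable (at z)" if "z \<in> U" for z
  proof -
    have "f differentiable (at z)" using Suc.prems that by auto
    then show ?thesis unfolding differentiable_def
      using has_derivative_transform_within_open[of f _ z UNIV U g] assms(1) that Suc.prems(1) by metis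
  qed
  moreover have "Ck_on k U (partial b g)" if "Ck_on k U (partial b f)" for b
    by (rule Suc.IH[OF _ that]) (rule partial_cong_open[OF assms(1) _ Suc.prems(1)])
  ultimately show ?case using Suc.prems by auto
qed

lemma Ck_on_continuous:
  assumes "open U" "Ck_on k U f" shows "continuous_on U f"
proof (cases k)
  case (Suc n)
  then have "f differentiable (at z)" if "z \<in> U" for z using assms that by auto
  then show ?thesis
    using differentiable_imp_continuous_within continuous_at_imp_continuous_on by blast
qed (use assms in auto)

lemma Ck_on_Suc_D: "open U \<Longrightarrow> Ck_on (Suc k) U f \<Longrightarrow> Ck_on k U f"
proof (induction k arbitrary: f)
  case 0
  then show ?case using Ck_on_continuous[of U "Suc 0" f] by simp
qed (use Ck_on.simps(2) in blast)

lemma Ck_on_subset: "Ck_on k U f \<Longrightarrow> V \<subseteq> U \<Longrightarrow> Ck_on k V f"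
  by (induction k arbitrary: f) (auto intro: continuous_on_subset)

lemma Ck_on_Un: "open U \<Longrightarrow> open V \<Longrightarrow> Ck_on k U f \<Longrightarrow> Ck_on k V f \<Longrightarrow> Ck_on k (U \<union> V) f"
  by (induction k arbitrary: f) (auto intro: continuous_on_open_Un)

lemma Ck_on_const [simp]: "open U \<Longrightarrow> Ck_on k U (\<lambda>_. c)"
proof (induction k arbitrary: c)
  case (Suc k)
  have "partial b (\<lambda>_. c) = (\<lambda>_. 0)" for b
    by (rule ext) (rule partial_eqI[OF has_derivative_const])
  then show ?case using Suc by simp
qed simp

lemma Ck_on_bounded_linear:
  assumes "open U" "bounded_linear l" "Ck_on k U f"
  shows "Ck_on k U (\<lambda>z. l (f z))"
  using assms(3)
proof (induction k arbitrary: f)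
  case 0
  then show ?case using bounded_linear.continuous_on[OF assms(2)] by simp
next
  case (Suc k)
  have d: "((\<lambda>z. l (f z)) has_derivative
      (\<lambda>v. l (Re v *\<^sub>R partial 1 f z + Im v *\<^sub>R partial \<i> f z))) (at z)" if "z \<in> U" for z
    using Suc.prems that
    by (intro bounded_linear.has_derivative[OF assms(2)] has_derivative_partial) auto
  have "Ck_on k U (partial 1 (\<lambda>z. l (f z)))"
    by (rule Ck_on_cong[OF assms(1) _ Suc.IH[of "partial 1 f"]])
       (use Suc.prems partial_eqI[OF d] in auto)
  moreover have "Ck_on k U (partial \<i> (\<lambda>z. l (f z)))"
    by (rule Ck_on_cong[OF assms(1) _ Suc.IH[of "partial \<i> f"]])
       (use Suc.prems partial_eqI[OF d] in auto)
  ultimately show ?case using d by (auto simp: differentiable_def)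
qed

lemma Ck_on_add:
  assumes "open U" "Ck_on k U f" "Ck_on k U g"
  shows "Ck_on k U (\<lambda>z. f z + g z)"
  using assms(2,3)
proof (induction k arbitrary: f g)
  case 0
  then show ?case by (simp add: continuous_on_add)
next
  case (Suc k)
  have d: "((\<lambda>z. f z + g z) has_derivative
      (\<lambda>v. (Re v *\<^sub>R partial 1 f z + Im v *\<^sub>R partial \<i> f z) +
           (Re v *\<^sub>R partial 1 g z + Im v *\<^sub>R partial \<i> g z))) (at z)" if "z \<in> U" for z
    using Suc.prems that by (intro has_derivative_add has_derivative_partial) auto
  have "Ck_on k U (partial 1 (\<lambda>z. f z + g z))"
    by (rule Ck_on_cong[OF assms(1) _ Suc.IH[of "partial 1 f" "partial 1 g"]])
       (use Suc.prems partial_eqI[OF d] in auto)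
  moreover have "Ck_on k U (partial \<i> (\<lambda>z. f z + g z))"
    by (rule Ck_on_cong[OF assms(1) _ Suc.IH[of "partial \<i> f" "partial \<i> g"]])
       (use Suc.prems partial_eqI[OF d] in auto)
  ultimately show ?case using d by (auto simp: differentiable_def)
qed

lemma Ck_on_mult:
  assumes "open U" "Ck_on k U f" "Ck_on k U g"
  shows "Ck_on k U (\<lambda>z. f z * g z)"
  using assms(2,3)
proof (induction k arbitrary: f g)
  case 0
  then show ?case by (simp add: continuous_on_mult)
next
  case (Suc k)
  have d: "((\<lambda>z. f z * g z) has_derivative
      (\<lambda>v. f z * (Re v *\<^sub>R partial 1 g z + Im v *\<^sub>R partial \<i> g z) +
           (Re v *\<^sub>R partial 1 f z + Im v *\<^sub>R partial \<i> f z) * g z)) (at z)" if "z \<in> U" for z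
    by (rule has_derivative_mult[OF has_derivative_partial has_derivative_partial])
       (use Suc.prems that in auto)
  have fg: "Ck_on k U f" "Ck_on k U g"
    using Suc.prems Ck_on_Suc_D[OF assms(1)] by blast+
  have "Ck_on k U (partial 1 (\<lambda>z. f z * g z))"
    by (rule Ck_on_cong[OF assms(1) _
          Ck_on_add[OF assms(1) Suc.IH[of f "partial 1 g"] Suc.IH[of "partial 1 f" g]]])
       (use Suc.prems fg partial_eqI[OF d] in auto)
  moreover have "Ck_on k U (partial \<i> (\<lambda>z. f z * g z))"
    by (rule Ck_on_cong[OF assms(1) _
          Ck_on_add[OF assms(1) Suc.IH[of f "partial \<i> g"] Suc.IH[of "partial \<i> f" g]]])
       (use Suc.prems fg partial_eqI[OF d] in auto)
  ultimately show ?case using d by (auto simp: differentiable_def)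
qed

text \<open>By the chain rule, the partial derivatives of the composition are sums of products of the partial
derivatives of \<open>g\<close>, composed with \<open>h\<close>, and real parts of those of \<open>h\<close>. The induction therefore runs on the
order with \<open>g\<close> arbitrary and uses closure under products.\<close>

lemma Ck_on_compose:
  assumes "open U" "open V" "\<And>z. z \<in> U \<Longrightarrow> h z \<in> V" "Ck_on k V g" "Ck_on k U h"
  shows "Ck_on k U (\<lambda>z. g (h z))"
  using assms(4,5)
proof (induction k arbitrary: g)
  case 0
  then show ?case using assms(3) by (auto intro!: continuous_on_compose2[of V g U h])
next
  case (Suc k)
  have d: "((\<lambda>z. g (h z)) has_derivative
      (\<lambda>v. Re (Re v *\<^sub>R partial 1 h z + Im v *\<^sub>R partial \<i> h z) *\<^sub>R partial 1 g (h z) +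
           Im (Re v *\<^sub>R partial 1 h z + Im v *\<^sub>R partial \<i> h z) *\<^sub>R partial \<i> g (h z))) (at z)"
    if "z \<in> U" for z
    by (rule has_derivative_compose[OF has_derivative_partial has_derivative_partial])
       (use Suc.prems that assms(3)[OF that] in auto)
  have h: "Ck_on k U h" using Suc.prems Ck_on_Suc_D[OF assms(1)] by blast
  have re: "bounded_linear (\<lambda>z. complex_of_real (Re z))" and im: "bounded_linear (\<lambda>z. complex_of_real (Im z))"
    by (intro bounded_linear_compose[OF bounded_linear_of_real] bounded_linear_Re bounded_linear_Im)+
  have g1: "Ck_on k U (\<lambda>z. partial 1 g (h z))" and gi: "Ck_on k U (\<lambda>z. partial \<i> g (h z))"
    using Suc.IH Suc.prems h by auto
  have *: "Ck_on k U (\<lambda>z. complex_of_real (Re (partial b h z)) * partial 1 g (h z) +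
      complex_of_real (Im (partial b h z)) * partial \<i> g (h z))" if "Ck_on k U (partial b h)" for b
    by (intro Ck_on_add Ck_on_mult assms(1) g1 gi
         Ck_on_bounded_linear[OF _ re] Ck_on_bounded_linear[OF _ im] that)
  have "Ck_on k U (partial 1 (\<lambda>z. g (h z)))"
    by (rule Ck_on_cong[OF assms(1) _ *[of 1]])
       (use Suc.prems partial_eqI[OF d] in \<open>auto simp: scaleR_conv_of_real\<close>)
  moreover have "Ck_on k U (partial \<i> (\<lambda>z. g (h z)))"
    by (rule Ck_on_cong[OF assms(1) _ *[of \<i>]])
       (use Suc.prems partial_eqI[OF d] in \<open>auto simp: scaleR_conv_of_real\<close>)
  ultimately show ?case using d by (auto simp: differentiable_def)
qed

lemma partial_holomorphic:
  assumes "f holomorphic_on U" "open U" "z \<in> U"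
  shows "partial b f z = b * deriv f z"
  using holomorphic_derivI[OF assms(1,2,3)]
  by (subst partial_eqI[of f "(*) (deriv f z)"]) (auto simp: has_field_derivative_def)

text \<open>The partial derivatives of a holomorphic function are constant multiples of its complex derivative,
which is again holomorphic.\<close>

lemma Ck_on_holomorphic:
  assumes "open U" "f holomorphic_on U" shows "Ck_on k U f"
  using assms(2)
proof (induction k arbitrary: f)
  case 0
  then show ?case by (simp add: holomorphic_on_imp_continuous_on)
next
  case (Suc k)
  have *: "Ck_on k U (\<lambda>z. b * deriv f z)" for b
    by (intro Suc.IH holomorphic_intros holomorphic_deriv[OF Suc.prems assms(1)])
  have "Ck_on k U (partial b f)" for b
    by (rule Ck_on_cong[OF assms(1) _ *[of b]]) (simp add: partial_holomorphic[OF Suc.prems assms(1)])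
  moreover have "f differentiable (at z)" if "z \<in> U" for z
    using holomorphic_derivI[OF Suc.prems assms(1) that] unfolding has_field_derivative_def differentiable_def by blast
  ultimately show ?case by simp
qed

lemma Ck_on_id [simp]: "open U \<Longrightarrow> Ck_on k U (\<lambda>z. z)"
  by (intro Ck_on_holomorphic holomorphic_intros)

lemma Ck_on_holomorphic_compose:
  assumes "open U" "open V" "\<And>z. z \<in> U \<Longrightarrow> h z \<in> V" "g holomorphic_on V" "Ck_on k U h"
  shows "Ck_on k U (\<lambda>z. g (h z))"
  using Ck_on_compose[OF assms(1-3) Ck_on_holomorphic[OF assms(2,4)] assms(5)] .

lemma Ck_if_compact_support:
  assumes "open U" "compact K" "K \<subseteq> U" "\<And>z. z \<notin> K \<Longrightarrow> \<phi> z = 0" "Ck_on k U \<phi>"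
  shows "Ck k \<phi>"
proof -
  have "open (- K)" using assms(2) by (simp add: compact_imp_closed open_Compl)
  then have "Ck_on k (- K) \<phi>"
    using Ck_on_cong[of "- K" "\<lambda>_. 0" \<phi> k] Ck_on_const[of "- K" k 0] assms(4) by simp
  then have "Ck_on k (U \<union> - K) \<phi>" using assms(1,5) \<open>open (- K)\<close> by (intro Ck_on_Un)
  moreover have "U \<union> - K = UNIV" using assms(3) by auto
  ultimately show ?thesis by (simp add: Ck_eq_Ck_on_UNIV)
qed

lemma test_functionsI:
  assumes "open U" "compact K" "K \<subseteq> U" "\<And>z. z \<notin> K \<Longrightarrow> \<phi> z = 0" "\<And>k. Ck_on k U \<phi>"
  shows "\<phi> \<in> test_functions U"
  using Ck_if_compact_support[OF assms] assms(2-4) unfolding test_functions_def by blast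

lemma test_function_Ck_on:
  assumes "\<phi> \<in> test_functions U" shows "Ck_on k V \<phi>"
  using assms Ck_on_subset[of k UNIV \<phi> V] Ck_eq_Ck_on_UNIV by (auto simp: test_functions_def)

lemma test_function_differentiable:
  assumes "\<phi> \<in> test_functions U" shows "\<phi> differentiable (at z)"
  using test_function_Ck_on[OF assms, of "Suc 0" UNIV] by auto

lemma test_function_continuous_on:
  assumes "\<phi> \<in> test_functions U" shows "continuous_on A \<phi>"
  using test_function_Ck_on[OF assms, of 0 A] by simp

lemma test_function_continuous_partial:
  assumes "\<phi> \<in> test_functions U"
  shows "continuous_on A (partial 1 \<phi>)" "continuous_on A (partial \<i> \<phi>)"
  using test_function_Ck_on[OF assms, of "Suc 0" A] by auto

lemma partial_eq_0_off_support:
  assumes "compact K" "\<And>z. z \<notin> K \<Longrightarrow> \<phi> z = 0" "z \<notin> K"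
  shows "partial b \<phi> z = 0"
proof -
  have "open (- K)" using assms(1) by (simp add: compact_imp_closed open_Compl)
  then have "partial b \<phi> z = partial b (\<lambda>_. 0) z" by (rule partial_cong_open) (use assms in auto)
  then show ?thesis using partial_eqI[OF has_derivative_const] by simp
qed

section \<open>A flat smooth function\<close>

text \<open>The factor \<open>1 / x ^ n\<close> makes the family closed under differentiation: the derivative of \<open>flat n\<close> is
a combination of \<open>flat (n + 2)\<close> and \<open>flat (n + 1)\<close>, so all members are smooth at once.\<close>

definition flat :: "nat \<Rightarrow> real \<Rightarrow> real" where
  "flat n x = (if x > 0 then exp (- 1 / x) / x ^ n else 0)"

lemma flat_tendsto_0: "((\<lambda>x. flat n x) \<longlongrightarrow> 0) (at_right 0)"
proof -
  have "((\<lambda>x::real. exp (- 1 / x) / x ^ n) \<longlongrightarrow> 0) (at_right 0)"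
  proof -
    have "((\<lambda>y::real. y ^ n / exp y) \<longlongrightarrow> 0) at_top" by (rule tendsto_power_div_exp_0)
    then have "((\<lambda>x::real. (inverse x) ^ n / exp (inverse x)) \<longlongrightarrow> 0) (at_right 0)"
      by (rule filterlim_compose) (rule filterlim_inverse_at_top_right)
    moreover have "(inverse x) ^ n / exp (inverse x) = exp (- 1 / x) / x ^ n" for x :: real
      by (simp add: exp_minus field_simps)
    ultimately show ?thesis by simp
  qed
  then show ?thesis
    by (rule Lim_transform_eventually) (auto simp: flat_def eventually_at_right_field intro: exI[of _ 1])
qed

lemma has_real_derivative_flat:
  "(flat n has_real_derivative flat (n + 2) x - real n * flat (n + 1) x) (at x)"
proof -
  consider "x > 0" | "x < 0" | "x = 0" by linarith
  then show ?thesis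
  proof cases
    case 1
    have "((\<lambda>x. exp (- 1 / x) / x ^ n) has_real_derivative
        (exp (- 1 / x) * (1 / x\<^sup>2) * x ^ n - exp (- 1 / x) * (real n * x ^ (n - 1))) / (x ^ n * x ^ n)) (at x)"
      using 1 by (auto intro!: derivative_eq_intros simp: power2_eq_square)
    moreover have "(exp (- 1 / x) * (1 / x\<^sup>2) * x ^ n - exp (- 1 / x) * (real n * x ^ (n - 1))) / (x ^ n * x ^ n)
        = flat (n + 2) x - real n * flat (n + 1) x"
      using 1 by (cases n) (auto simp: flat_def field_simps power2_eq_square)
    ultimately have "((\<lambda>x. exp (- 1 / x) / x ^ n) has_real_derivative flat (n + 2) x - real n * flat (n + 1) x) (at x)"
      by simp
    then show ?thesis
      by (rule has_field_derivative_transform_within_open[of _ _ _ "{0<..}"]) (use 1 in \<open>auto simp: flat_def\<close>)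
  next
    case 2
    have "((\<lambda>x. 0) has_real_derivative 0) (at x)" by simp
    then have "(flat n has_real_derivative 0) (at x)"
      by (rule has_field_derivative_transform_within_open[of _ _ _ "{..<0}"]) (use 2 in \<open>auto simp: flat_def\<close>)
    then show ?thesis using 2 by (simp add: flat_def)
  next
    case 3
    have "((\<lambda>y. flat n y / y) \<longlongrightarrow> 0) (at 0)"
    proof (rule filterlim_split_at)
      have "((\<lambda>x. flat (n + 1) x) \<longlongrightarrow> 0) (at_right 0)" by (rule flat_tendsto_0)
      then show "((\<lambda>y. flat n y / y) \<longlongrightarrow> 0) (at_right 0)"
        by (rule Lim_transform_eventually)
           (auto simp: flat_def eventually_at_right_field intro: exI[of _ 1])
      have "((\<lambda>x. 0::real) \<longlongrightarrow> 0) (at_left (0::real))" by simp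
      then show "((\<lambda>y. flat n y / y) \<longlongrightarrow> 0) (at_left 0)"
        by (rule Lim_transform_eventually)
           (auto simp: flat_def eventually_at_left_field intro: exI[of _ "-1"])
    qed
    then have "(flat n has_real_derivative 0) (at 0)"
      by (simp add: has_field_derivative_iff flat_def)
    then show ?thesis using 3 by (simp add: flat_def)
  qed
qed

lemma Ck_on_flat:
  assumes "open U" shows "Ck_on k U (\<lambda>z. complex_of_real (flat n (Re z)))"
proof (induction k arbitrary: n)
  case 0
  have "isCont (flat n) x" for x using has_real_derivative_flat DERIV_isCont by blast
  then have "continuous_on UNIV (flat n)" by (simp add: continuous_at_imp_continuous_on)
  then show ?case by (auto intro!: continuous_intros continuous_on_compose2[of UNIV "flat n"])
next
  case (Suc k)
  have d: "((\<lambda>z. complex_of_real (flat n (Re z))) has_derivative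
      (\<lambda>v. complex_of_real (Re v * (flat (n + 2) (Re z) - real n * flat (n + 1) (Re z))))) (at z)" for z
  proof -
    have "(flat n has_derivative (\<lambda>h. h * (flat (n + 2) (Re z) - real n * flat (n + 1) (Re z)))) (at (Re z))"
      using has_real_derivative_flat[of n "Re z"] unfolding has_field_derivative_def
      by (simp add: mult_commute_abs)
    from has_derivative_compose[OF bounded_linear_imp_has_derivative[OF bounded_linear_Re] this, of UNIV]
    show ?thesis by (intro has_derivative_of_real) 
  qed
  have "Ck_on k U (\<lambda>z. complex_of_real (flat (n + 2) (Re z)) + of_real (- real n) * complex_of_real (flat (n + 1) (Re z)))"
    by (intro Ck_on_add Ck_on_mult Ck_on_const Suc.IH assms)
  then have "Ck_on k U (partial 1 (\<lambda>z. complex_of_real (flat n (Re z))))"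
    by (rule Ck_on_cong[OF assms, rotated]) (simp add: partial_eqI[OF d])
  moreover have "Ck_on k U (partial \<i> (\<lambda>z. complex_of_real (flat n (Re z))))"
    by (rule Ck_on_cong[OF assms, of "\<lambda>_. 0"]) (simp_all add: partial_eqI[OF d] assms)
  ultimately show ?case using d by (auto simp: differentiable_def)
qed

section \<open>Hyperbolic distance\<close>

lemma hplane_iff: "z \<in> hplane \<longleftrightarrow> cmod z < 1"
  by (simp add: hplane_def)

lemma open_hplane [simp]: "open hplane"
  by (simp add: hplane_def)

lemma one_minus_norm_pos: "z \<in> hplane \<Longrightarrow> 0 < 1 - (cmod z)\<^sup>2"
  by (simp add: hplane_iff power_less_one_iff abs_square_less_1)

lemma hdist_arg_ge_1:
  assumes "z \<in> hplane" "w \<in> hplane"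
  shows "1 + 2 * (cmod (z - w))\<^sup>2 / ((1 - (cmod z)\<^sup>2) * (1 - (cmod w)\<^sup>2)) \<ge> 1"
  using one_minus_norm_pos[OF assms(1)] one_minus_norm_pos[OF assms(2)] by simp

lemma hdist_nonneg:
  assumes "z \<in> hplane" "w \<in> hplane" shows "0 \<le> hdist z w"
  unfolding hdist_def using hdist_arg_ge_1[OF assms] by (simp add: arcosh_nonneg_real)

lemma cosh_hdist:
  assumes "z \<in> hplane" "w \<in> hplane"
  shows "cosh (hdist z w) = 1 + 2 * (cmod (z - w))\<^sup>2 / ((1 - (cmod z)\<^sup>2) * (1 - (cmod w)\<^sup>2))"
  unfolding hdist_def using hdist_arg_ge_1[OF assms] by (simp add: cosh_arcosh_real)

lemma sinh_half_hdist:
  assumes "z \<in> hplane" "w \<in> hplane"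
  shows "sinh (hdist z w / 2) = cmod (z - w) / sqrt ((1 - (cmod z)\<^sup>2) * (1 - (cmod w)\<^sup>2))"
proof -
  let ?P = "(1 - (cmod z)\<^sup>2) * (1 - (cmod w)\<^sup>2)"
  have P: "?P > 0" using one_minus_norm_pos assms by simp
  have "cosh (hdist z w) = 2 * (sinh (hdist z w / 2))\<^sup>2 + 1"
    using cosh_double[of "hdist z w / 2"] cosh_square_eq[of "hdist z w / 2"] by simp
  then have "(sinh (hdist z w / 2))\<^sup>2 = (cmod (z - w))\<^sup>2 / ?P"
    using cosh_hdist[OF assms] by simp
  also have "\<dots> = (cmod (z - w) / sqrt ?P)\<^sup>2" using P by (simp add: power_divide)
  finally show ?thesis
    using hdist_nonneg[OF assms] P by (intro power2_eq_imp_eq[of "sinh _"]) auto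
qed

text \<open>Sets that are small in the hyperbolic metric are small in the Euclidean one. This is what allows the
measurability of Euclidean half-planes to be tested with Euclidean distances.\<close>

lemma norm_diff_le_sinh:
  assumes "z \<in> hplane" "w \<in> hplane"
  shows "cmod (z - w) \<le> sinh (hdist z w / 2)"
proof -
  let ?P = "(1 - (cmod z)\<^sup>2) * (1 - (cmod w)\<^sup>2)"
  have P: "?P > 0" using one_minus_norm_pos assms by simp
  have "?P \<le> 1" using one_minus_norm_pos[OF assms(1)] one_minus_norm_pos[OF assms(2)] by (intro mult_le_one) auto
  then have "sqrt ?P \<le> 1" by simp
  then have "cmod (z - w) * sqrt ?P \<le> cmod (z - w)" by (intro mult_right_le_one_le) (use P in auto)
  then show ?thesis unfolding sinh_half_hdist[OF assms] using P by (simp add: pos_le_divide_eq)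
qed

section \<open>Hausdorff measure on Borel sets\<close>

lemma hdiam_empty [simp]: "hdiam {} = 0"
  by (simp add: hdiam_def bot_ennreal)

lemma hdist_le_hdiam: "z \<in> S \<Longrightarrow> w \<in> S \<Longrightarrow> ennreal (hdist z w) \<le> hdiam S"
  unfolding hdiam_def by (meson SUP_upper2 SUP_upper)

definition cover :: "real \<Rightarrow> complex set \<Rightarrow> (nat \<Rightarrow> complex set) \<Rightarrow> bool" where
  "cover \<delta> A C \<longleftrightarrow> A \<subseteq> (\<Union>i. C i) \<and> (\<forall>i. C i \<subseteq> hplane \<and> hdiam (C i) \<le> ennreal \<delta>)"

lemma hausdorff_content_eq: "hausdorff_content \<delta> A = Inf {(\<Sum>i. hdiam (C i)) | C. cover \<delta> A C}"
  by (simp add: hausdorff_content_def cover_def)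

lemma hausdorff_content_le: "cover \<delta> A C \<Longrightarrow> hausdorff_content \<delta> A \<le> (\<Sum>i. hdiam (C i))"
  unfolding hausdorff_content_eq by (rule Inf_lower) auto

lemma hausdorff_content_greatest:
  "(\<And>C. cover \<delta> A C \<Longrightarrow> b \<le> (\<Sum>i. hdiam (C i))) \<Longrightarrow> b \<le> hausdorff_content \<delta> A"
  unfolding hausdorff_content_eq by (rule Inf_greatest) auto

lemma hausdorff_content_mono:
  assumes "A \<subseteq> B" "\<delta>' \<le> \<delta>" shows "hausdorff_content \<delta> A \<le> hausdorff_content \<delta>' B"
proof (rule hausdorff_content_greatest)
  fix C assume "cover \<delta>' B C"
  then have "cover \<delta> A C" using assms unfolding cover_def by (meson ennreal_leI order_trans)
  then show "hausdorff_content \<delta> A \<le> (\<Sum>i. hdiam (C i))" by (rule hausdorff_content_le)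
qed

lemma hausdorff_content_le_outer: "0 < \<delta> \<Longrightarrow> hausdorff_content \<delta> A \<le> hausdorff_outer A"
  unfolding hausdorff_outer_def by (intro SUP_upper) auto

lemma hausdorff_outer_mono: "A \<subseteq> B \<Longrightarrow> hausdorff_outer A \<le> hausdorff_outer B"
  unfolding hausdorff_outer_def by (intro SUP_mono) (auto intro!: hausdorff_content_mono)

lemma hausdorff_outer_empty [simp]: "hausdorff_outer {} = 0"
proof -
  have "hausdorff_content \<delta> {} = 0" for \<delta>
    using hausdorff_content_le[of \<delta> "{}" "\<lambda>_. {}"] by (simp add: cover_def)
  then show ?thesis by (simp add: hausdorff_outer_def)
qed

lemma hausdorff_content_subadditive:
  "hausdorff_content \<delta> (\<Union>i. A i) \<le> (\<Sum>i. hausdorff_content \<delta> (A i))"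
proof (rule ennreal_le_epsilon)
  fix e :: real assume fin: "(\<Sum>i. hausdorff_content \<delta> (A i)) < top" and e: "0 < e"
  have "\<exists>C. cover \<delta> (A i) C \<and> (\<Sum>j. hdiam (C j)) \<le> hausdorff_content \<delta> (A i) + ennreal (e * (1/2) ^ Suc i)" for i
  proof -
    have "hausdorff_content \<delta> (A i) < top"
      using fin by (metis ennreal_suminf_lessD)
    then have "hausdorff_content \<delta> (A i) < hausdorff_content \<delta> (A i) + ennreal (e * (1/2) ^ Suc i)"
      using e by (cases "hausdorff_content \<delta> (A i)" rule: ennreal_cases)
        (auto simp: ennreal_plus[symmetric] ennreal_less_iff simp del: ennreal_plus)
    then have "\<exists>x \<in> {(\<Sum>i. hdiam (C i)) | C. cover \<delta> (A i) C}. x < hausdorff_content \<delta> (A i) + ennreal (e * (1/2) ^ Suc i)"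
      unfolding hausdorff_content_eq Inf_less_iff .
    then show ?thesis by (auto intro: less_imp_le)
  qed
  then obtain C where C: "\<And>i. cover \<delta> (A i) (C i)"
    and Cle: "\<And>i. (\<Sum>j. hdiam (C i j)) \<le> hausdorff_content \<delta> (A i) + ennreal (e * (1/2) ^ Suc i)"
    by metis
  let ?D = "\<lambda>n. case prod_decode n of (i, j) \<Rightarrow> C i j"
  have "cover \<delta> (\<Union>i. A i) ?D"
    unfolding cover_def
  proof (intro conjI allI)
    show "(\<Union>i. A i) \<subseteq> (\<Union>n. ?D n)"
    proof
      fix x assume "x \<in> (\<Union>i. A i)"
      then obtain i j where "x \<in> C i j" using C unfolding cover_def by blast
      then have "x \<in> ?D (prod_encode (i, j))" by simp
      then show "x \<in> (\<Union>n. ?D n)" by (rule UN_I[OF UNIV_I])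
    qed
  qed (use C in \<open>auto simp: cover_def split: prod.splits\<close>)
  then have "hausdorff_content \<delta> (\<Union>i. A i) \<le> (\<Sum>n. hdiam (?D n))" by (rule hausdorff_content_le)
  also have "\<dots> = (\<Sum>i. \<Sum>j. hdiam (C i j))"
    using suminf_ennreal_2dimen[of "\<lambda>i. \<Sum>j. hdiam (C i j)" "\<lambda>(i, j). hdiam (C i j)"]
    by (simp add: o_def case_prod_unfold)
  also have "\<dots> \<le> (\<Sum>i. hausdorff_content \<delta> (A i) + ennreal (e * (1/2) ^ Suc i))"
    by (intro suminf_le Cle) auto
  also have "\<dots> = (\<Sum>i. hausdorff_content \<delta> (A i)) + (\<Sum>i. ennreal (e * (1/2) ^ Suc i))"
    by (intro suminf_add[symmetric]) auto
  also have "(\<Sum>i. ennreal (e * (1/2) ^ Suc i)) = ennreal e"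
    using e sums_mult[OF power_half_series, of e] by (intro suminf_ennreal_eq) auto
  finally show "hausdorff_content \<delta> (\<Union>i. A i) \<le> (\<Sum>i. hausdorff_content \<delta> (A i)) + ennreal e" .
qed

lemma hausdorff_outer_subadditive: "hausdorff_outer (\<Union>i. A i) \<le> (\<Sum>i. hausdorff_outer (A i))"
  unfolding hausdorff_outer_def[of "\<Union>i. A i"]
proof (rule SUP_least)
  fix \<delta> :: real assume "\<delta> \<in> {0<..}"
  then have "(\<Sum>i. hausdorff_content \<delta> (A i)) \<le> (\<Sum>i. hausdorff_outer (A i))"
    by (intro suminf_le hausdorff_content_le_outer) auto
  then show "hausdorff_content \<delta> (\<Union>i. A i) \<le> (\<Sum>i. hausdorff_outer (A i))"
    using hausdorff_content_subadditive order_trans by blast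
qed

lemma hausdorff_outer_Un_le: "hausdorff_outer (A \<union> B) \<le> hausdorff_outer A + hausdorff_outer B"
proof -
  let ?A = "\<lambda>i::nat. if i = 0 then A else if i = 1 then B else {}"
  have "(\<Union>i. ?A i) = A \<union> B" by (auto split: if_splits)
  moreover have "(\<Sum>i. hausdorff_outer (?A i)) = hausdorff_outer A + hausdorff_outer B"
  proof -
    have "(\<Sum>i. hausdorff_outer (?A i)) = (\<Sum>i\<in>{0, 1}. hausdorff_outer (?A i))"
      by (rule suminf_finite) auto
    then show ?thesis by simp
  qed
  ultimately show ?thesis using hausdorff_outer_subadditive[of ?A] by simp
qed

text \<open>A set of small diameter cannot meet both of two sets at a positive distance from each other, so a fine
covering of the union splits into coverings of the parts.\<close>

lemma hausdorff_outer_separated: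
  assumes "A \<subseteq> hplane" "B \<subseteq> hplane" "0 < \<eta>" "\<And>a b. a \<in> A \<Longrightarrow> b \<in> B \<Longrightarrow> \<eta> \<le> cmod (a - b)"
  shows "hausdorff_outer A + hausdorff_outer B \<le> hausdorff_outer (A \<union> B)"
proof -
  define d where "d = arsinh \<eta>"
  have d: "0 < d" using assms(3) by (simp add: d_def)
  have small: "hausdorff_content \<delta> A + hausdorff_content \<delta> B \<le> hausdorff_content \<delta> (A \<union> B)"
    if \<delta>: "0 < \<delta>" "\<delta> \<le> d" for \<delta>
  proof (rule hausdorff_content_greatest)
    fix C assume C: "cover \<delta> (A \<union> B) C"
    let ?X = "\<lambda>X i. if C i \<inter> X = {} then {} else C i"
    have "cover \<delta> A (?X A)" "cover \<delta> B (?X B)"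
      using C unfolding cover_def by (fastforce split: if_splits)+
    then have "hausdorff_content \<delta> A + hausdorff_content \<delta> B \<le> (\<Sum>i. hdiam (?X A i)) + (\<Sum>i. hdiam (?X B i))"
      by (intro add_mono hausdorff_content_le)
    also have "\<dots> = (\<Sum>i. hdiam (?X A i) + hdiam (?X B i))" by (rule suminf_add) auto
    also have "\<dots> \<le> (\<Sum>i. hdiam (C i))"
    proof (intro suminf_le)
      fix i
      have "C i \<inter> A = {} \<or> C i \<inter> B = {}"
      proof (rule ccontr)
        assume "\<not> ?thesis"
        then obtain a b where ab: "a \<in> C i" "a \<in> A" "b \<in> C i" "b \<in> B" by blast
        then have "ennreal (hdist a b) \<le> ennreal \<delta>"
          using hdist_le_hdiam[of a "C i" b] C unfolding cover_def by (meson order_trans)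
        then have "hdist a b \<le> d" using \<delta> by (simp add: ennreal_le_iff)
        then have "sinh (hdist a b / 2) < sinh d" using d by simp
        then have "cmod (a - b) < \<eta>"
          using norm_diff_le_sinh[of a b] ab assms(1,2) unfolding d_def sinh_arsinh_real
          by (meson le_less_trans subsetD)
        then show False using assms(4)[of a b] ab by simp
      qed
      then show "hdiam (?X A i) + hdiam (?X B i) \<le> hdiam (C i)" by auto
    qed auto
    finally show "hausdorff_content \<delta> A + hausdorff_content \<delta> B \<le> (\<Sum>i. hdiam (C i))" .
  qed
  have "hausdorff_content \<delta>1 A + hausdorff_content \<delta>2 B \<le> hausdorff_outer (A \<union> B)"
    if "0 < \<delta>1" "0 < \<delta>2" for \<delta>1 \<delta>2
  proof -
    let ?m = "min d (min \<delta>1 \<delta>2)"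
    have "hausdorff_content \<delta>1 A + hausdorff_content \<delta>2 B \<le> hausdorff_content ?m A + hausdorff_content ?m B"
      by (intro add_mono hausdorff_content_mono) auto
    also have "\<dots> \<le> hausdorff_content ?m (A \<union> B)" using that d by (intro small) auto
    also have "\<dots> \<le> hausdorff_outer (A \<union> B)" using that d by (intro hausdorff_content_le_outer) auto
    finally show ?thesis .
  qed
  then have "hausdorff_content \<delta>1 A + hausdorff_outer B \<le> hausdorff_outer (A \<union> B)" if "0 < \<delta>1" for \<delta>1
    unfolding hausdorff_outer_def[of B] using that
    by (subst ennreal_SUP_add_right) (auto intro!: SUP_least)
  then show ?thesis
    unfolding hausdorff_outer_def[of A]
    by (subst ennreal_SUP_add_left[symmetric]) (auto intro!: SUP_least)
qed

lemma outer_measure_space_hausdorff: "outer_measure_space (Pow hplane) hausdorff_outer"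
  unfolding outer_measure_space_def positive_def increasing_def countably_subadditive_def
  by (auto intro: hausdorff_outer_mono hausdorff_outer_subadditive)

text \<open>Caratheodory's argument. The part of \<open>X\<close> beyond the half-plane is exhausted by sets \<open>A n\<close>
that stay away from the half-plane, and the rest consists of thin layers \<open>D k\<close>. Every second layer is
separated from the ones before it, so the measures of the layers have a finite sum, and the layers that
\<open>A n\<close> misses do not count in the limit.\<close>

lemma hausdorff_outer_halfspace_split:
  assumes X: "X \<subseteq> hplane" and i: "norm i = 1"
  shows "hausdorff_outer (X \<inter> {z. z \<bullet> i \<le> a}) + hausdorff_outer (X - {z. z \<bullet> i \<le> a}) \<le> hausdorff_outer X"
proof (cases "hausdorff_outer X = top")
  case False
  let ?H = hausdorff_outer and ?F = "{z. z \<bullet> i \<le> a}"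
  have sep: "\<eta> \<le> cmod (z - w)" if "z \<bullet> i + \<eta> \<le> w \<bullet> i" for z w \<eta>
  proof -
    have "\<eta> \<le> (w - z) \<bullet> i" using that by (simp add: inner_diff_left)
    also have "\<dots> \<le> norm (w - z) * norm i" by (rule norm_cauchy_schwarz)
    finally show ?thesis using i by (simp add: norm_minus_commute)
  qed
  define D where "D k = {z \<in> X. a + 1 / real (k + 2) < z \<bullet> i \<and> z \<bullet> i \<le> a + 1 / real (k + 1)}" for k :: nat
  define A where "A n = {z \<in> X. a + 1 / real (n + 1) < z \<bullet> i}" for n :: nat
  \<comment> \<open>Layers of the same parity, with \<open>p\<close> in \<open>{0, 1}\<close>, are pairwise separated.\<close>
  have par: "(\<Sum>k<m. ?H (D (2 * k + p))) \<le> ?H (\<Union>k<m. D (2 * k + p))" for m p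
  proof (induction m)
    case (Suc m)
    have "?H (D (2 * m + p)) + ?H (\<Union>k<m. D (2 * k + p)) \<le> ?H (D (2 * m + p) \<union> (\<Union>k<m. D (2 * k + p)))"
    proof (cases "m = 0")
      case False
      let ?\<eta> = "1 / real (2 * m + p) - 1 / real (2 * m + p + 1)"
      show ?thesis
      proof (rule hausdorff_outer_separated[where \<eta> = ?\<eta>])
        have "1 / real (2 * m + p + 1) < 1 / real (2 * m + p)"
          using False by (intro divide_strict_left_mono) auto
        then show "0 < ?\<eta>" by simp
        fix z w assume z: "z \<in> D (2 * m + p)" and w: "w \<in> (\<Union>k<m. D (2 * k + p))"
        then obtain k where k: "k < m" "w \<in> D (2 * k + p)" by blast
        have "1 / real (2 * m + p) \<le> 1 / real (2 * k + p + 2)"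
          using k(1) by (intro divide_left_mono) auto
        then have "a + 1 / real (2 * m + p) \<le> w \<bullet> i" using k(2) by (simp add: D_def)
        moreover have "z \<bullet> i \<le> a + 1 / real (2 * m + p + 1)" using z by (simp add: D_def)
        ultimately show "?\<eta> \<le> cmod (z - w)" by (intro sep) simp
      qed (use X in \<open>auto simp: D_def\<close>)
    qed simp
    moreover have "D (2 * m + p) \<union> (\<Union>k<m. D (2 * k + p)) = (\<Union>k<Suc m. D (2 * k + p))"
      by (auto simp: less_Suc_eq)
    ultimately show ?case using Suc.IH
      by (simp add: add.commute) (meson add_left_mono order_trans)
  qed simp
  have half: "(\<Sum>k<m. ?H (D (2 * k + p))) \<le> ?H X" for m p
  proof -
    have "?H (\<Union>k<m. D (2 * k + p)) \<le> ?H X" by (intro hausdorff_outer_mono) (auto simp: D_def)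
    then show ?thesis using par[where m = m and p = p] order_trans by blast
  qed
  define S where "S = (\<Sum>k. ?H (D k))"
  have S_le: "S \<le> ?H X + ?H X"
    unfolding S_def
  proof (rule suminf_le_const)
    fix n
    have "(\<Sum>k<n. ?H (D k)) \<le> (\<Sum>k<2 * n. ?H (D k))" by (intro sum_mono2) auto
    also have "\<dots> = (\<Sum>k<n. ?H (D (2 * k))) + (\<Sum>k<n. ?H (D (2 * k + 1)))"
      by (induction n) (auto simp: algebra_simps)
    also have "\<dots> \<le> ?H X + ?H X" using half[where p = 0] half[where p = 1] by (intro add_mono) auto
    finally show "(\<Sum>k<n. ?H (D k)) \<le> ?H X + ?H X" .
  qed auto
  have S_fin: "S \<noteq> top" using S_le False by (auto simp: top_unique)
  have main: "?H (X \<inter> ?F) + ?H (X - ?F) + (\<Sum>k<n. ?H (D k)) \<le> ?H X + S" for n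
  proof -
    have cov: "X - ?F \<subseteq> A n \<union> (\<Union>k. D (k + n))"
    proof
      fix z assume z: "z \<in> X - ?F"
      show "z \<in> A n \<union> (\<Union>k. D (k + n))"
      proof (cases "z \<in> A n")
        case False
        \<comment> \<open>The least \<open>m\<close> with \<open>P m\<close> locates the layer of \<open>z\<close>.\<close>
        define P where "P m \<longleftrightarrow> a + 1 / real (m + 1) < z \<bullet> i" for m :: nat
        have "\<exists>m. P m"
        proof -
          have "0 < z \<bullet> i - a" using z by simp
          then obtain m where "inverse (real (Suc m)) < z \<bullet> i - a" using reals_Archimedean by blast
          then show ?thesis by (auto simp: P_def inverse_eq_divide algebra_simps intro!: exI[of _ m])
        qed
        define m where "m = (LEAST m. P m)"
        have Pm: "P m" unfolding m_def using \<open>\<exists>m. P m\<close> LeastI_ex by metis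
        have "\<not> P k" if "k \<le> n" for k
        proof
          assume "P k"
          moreover have "1 / real (n + 1) \<le> 1 / real (k + 1)" using that by (intro divide_left_mono) auto
          ultimately show False using False z by (auto simp: A_def P_def)
        qed
        then have "n < m" using Pm not_le by blast
        then obtain k where k: "m = Suc (k + n)" by (metis add.commute less_iff_Suc_add)
        have "\<not> P (k + n)" using k not_less_Least[of "k + n" P] by (simp add: m_def)
        then have "z \<in> D (k + n)" using Pm z unfolding D_def P_def k by (auto simp: add_ac)
        then show ?thesis by blast
      qed simp
    qed
    have "?H (X - ?F) \<le> ?H (A n) + (\<Sum>k. ?H (D (k + n)))"
    proof -
      have "?H (X - ?F) \<le> ?H (A n \<union> (\<Union>k. D (k + n)))" by (rule hausdorff_outer_mono[OF cov])
      also have "\<dots> \<le> ?H (A n) + ?H (\<Union>k. D (k + n))" by (rule hausdorff_outer_Un_le)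
      also have "\<dots> \<le> ?H (A n) + (\<Sum>k. ?H (D (k + n)))"
        by (intro add_left_mono hausdorff_outer_subadditive)
      finally show ?thesis .
    qed
    moreover have "?H (X \<inter> ?F) + ?H (A n) \<le> ?H X"
    proof -
      have "?H (X \<inter> ?F) + ?H (A n) \<le> ?H ((X \<inter> ?F) \<union> A n)"
        by (rule hausdorff_outer_separated[where \<eta> = "1 / real (n + 1)"])
           (use X in \<open>auto simp: A_def intro!: sep\<close>)
      also have "\<dots> \<le> ?H X" by (intro hausdorff_outer_mono) (auto simp: A_def)
      finally show ?thesis .
    qed
    moreover have "(\<Sum>k. ?H (D (k + n))) + (\<Sum>k<n. ?H (D k)) = S"
      unfolding S_def by (rule suminf_offset[symmetric]) auto
    moreover have "x + y + s \<le> h + S'" if "y \<le> an + t" "x + an \<le> h" "t + s = S'" for x y s h S' an t :: ennreal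
    proof -
      have "x + y + s \<le> x + (an + t) + s" using that(1) by (intro add_mono) auto
      also have "\<dots> = (x + an) + (t + s)" by (simp add: ac_simps)
      also have "\<dots> \<le> h + S'" using that(2,3) by (intro add_mono) auto
      finally show ?thesis .
    qed
    ultimately show ?thesis by blast
  qed
  have "?H (X \<inter> ?F) + ?H (X - ?F) + S \<le> ?H X + S"
  proof -
    have "(\<lambda>n. ?H (X \<inter> ?F) + ?H (X - ?F) + (\<Sum>k<n. ?H (D k))) \<longlonglongrightarrow> ?H (X \<inter> ?F) + ?H (X - ?F) + S"
      unfolding S_def by (intro tendsto_add tendsto_const summable_LIMSEQ) auto
    then show ?thesis using main by (intro LIMSEQ_le_const2) auto
  qed
  then show ?thesis using S_fin by (simp add: add.commute[of _ S] ennreal_add_left_cancel_le)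
qed simp

lemma sets_hyp_hausdorff: "sets hyp_hausdorff = sets (restrict_space borel hplane)"
  and space_hyp_hausdorff: "space hyp_hausdorff = hplane"
proof -
  have "sets (restrict_space borel hplane) \<subseteq> Pow hplane"
    using sets.space_closed[of "restrict_space borel hplane"] by (simp add: space_restrict_space)
  moreover have "sigma_sets hplane (sets (restrict_space borel hplane)) = sets (restrict_space borel hplane)"
    using sets.sigma_sets_eq[of "restrict_space borel hplane"] by (simp add: space_restrict_space)
  ultimately show "sets hyp_hausdorff = sets (restrict_space borel hplane)" "space hyp_hausdorff = hplane"
    unfolding hyp_hausdorff_def by (simp_all add: space_measure_of_conv)
qed

text \<open>Half-planes generate the Borel sets, and the sets measurable in the sense of Caratheodory form a
sigma-algebra on which the outer measure is countably additive. Without this fact \<open>measure_of\<close> would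
return the null measure.\<close>

lemma emeasure_hyp_hausdorff:
  assumes "A \<in> sets (restrict_space borel hplane)"
  shows "emeasure hyp_hausdorff A = hausdorff_outer A"
proof -
  interpret P: sigma_algebra hplane "Pow hplane" by (rule sigma_algebra_Pow)
  let ?L = "lambda_system hplane (Pow hplane) hausdorff_outer"
  have L: "measure_space hplane ?L hausdorff_outer"
    by (rule P.caratheodory_lemma[OF outer_measure_space_hausdorff])
  then interpret L: sigma_algebra hplane ?L by (simp add: measure_space_def)
  have half: "hplane \<inter> {z. z \<bullet> i \<le> a} \<in> ?L" if "i \<in> Basis" for i :: complex and a
    unfolding P.lambda_system_eq
  proof (intro CollectI conjI ballI antisym)
    fix X assume "X \<in> Pow hplane"
    then have X: "X \<subseteq> hplane" by simp
    have eq: "X \<inter> (hplane \<inter> {z. z \<bullet> i \<le> a}) = X \<inter> {z. z \<bullet> i \<le> a}"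
      "X - hplane \<inter> {z. z \<bullet> i \<le> a} = X - {z. z \<bullet> i \<le> a}" using X by auto
    show "hausdorff_outer (X \<inter> (hplane \<inter> {z. z \<bullet> i \<le> a})) + hausdorff_outer (X - hplane \<inter> {z. z \<bullet> i \<le> a})
        \<le> hausdorff_outer X"
      unfolding eq using that by (intro hausdorff_outer_halfspace_split[OF X]) simp
    show "hausdorff_outer X \<le> hausdorff_outer (X \<inter> (hplane \<inter> {z. z \<bullet> i \<le> a})) + hausdorff_outer (X - hplane \<inter> {z. z \<bullet> i \<le> a})"
      unfolding eq using hausdorff_outer_Un_le[of "X \<inter> {z. z \<bullet> i \<le> a}" "X - {z. z \<bullet> i \<le> a}"]
      by (simp add: Int_Diff_Un)
  qed auto
  have "hplane \<inter> B \<in> ?L" if "B \<in> sigma_sets UNIV ((\<lambda>(a, i). {x. x \<bullet> i \<le> a}) ` (UNIV \<times> Basis))" for B :: "complex set"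
    using that
  proof (induction rule: sigma_sets.induct)
    case (Compl B)
    have "hplane \<inter> (UNIV - B) = hplane - hplane \<inter> B" by auto
    then show ?case using L.compl_sets[OF Compl.IH] by simp
  next
    case (Union B)
    have "hplane \<inter> (\<Union>i. B i) = (\<Union>i. hplane \<inter> B i)" by auto
    then show ?case using Union.IH L.countable_nat_UN by (metis image_subsetI)
  qed (auto simp: half)
  then have sub: "sets (restrict_space borel hplane) \<subseteq> ?L"
    by (auto simp: sets_restrict_space borel_eq_halfspace_le)
  have "countably_additive (sets (restrict_space borel hplane)) hausdorff_outer"
    using L sub unfolding measure_space_def countably_additive_def by blast
  then show ?thesis
    using assms sets_hyp_hausdorff emeasure_measure_of[of hyp_hausdorff hplane "sets (restrict_space borel hplane)" hausdorff_outer A]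
      sets.space_closed[of "restrict_space borel hplane"]
    by (simp add: hyp_hausdorff_def positive_def space_restrict_space)
qed

section \<open>Isometries moving the origin\<close>

text \<open>The isometry of the disk model that moves the origin to \<open>p\<close> without rotating at the origin.\<close>

definition moeb :: "complex \<Rightarrow> complex \<Rightarrow> complex" where
  "moeb p z = (z + p) / (1 + cnj p * z)"

lemma of_real_norm_power2: "(complex_of_real (cmod z))\<^sup>2 = z * cnj z"
  by (metis complex_norm_square of_real_power)

lemma moeb_denom_nonzero:
  assumes "p \<in> hplane" "z \<in> hplane" shows "1 + cnj p * z \<noteq> 0"
proof
  assume "1 + cnj p * z = 0"
  then have "cmod (cnj p * z) = 1" by (metis add_eq_0_iff norm_minus_cancel norm_one)
  moreover have "cmod p * cmod z < 1 * 1"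
    using assms by (intro mult_strict_mono') (auto simp: hplane_iff)
  ultimately show False by (simp add: norm_mult)
qed

lemma moeb_diff:
  assumes "p \<in> hplane" "z \<in> hplane" "w \<in> hplane"
  shows "moeb p z - moeb p w = (z - w) * (1 - (cmod p)\<^sup>2) / ((1 + cnj p * z) * (1 + cnj p * w))"
  using moeb_denom_nonzero[OF assms(1,2)] moeb_denom_nonzero[OF assms(1,3)]
  by (simp add: moeb_def diff_frac_eq of_real_norm_power2) (simp add: algebra_simps)

lemma one_minus_norm_moeb:
  assumes "p \<in> hplane" "z \<in> hplane"
  shows "1 - (cmod (moeb p z))\<^sup>2 = (1 - (cmod p)\<^sup>2) * (1 - (cmod z)\<^sup>2) / (cmod (1 + cnj p * z))\<^sup>2"
proof -
  have "(cmod (1 + cnj p * z))\<^sup>2 - (cmod (z + p))\<^sup>2 = (1 - (cmod p)\<^sup>2) * (1 - (cmod z)\<^sup>2)"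
    by (simp add: cmod_power2) (simp add: algebra_simps power2_eq_square)
  then show ?thesis using moeb_denom_nonzero[OF assms]
    by (simp add: moeb_def norm_divide power_divide field_simps)
qed

lemma moeb_in_hplane:
  assumes "p \<in> hplane" "z \<in> hplane" shows "moeb p z \<in> hplane"
proof -
  have "0 < 1 - (cmod (moeb p z))\<^sup>2"
    unfolding one_minus_norm_moeb[OF assms]
    using one_minus_norm_pos assms moeb_denom_nonzero[OF assms] by simp
  then show ?thesis by (simp add: hplane_iff abs_square_less_1)
qed

lemma uminus_in_hplane [simp]: "- p \<in> hplane \<longleftrightarrow> p \<in> hplane"
  by (simp add: hplane_iff)

lemma moeb_moeb_uminus:
  assumes "p \<in> hplane" "z \<in> hplane" shows "moeb p (moeb (- p) z) = z"
proof -
  have d: "1 - cnj p * z \<noteq> 0" using moeb_denom_nonzero[of "- p" z] assms by simp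
  have "1 - cnj p * p \<noteq> 0"
    using one_minus_norm_pos[OF assms(1)] by (metis complex_norm_square mult.commute of_real_1 of_real_diff of_real_eq_0_iff less_irrefl)
  moreover have "1 + cnj p * moeb (- p) z = (1 - cnj p * p) / (1 - cnj p * z)"
    using d by (simp add: moeb_def field_simps)
  moreover have "moeb (- p) z + p = z * (1 - cnj p * p) / (1 - cnj p * z)"
    using d by (simp add: moeb_def field_simps)
  ultimately show ?thesis using d by (simp add: moeb_def[of p])
qed

lemma moeb_uminus_moeb: "p \<in> hplane \<Longrightarrow> z \<in> hplane \<Longrightarrow> moeb (- p) (moeb p z) = z"
  using moeb_moeb_uminus[of "- p" z] by simp

lemma moeb_0 [simp]: "moeb p 0 = p"
  by (simp add: moeb_def)

lemma inj_on_moeb: "p \<in> hplane \<Longrightarrow> inj_on (moeb p) hplane"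
  by (rule inj_on_inverseI[of _ "moeb (- p)"]) (rule moeb_uminus_moeb)

lemma moeb_image_hplane: "p \<in> hplane \<Longrightarrow> moeb p ` hplane = hplane"
  using moeb_in_hplane moeb_moeb_uminus[of p] by (auto simp: image_iff) (metis uminus_in_hplane)

lemma has_field_derivative_moeb:
  assumes "p \<in> hplane" "z \<in> hplane"
  shows "(moeb p has_field_derivative (1 - (cmod p)\<^sup>2) / (1 + cnj p * z)\<^sup>2) (at z)"
proof -
  have "moeb p = (\<lambda>z. (z + p) / (1 + cnj p * z))" by (simp add: moeb_def fun_eq_iff)
  moreover have "((\<lambda>z. (z + p) / (1 + cnj p * z)) has_field_derivative
      (1 * (1 + cnj p * z) - (z + p) * cnj p) / ((1 + cnj p * z) * (1 + cnj p * z))) (at z)"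
    using moeb_denom_nonzero[OF assms] by (intro DERIV_divide) (auto intro!: derivative_eq_intros)
  moreover have *: "1 * (1 + cnj p * z) - (z + p) * cnj p = 1 - (cmod p)\<^sup>2"
    by (simp add: of_real_norm_power2) (simp add: algebra_simps)
  ultimately show ?thesis unfolding * power2_eq_square[of "1 + cnj p * z"] by simp
qed

lemma holomorphic_moeb: "p \<in> hplane \<Longrightarrow> moeb p holomorphic_on hplane"
  by (auto simp: holomorphic_on_open intro: has_field_derivative_moeb)

lemma continuous_on_moeb: "p \<in> hplane \<Longrightarrow> A \<subseteq> hplane \<Longrightarrow> continuous_on A (moeb p)"
  using holomorphic_on_imp_continuous_on[OF holomorphic_moeb] continuous_on_subset by blast

lemma conf_moeb:
  assumes "p \<in> hplane" "z \<in> hplane"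
  shows "conf (moeb p z) * cmod (deriv (moeb p) z) = conf z"
proof -
  have "cmod (1 - (cmod p)\<^sup>2 :: complex) = 1 - (cmod p)\<^sup>2"
    using one_minus_norm_pos[OF assms(1)] by (metis abs_of_pos norm_of_real of_real_1 of_real_diff)
  then have "cmod (deriv (moeb p) z) = (1 - (cmod p)\<^sup>2) / (cmod (1 + cnj p * z))\<^sup>2"
    by (simp add: DERIV_imp_deriv[OF has_field_derivative_moeb[OF assms]] norm_divide norm_power)
  then show ?thesis
    using one_minus_norm_pos[OF assms(1)] one_minus_norm_pos[OF assms(2)] moeb_denom_nonzero[OF assms]
    by (simp add: conf_def one_minus_norm_moeb[OF assms])
qed

lemma hdist_moeb:
  assumes "p \<in> hplane" "z \<in> hplane" "w \<in> hplane"
  shows "hdist (moeb p z) (moeb p w) = hdist z w"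
proof -
  have "cmod (1 - (cmod p)\<^sup>2 :: complex) = 1 - (cmod p)\<^sup>2"
    using one_minus_norm_pos[OF assms(1)] by (metis abs_of_pos norm_of_real of_real_1 of_real_diff)
  then have "cmod (moeb p z - moeb p w) = cmod (z - w) * (1 - (cmod p)\<^sup>2) / (cmod (1 + cnj p * z) * cmod (1 + cnj p * w))"
    by (simp add: moeb_diff[OF assms] norm_divide norm_mult)
  moreover have "(d * k / (a * b))\<^sup>2 / ((k * Z / a\<^sup>2) * (k * W / b\<^sup>2)) = d\<^sup>2 / (Z * W)"
    if "k > 0" "a > 0" "b > 0" "Z > 0" "W > 0" for d k a b Z W :: real
    using that by (simp add: field_simps power2_eq_square)
  ultimately have "(cmod (moeb p z - moeb p w))\<^sup>2 / ((1 - (cmod (moeb p z))\<^sup>2) * (1 - (cmod (moeb p w))\<^sup>2))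
     = (cmod (z - w))\<^sup>2 / ((1 - (cmod z)\<^sup>2) * (1 - (cmod w)\<^sup>2))"
    unfolding one_minus_norm_moeb[OF assms(1,2)] one_minus_norm_moeb[OF assms(1,3)]
    using one_minus_norm_pos[OF assms(1)] one_minus_norm_pos[OF assms(2)] one_minus_norm_pos[OF assms(3)]
      moeb_denom_nonzero[OF assms(1,2)] moeb_denom_nonzero[OF assms(1,3)] by simp
  then show ?thesis unfolding hdist_def times_divide_eq_right[symmetric] by simp
qed

lemma hdiam_moeb:
  assumes "p \<in> hplane" "S \<subseteq> hplane" shows "hdiam (moeb p ` S) = hdiam S"
  unfolding hdiam_def image_image using assms by (intro SUP_cong refl) (auto simp: hdist_moeb subset_iff)

lemma hausdorff_outer_moeb_le:
  assumes "p \<in> hplane" "A \<subseteq> hplane" shows "hausdorff_outer (moeb p ` A) \<le> hausdorff_outer A"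
  unfolding hausdorff_outer_def
proof (rule SUP_mono, rule bexI)
  fix \<delta> :: real assume "\<delta> \<in> {0<..}"
  show "hausdorff_content \<delta> (moeb p ` A) \<le> hausdorff_content \<delta> A"
  proof (rule hausdorff_content_greatest)
    fix C assume C: "cover \<delta> A C"
    then have Ch: "C i \<subseteq> hplane" for i by (simp add: cover_def)
    have "cover \<delta> (moeb p ` A) (\<lambda>i. moeb p ` C i)"
      unfolding cover_def
    proof (intro conjI allI)
      show "moeb p ` A \<subseteq> (\<Union>i. moeb p ` C i)" using C unfolding cover_def by blast
      show "moeb p ` C i \<subseteq> hplane" for i using Ch moeb_in_hplane[OF assms(1)] by blast
      show "hdiam (moeb p ` C i) \<le> ennreal \<delta>" for i
        using C hdiam_moeb[OF assms(1) Ch] by (simp add: cover_def)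
    qed
    from hausdorff_content_le[OF this]
    show "hausdorff_content \<delta> (moeb p ` A) \<le> (\<Sum>i. hdiam (C i))"
      by (simp add: hdiam_moeb[OF assms(1) Ch])
  qed
qed

lemma hausdorff_outer_moeb:
  assumes "p \<in> hplane" "A \<subseteq> hplane" shows "hausdorff_outer (moeb p ` A) = hausdorff_outer A"
proof (rule antisym)
  have "moeb (- p) ` moeb p ` A = A"
    using assms by (force simp: image_image moeb_uminus_moeb)
  moreover have "moeb p ` A \<subseteq> hplane" using assms moeb_in_hplane by blast
  ultimately show "hausdorff_outer A \<le> hausdorff_outer (moeb p ` A)"
    using hausdorff_outer_moeb_le[of "- p" "moeb p ` A"] assms by simp
qed (rule hausdorff_outer_moeb_le[OF assms])

lemma measurable_moeb_hyp_hausdorff [measurable]: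
  assumes "p \<in> hplane" shows "moeb p \<in> measurable hyp_hausdorff hyp_hausdorff"
proof -
  have "moeb p \<in> borel_measurable (restrict_space borel hplane)"
    by (rule borel_measurable_continuous_on_restrict[OF continuous_on_moeb[OF assms order_refl]])
  then have "moeb p \<in> measurable (restrict_space borel hplane) (restrict_space borel hplane)"
    using moeb_in_hplane[OF assms] by (intro measurable_restrict_space2) (auto simp: space_restrict_space)
  then show ?thesis by (simp add: measurable_cong_sets[OF sets_hyp_hausdorff sets_hyp_hausdorff])
qed

lemma distr_hyp_hausdorff_moeb:
  assumes "p \<in> hplane" shows "distr hyp_hausdorff hyp_hausdorff (moeb p) = hyp_hausdorff"
proof (rule measure_eqI)
  fix A assume "A \<in> sets (distr hyp_hausdorff hyp_hausdorff (moeb p))"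
  then have A: "A \<in> sets hyp_hausdorff" by simp
  then have sub: "A \<subseteq> hplane" using sets.sets_into_space[of A hyp_hausdorff] by (simp add: space_hyp_hausdorff)
  let ?B = "moeb p -` A \<inter> space hyp_hausdorff"
  have B: "?B \<in> sets hyp_hausdorff" using A assms by measurable
  have "moeb p ` ?B = A \<inter> moeb p ` hplane" by (auto simp: space_hyp_hausdorff)
  then have "moeb p ` ?B = A" using sub moeb_image_hplane[OF assms] by auto
  then have "hausdorff_outer A = hausdorff_outer ?B"
    using hausdorff_outer_moeb[OF assms, of ?B] by (simp add: space_hyp_hausdorff)
  then show "emeasure (distr hyp_hausdorff hyp_hausdorff (moeb p)) A = emeasure hyp_hausdorff A"
    using A B assms by (subst emeasure_distr) (auto simp: emeasure_hyp_hausdorff sets_hyp_hausdorff)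
qed simp

section \<open>Disks, exteriors and circles\<close>

lemma tanh_half_bounds:
  assumes "0 < R" shows "0 < tanh (R / 2 :: real)" "tanh (R / 2) < 1"
  using assms tanh_real_lt_1 by auto

lemma power2_less_power2_iff: "0 \<le> a \<Longrightarrow> 0 \<le> b \<Longrightarrow> a\<^sup>2 < b\<^sup>2 \<longleftrightarrow> a < (b::real)"
  by (meson power_less_imp_less_base power_strict_mono zero_less_numeral)

lemma geodesic_disk_0:
  assumes "0 < R" shows "geodesic_disk 0 R = ball 0 (tanh (R / 2))"
proof -
  have *: "hdist 0 z < R \<longleftrightarrow> cmod z < tanh (R / 2)" if z: "z \<in> hplane" for z
  proof -
    have z0: "0 \<in> hplane" by (simp add: hplane_iff)
    have p: "1 - (cmod z)\<^sup>2 > 0" by (rule one_minus_norm_pos[OF z])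
    have c: "cosh (R / 2) > 0" by (rule cosh_real_pos)
    have s: "sinh (R / 2) > 0" using assms by simp
    have "hdist 0 z < R \<longleftrightarrow> sinh (hdist 0 z / 2) < sinh (R / 2)" by simp
    also have "\<dots> \<longleftrightarrow> cmod z < sinh (R / 2) * sqrt (1 - (cmod z)\<^sup>2)"
      using p by (simp add: sinh_half_hdist[OF z0 z] pos_divide_less_eq)
    also have "\<dots> \<longleftrightarrow> (cmod z)\<^sup>2 < (sinh (R / 2) * sqrt (1 - (cmod z)\<^sup>2))\<^sup>2"
      using p s by (intro power2_less_power2_iff[symmetric]) auto
    also have "\<dots> \<longleftrightarrow> (cmod z)\<^sup>2 < (sinh (R / 2))\<^sup>2 * (1 - (cmod z)\<^sup>2)"
      using p by (simp add: power_mult_distrib)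
    also have "\<dots> \<longleftrightarrow> (cmod z)\<^sup>2 * (cosh (R / 2))\<^sup>2 < (sinh (R / 2))\<^sup>2"
      by (simp add: cosh_square_eq algebra_simps)
    also have "\<dots> \<longleftrightarrow> (cmod z * cosh (R / 2))\<^sup>2 < (sinh (R / 2))\<^sup>2"
      by (simp add: power_mult_distrib)
    also have "\<dots> \<longleftrightarrow> cmod z * cosh (R / 2) < sinh (R / 2)"
      using c s by (intro power2_less_power2_iff) auto
    also have "\<dots> \<longleftrightarrow> cmod z < tanh (R / 2)"
      using c by (simp add: tanh_def pos_less_divide_eq)
    finally show ?thesis .
  qed
  show ?thesis
    using * tanh_half_bounds[OF assms] by (auto simp: geodesic_disk_def hplane_iff)
qed

lemma geodesic_disk_moeb:
  assumes "p \<in> hplane" shows "geodesic_disk p R = moeb p ` geodesic_disk 0 R"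
proof (rule set_eqI)
  fix z
  have z0: "0 \<in> hplane" by (simp add: hplane_iff)
  have "hdist p z = hdist 0 (moeb (- p) z)" if "z \<in> hplane" for z
    using hdist_moeb[OF assms z0 moeb_in_hplane[of "- p" z]] that assms by (simp add: moeb_moeb_uminus)
  then have "z \<in> moeb p ` geodesic_disk 0 R" if "z \<in> geodesic_disk p R"
    using that assms moeb_in_hplane moeb_moeb_uminus[OF assms, of z]
    by (intro image_eqI[of _ _ "moeb (- p) z"]) (auto simp: geodesic_disk_def)
  moreover have "z \<in> geodesic_disk p R" if "z \<in> moeb p ` geodesic_disk 0 R"
    using that assms hdist_moeb[OF assms z0] moeb_in_hplane by (auto simp: geodesic_disk_def)
  ultimately show "z \<in> geodesic_disk p R \<longleftrightarrow> z \<in> moeb p ` geodesic_disk 0 R" by blast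
qed

lemma closure_geodesic_disk:
  assumes "p \<in> hplane" "0 < R"
  shows "closure (geodesic_disk p R) = moeb p ` cball 0 (tanh (R / 2))"
proof -
  let ?\<rho> = "tanh (R / 2)"
  note \<rho> = tanh_half_bounds[OF assms(2)]
  have sub: "cball 0 ?\<rho> \<subseteq> hplane" using \<rho> by (auto simp: hplane_iff)
  have D: "geodesic_disk p R = moeb p ` ball 0 ?\<rho>"
    using assms by (simp add: geodesic_disk_moeb geodesic_disk_0)
  \<comment> \<open>The image of the closed Euclidean disk is compact, so it is closed in the whole plane and not only in the model.\<close>
  have "compact (moeb p ` cball 0 ?\<rho>)"
    by (intro compact_continuous_image continuous_on_moeb assms sub compact_cball)
  then have "closure (geodesic_disk p R) \<subseteq> moeb p ` cball 0 ?\<rho>"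
    by (intro closure_minimal compact_imp_closed) (auto simp: D)
  moreover have "moeb p ` closure (ball 0 ?\<rho>) \<subseteq> closure (moeb p ` ball 0 ?\<rho>)"
    using \<rho> sub by (intro image_closure_subset[OF continuous_on_moeb[OF assms(1)] closed_closure closure_subset]) auto
  ultimately show ?thesis using \<rho> by (simp add: D)
qed

lemma exterior_geodesic_disk:
  assumes "p \<in> hplane" "0 < R"
  shows "exterior (geodesic_disk p R) = moeb p ` {z \<in> hplane. tanh (R / 2) < cmod z}"
proof -
  have sub: "cball 0 (tanh (R / 2)) \<subseteq> hplane" using tanh_half_bounds[OF assms(2)] by (auto simp: hplane_iff)
  have "exterior (geodesic_disk p R) = moeb p ` hplane - moeb p ` cball 0 (tanh (R / 2))"
    unfolding exterior_def closure_geodesic_disk[OF assms] by (simp add: moeb_image_hplane[OF assms(1)])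
  also have "\<dots> = moeb p ` (hplane - cball 0 (tanh (R / 2)))"
    using inj_on_image_set_diff[OF inj_on_moeb[OF assms(1)], of hplane] sub by simp
  also have "hplane - cball 0 (tanh (R / 2)) = {z \<in> hplane. tanh (R / 2) < cmod z}" by auto
  finally show ?thesis .
qed

lemma open_exterior: "open (exterior \<Omega>)"
  by (simp add: exterior_def open_Diff)

lemma exterior_subset_hplane: "exterior \<Omega> \<subseteq> hplane"
  by (auto simp: exterior_def)

text \<open>A point of the image circle is approached from outside along its own radius in the centred picture; the
points \<open>x n\<close> below have norm between \<open>tanh (R / 2)\<close> and 1.\<close>

lemma hboundary_exterior:
  assumes "p \<in> hplane" "0 < R"
  shows "hboundary (exterior (geodesic_disk p R)) = moeb p ` sphere 0 (tanh (R / 2))"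
proof -
  let ?\<rho> = "tanh (R / 2)" and ?U = "exterior (geodesic_disk p R)"
  note \<rho> = tanh_half_bounds[OF assms(2)]
  have U: "?U = hplane - moeb p ` cball 0 ?\<rho>"
    by (simp add: exterior_def closure_geodesic_disk[OF assms])
  have fr: "frontier ?U = closure ?U - ?U"
    using open_exterior[of "geodesic_disk p R"] by (simp add: frontier_def interior_open)
  show ?thesis
  proof
    show "hboundary ?U \<subseteq> moeb p ` sphere 0 ?\<rho>"
    proof
      fix z assume "z \<in> hboundary ?U"
      then have z: "z \<in> closure ?U" "z \<in> hplane" "z \<notin> ?U" by (auto simp: hboundary_def fr)
      then obtain w where w: "z = moeb p w" "cmod w \<le> ?\<rho>" by (auto simp: U)
      have "w \<notin> ball 0 ?\<rho>"
      proof
        assume "w \<in> ball 0 ?\<rho>"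
        then have "z \<in> geodesic_disk p R"
          using w assms by (simp add: geodesic_disk_moeb geodesic_disk_0)
        moreover have "open (geodesic_disk p R)"
          using assms \<rho> unfolding geodesic_disk_moeb[OF assms(1)] geodesic_disk_0[OF assms(2)]
          by (intro open_mapping_thm3[of "moeb p"] holomorphic_on_subset[OF holomorphic_moeb] inj_on_subset[OF inj_on_moeb])
             (auto simp: hplane_iff)
        moreover have "geodesic_disk p R \<inter> ?U = {}"
          using closure_subset[of "geodesic_disk p R"] by (auto simp: exterior_def)
        ultimately show False using z(1) open_Int_closure_eq_empty by blast
      qed
      then show "z \<in> moeb p ` sphere 0 ?\<rho>" using w by (auto simp: dist_norm)
    qed
    show "moeb p ` sphere 0 ?\<rho> \<subseteq> hboundary ?U"
    proof
      fix z assume "z \<in> moeb p ` sphere 0 ?\<rho>"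
      then obtain w where w: "z = moeb p w" "cmod w = ?\<rho>" by auto
      have wh: "w \<in> hplane" using w \<rho> by (simp add: hplane_iff)
      define x where "x n = w * of_real (1 + (1 / ?\<rho> - 1) / real (n + 2))" for n
      have nx: "cmod (x n) = ?\<rho> + (1 - ?\<rho>) / real (n + 2)" for n
      proof -
        have "r * \<bar>1 + (1 / r - 1) / m\<bar> = r + (1 - r) / m" if "0 < r" "r < 1" "0 < m" for r m :: real
        proof -
          have "0 \<le> 1 + (1 / r - 1) / m" using that by (intro add_nonneg_nonneg divide_nonneg_pos) auto
          then show ?thesis using that by (simp add: field_simps)
        qed
        from this[OF \<rho>, of "real (n + 2)"] show ?thesis using w(2) unfolding x_def norm_mult norm_of_real by simp
      qed
      have x_in: "x n \<in> {z \<in> hplane. ?\<rho> < cmod z}" for n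
      proof -
        have "(1 - ?\<rho>) / real (n + 2) < (1 - ?\<rho>) / 1"
          using \<rho> by (intro divide_strict_left_mono) auto
        moreover have "0 < (1 - ?\<rho>) / real (n + 2)" using \<rho> by simp
        ultimately show ?thesis unfolding mem_Collect_eq hplane_iff nx by simp
      qed
      have "x \<longlonglongrightarrow> w * of_real (1 + 0)"
        unfolding x_def
        by (intro tendsto_intros real_tendsto_divide_at_top[OF tendsto_const]
            filterlim_compose[OF filterlim_real_sequentially filterlim_add_const_nat_at_top])
      then have lim: "x \<longlonglongrightarrow> w" by simp
      have "isCont (moeb p) w"
        using continuous_on_moeb[OF assms(1) order_refl] wh by (simp add: continuous_on_eq_continuous_at)
      then have "(\<lambda>n. moeb p (x n)) \<longlonglongrightarrow> z" unfolding w(1) using lim by (rule isCont_tendsto_compose)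
      moreover have "moeb p (x n) \<in> ?U" for n unfolding exterior_geodesic_disk[OF assms] using x_in by blast
      ultimately have "z \<in> closure ?U"
        unfolding closure_sequential by (intro exI[of _ "\<lambda>n. moeb p (x n)"]) auto
      moreover have "z \<notin> ?U" unfolding U using w by auto
      moreover have "z \<in> hplane" using w wh assms moeb_in_hplane by simp
      ultimately show "z \<in> hboundary ?U" unfolding hboundary_def fr by blast
    qed
  qed
qed

lemma test_function_moeb:
  assumes p: "p \<in> hplane" and \<phi>: "\<phi> \<in> test_functions hplane"
  shows "(\<lambda>z. if z \<in> hplane then \<phi> (moeb p z) else 0) \<in> test_functions hplane"
proof -
  obtain K where K: "compact K" "K \<subseteq> hplane" "\<And>z. z \<notin> K \<Longrightarrow> \<phi> z = 0"
    using \<phi> unfolding test_functions_def by blast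
  have mp: "- p \<in> hplane" using p by simp
  show ?thesis
  proof (rule test_functionsI[of _ "moeb (- p) ` K"])
    show "compact (moeb (- p) ` K)" by (intro compact_continuous_image continuous_on_moeb mp K)
    show "moeb (- p) ` K \<subseteq> hplane" using moeb_in_hplane[OF mp] K(2) by blast
    fix z assume "z \<notin> moeb (- p) ` K"
    then show "(if z \<in> hplane then \<phi> (moeb p z) else 0) = 0"
      using moeb_uminus_moeb[OF p, of z] K(3)[of "moeb p z"] by (metis imageI)
  next
    fix k
    have "Ck_on k hplane (\<lambda>z. \<phi> (moeb p z))"
      by (rule Ck_on_compose[OF open_hplane open_hplane _ test_function_Ck_on[OF \<phi>]
            Ck_on_holomorphic[OF open_hplane holomorphic_moeb[OF p]]]) (rule moeb_in_hplane[OF p])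
    then show "Ck_on k hplane (\<lambda>z. if z \<in> hplane then \<phi> (moeb p z) else 0)"
      by (rule Ck_on_cong[OF open_hplane, rotated]) simp
  qed simp
qed

text \<open>In the coordinates \<open>s\<close> and \<open>\<theta>\<close> the hyperbolic metric is \<open>(hcirc s)\<^sup>2 (ds\<^sup>2 + d\<theta>\<^sup>2)\<close>. Being conformal,
they leave the Dirichlet integral in its Euclidean form.\<close>

definition logpolar :: "real \<Rightarrow> real \<Rightarrow> complex" where
  "logpolar s \<theta> = exp (Complex s \<theta>)"

text \<open>For \<open>exp s = tanh (r / 2)\<close> this is \<open>sinh r\<close>, the length of the circle of radius \<open>r\<close> divided by \<open>2 \<pi>\<close>;
moreover \<open>cosh s = coth r\<close>.\<close>

definition hcirc :: "real \<Rightarrow> real" where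
  "hcirc s = - 1 / sinh s"

lemma norm_logpolar [simp]: "cmod (logpolar s \<theta>) = exp s"
  by (simp add: logpolar_def)

lemma continuous_on_logpolar [continuous_intros]:
  "continuous_on A f \<Longrightarrow> continuous_on A g \<Longrightarrow> continuous_on A (\<lambda>x. logpolar (f x) (g x))"
  unfolding logpolar_def Complex_eq by (intro continuous_intros)

lemma hcirc_pos: "s < 0 \<Longrightarrow> 0 < hcirc s"
  by (simp add: hcirc_def divide_neg_neg)

lemma conf_logpolar:
  assumes "s < 0" shows "conf (logpolar s \<theta>) * exp s = hcirc s"
proof -
  define x where "x = exp s"
  have x: "0 < x" "x < 1" using assms by (auto simp: x_def)
  have "x * x < 1 * 1" using x by (intro mult_strict_mono) auto
  then have d: "1 - x * x \<noteq> 0" by simp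
  have "x - inverse x = - ((1 - x * x) / x)" using x by (simp add: diff_divide_distrib inverse_eq_divide)
  then have "- 1 / ((x - inverse x) / 2) = 2 / (1 - x * x) * x" using x d by simp
  then show ?thesis by (simp add: conf_def hcirc_def sinh_def exp_minus x_def power2_eq_square)
qed

section \<open>Hausdorff measure of circles\<close>

lemma logpolar_in_hplane: "s < 0 \<Longrightarrow> logpolar s \<theta> \<in> hplane"
  by (simp add: hplane_iff)

lemma norm_logpolar_diff: "cmod (logpolar s \<theta> - logpolar s \<phi>) = 2 * exp s * \<bar>sin ((\<theta> - \<phi>) / 2)\<bar>"
proof -
  have "Complex s \<theta> = Complex s \<phi> + \<i> * of_real (\<theta> - \<phi>)" by (simp add: complex_eq_iff)
  then have "logpolar s \<theta> = logpolar s \<phi> * exp (\<i> * of_real (\<theta> - \<phi>))"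
    unfolding logpolar_def by (simp add: exp_add)
  then have "logpolar s \<theta> - logpolar s \<phi> = logpolar s \<phi> * (exp (\<i> * of_real (\<theta> - \<phi>)) - 1)"
    by (simp add: algebra_simps)
  then show ?thesis using dist_exp_i_1[of "\<theta> - \<phi>"] by (simp add: norm_mult)
qed

text \<open>The hyperbolic chord formula. It is the only relation between distance and angle that the length
of a circle needs.\<close>

lemma sinh_half_hdist_logpolar:
  assumes "s < 0"
  shows "sinh (hdist (logpolar s \<theta>) (logpolar s \<phi>) / 2) = hcirc s * \<bar>sin ((\<theta> - \<phi>) / 2)\<bar>"
proof -
  have "0 < 1 - (exp s)\<^sup>2" using one_minus_norm_pos[OF logpolar_in_hplane[OF assms, of 0]] by simp
  then have "sqrt ((1 - (exp s)\<^sup>2) * (1 - (exp s)\<^sup>2)) = 1 - (exp s)\<^sup>2" by (simp add: real_sqrt_mult_self)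
  moreover have "2 * exp s / (1 - (exp s)\<^sup>2) = hcirc s"
    using conf_logpolar[OF assms, of 0] by (simp add: conf_def)
  ultimately have "2 * exp s * x / sqrt ((1 - (exp s)\<^sup>2) * (1 - (exp s)\<^sup>2)) = hcirc s * x" for x
    by (metis times_divide_eq_left)
  then show ?thesis
    unfolding sinh_half_hdist[OF logpolar_in_hplane[OF assms] logpolar_in_hplane[OF assms]] norm_logpolar_diff
      norm_logpolar .
qed

lemma le_sinh: "0 \<le> x \<Longrightarrow> x \<le> sinh (x::real)"
proof -
  assume x: "0 \<le> x"
  have "sinh 0 - 0 \<le> sinh x - x"
  proof (rule DERIV_nonneg_imp_nondecreasing[OF x])
    fix t :: real
    have "((\<lambda>x. sinh x - x) has_real_derivative cosh t - 1) (at t)"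
      by (auto intro!: derivative_eq_intros)
    then show "\<exists>y. ((\<lambda>x. sinh x - x) has_real_derivative y) (at t) \<and> 0 \<le> y"
      using cosh_real_ge_1[of t] by (intro exI[of _ "cosh t - 1"]) auto
  qed
  then show ?thesis by simp
qed

lemma hdist_logpolar_le:
  assumes "s < 0"
  shows "hdist (logpolar s \<theta>) (logpolar s \<phi>) \<le> hcirc s * \<bar>\<theta> - \<phi>\<bar>"
proof -
  let ?d = "hdist (logpolar s \<theta>) (logpolar s \<phi>)"
  have "0 \<le> ?d" by (intro hdist_nonneg logpolar_in_hplane assms)
  then have "?d / 2 \<le> sinh (?d / 2)" by (intro le_sinh) simp
  also have "\<dots> = hcirc s * \<bar>sin ((\<theta> - \<phi>) / 2)\<bar>" by (rule sinh_half_hdist_logpolar[OF assms])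
  also have "\<dots> \<le> hcirc s * \<bar>(\<theta> - \<phi>) / 2\<bar>"
    using hcirc_pos[OF assms] abs_sin_x_le_abs_x[of "(\<theta> - \<phi>) / 2"] by (intro mult_left_mono) auto
  finally show ?thesis by (simp add: abs_mult)
qed

lemma sphere_eq_logpolar: "(sphere 0 (exp s) :: complex set) = logpolar s ` {0..2 * pi}"
proof
  show "(sphere 0 (exp s) :: complex set) \<subseteq> logpolar s ` {0..2 * pi}"
  proof
    fix z :: complex assume "z \<in> sphere 0 (exp s)"
    then have z: "cmod z = exp s" by simp
    have "logpolar s (Arg2pi z) = of_real (cmod z) * exp (\<i> * of_real (Arg2pi z))"
      by (simp add: logpolar_def Complex_eq exp_add z exp_of_real)
    also have "\<dots> = z" using Arg2pi_eq[of z] by simp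
    finally show "z \<in> logpolar s ` {0..2 * pi}"
      using Arg2pi_ge_0[of z] Arg2pi_lt_2pi[of z] by (intro image_eqI[of _ _ "Arg2pi z"]) auto
  qed
qed auto

text \<open>Cut the circle into equal arcs; the diameter of an arc is at most its length.\<close>

lemma hausdorff_outer_circle_le:
  assumes s: "s < 0"
  shows "hausdorff_outer (sphere 0 (exp s)) \<le> ennreal (2 * pi * hcirc s)"
  unfolding hausdorff_outer_def
proof (rule SUP_least)
  fix \<delta> :: real assume "\<delta> \<in> {0<..}"
  then have \<delta>: "0 < \<delta>" by simp
  define L where "L = 2 * pi * hcirc s"
  have L: "0 < L" using hcirc_pos[OF s] by (simp add: L_def)
  obtain n :: nat where n: "L / \<delta> < real n" using reals_Archimedean2 by blast
  then have n0: "0 < n" using L \<delta> by (metis divide_pos_pos less_trans of_nat_0_less_iff)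
  have Ln: "L / real n \<le> \<delta>" using n n0 \<delta> by (simp add: field_simps)
  define I where "I i = {2 * pi * real i / real n..2 * pi * real (Suc i) / real n}" for i
  define C where "C i = (if i < n then logpolar s ` I i else {})" for i
  have diam: "hdiam (C i) \<le> ennreal (if i < n then L / real n else 0)" for i
  proof -
    have "ennreal (hdist z w) \<le> ennreal (L / real n)" if zw: "z \<in> logpolar s ` I i" "w \<in> logpolar s ` I i" for z w
    proof -
      obtain \<theta> \<phi> where *: "z = logpolar s \<theta>" "w = logpolar s \<phi>" "\<theta> \<in> I i" "\<phi> \<in> I i" using zw by blast
      have "2 * pi * real (Suc i) / real n - 2 * pi * real i / real n = 2 * pi / real n"
        by (simp add: diff_divide_distrib[symmetric] algebra_simps)
      then have "\<bar>\<theta> - \<phi>\<bar> \<le> 2 * pi / real n" using *(3,4) by (auto simp: I_def abs_le_iff)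
      then have "hcirc s * \<bar>\<theta> - \<phi>\<bar> \<le> hcirc s * (2 * pi / real n)" using hcirc_pos[OF s] by (intro mult_left_mono) auto
      then have "hdist z w \<le> L / real n"
        using hdist_logpolar_le[OF s, of \<theta> \<phi>] * by (simp add: L_def mult.commute)
      then show ?thesis by (rule ennreal_leI)
    qed
    then show ?thesis by (auto simp: C_def hdiam_def bot_ennreal intro!: SUP_least)
  qed
  have "cover \<delta> (sphere 0 (exp s)) C"
    unfolding cover_def
  proof (intro conjI allI)
    show "sphere 0 (exp s) \<subseteq> (\<Union>i. C i)"
      unfolding sphere_eq_logpolar
    proof (rule image_subsetI)
      fix \<theta> assume \<theta>: "\<theta> \<in> {0..2 * pi}"
      define i where "i = min (nat \<lfloor>\<theta> * real n / (2 * pi)\<rfloor>) (n - 1)"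
      have x0: "0 \<le> \<theta> * real n / (2 * pi)" using \<theta> by simp
      have xn: "\<theta> * real n / (2 * pi) \<le> real n" using \<theta> n0 by (simp add: field_simps)
      have "real i \<le> \<theta> * real n / (2 * pi)"
        using of_nat_floor[OF x0] unfolding i_def by linarith
      moreover have "\<theta> * real n / (2 * pi) \<le> real (Suc i)"
      proof (cases "nat \<lfloor>\<theta> * real n / (2 * pi)\<rfloor> \<le> n - 1")
        case True
        then show ?thesis using x0 unfolding i_def by simp linarith
      next
        case False
        then show ?thesis using xn n0 unfolding i_def by simp
      qed
      ultimately have "\<theta> \<in> I i" using n0 by (simp add: I_def field_simps)
      moreover have "i < n" using n0 by (simp add: i_def)
      ultimately show "logpolar s \<theta> \<in> (\<Union>i. C i)" by (auto simp: C_def intro!: exI[of _ i])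
    qed
    show "C i \<subseteq> hplane" for i using logpolar_in_hplane[OF s] by (auto simp: C_def)
    show "hdiam (C i) \<le> ennreal \<delta>" for i
      using diam[of i] Ln \<delta> by (auto intro: order_trans ennreal_leI split: if_splits simp: C_def)
  qed
  then have "hausdorff_content \<delta> (sphere 0 (exp s)) \<le> (\<Sum>i. hdiam (C i))" by (rule hausdorff_content_le)
  also have "\<dots> \<le> (\<Sum>i. ennreal (if i < n then L / real n else 0))" by (intro suminf_le diam) auto
  also have "\<dots> = (\<Sum>i<n. ennreal (L / real n))"
    by (subst suminf_finite[of "{..<n}"]) auto
  also have "\<dots> = ennreal L" using n0 L by (subst sum_ennreal) auto
  finally show "hausdorff_content \<delta> (sphere 0 (exp s)) \<le> ennreal (2 * pi * hcirc s)" by (simp add: L_def)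
qed

text \<open>By the chord formula the arc between two points at distance \<open>d\<close> has length \<open>q d\<close> with
\<open>q d = 2 L arcsin (sinh (d / 2) / L)\<close>, and \<open>q\<close> has derivative 1 at 0.\<close>

lemma arc_le_hdist_locally:
  assumes s: "s < 0" and \<epsilon>: "0 < \<epsilon>"
  obtains \<delta> where "0 < \<delta>"
    "\<And>\<theta> \<phi>. \<bar>\<theta> - \<phi>\<bar> < pi \<Longrightarrow> hdist (logpolar s \<theta>) (logpolar s \<phi>) \<le> \<delta> \<Longrightarrow>
       hcirc s * \<bar>\<theta> - \<phi>\<bar> \<le> (1 + \<epsilon>) * hdist (logpolar s \<theta>) (logpolar s \<phi>)"
proof -
  define L where "L = hcirc s"
  have L: "0 < L" using hcirc_pos[OF s] by (simp add: L_def)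
  \<comment> \<open>The length of the arc over a chord of hyperbolic length \<open>x\<close>.\<close>
  define q where "q x = 2 * L * arcsin (sinh (x / 2) / L)" for x
  have "(q has_real_derivative 1) (at 0)"
    unfolding q_def[abs_def] using L by (auto intro!: derivative_eq_intros)
  then have "((\<lambda>x. (q x - q 0) / (x - 0)) \<longlongrightarrow> 1) (at 0)"
    by (simp add: has_field_derivative_iff)
  then have "\<forall>\<^sub>F x in at 0. dist ((q x - q 0) / (x - 0)) 1 < \<epsilon>"
    using \<epsilon> by (rule tendstoD)
  then obtain d where d: "0 < d" "\<And>x. x \<noteq> 0 \<Longrightarrow> \<bar>x\<bar> < d \<Longrightarrow> dist ((q x - q 0) / (x - 0)) 1 < \<epsilon>"
    by (auto simp: eventually_at)
  have q_le: "q x \<le> (1 + \<epsilon>) * x" if "0 \<le> x" "x < d" for x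
  proof (cases "x = 0")
    case False
    then have "\<bar>q x / x - 1\<bar> < \<epsilon>" using d(2)[of x] that by (simp add: dist_real_def q_def)
    then have "q x / x \<le> 1 + \<epsilon>" by linarith
    then show ?thesis using False that by (simp add: field_simps)
  qed (simp add: q_def)
  show ?thesis
  proof (rule that[of "d / 2"])
    show "0 < d / 2" using d by simp
    fix \<theta> \<phi> :: real
    let ?D = "hdist (logpolar s \<theta>) (logpolar s \<phi>)"
    assume close: "\<bar>\<theta> - \<phi>\<bar> < pi" and D: "?D \<le> d / 2"
    have D0: "0 \<le> ?D" by (intro hdist_nonneg logpolar_in_hplane s)
    have "\<bar>sin ((\<theta> - \<phi>) / 2)\<bar> = sin (\<bar>\<theta> - \<phi>\<bar> / 2)"
    proof (cases "\<theta> \<ge> \<phi>")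
      case True
      then have "0 \<le> sin ((\<theta> - \<phi>) / 2)" using close by (intro sin_ge_zero) auto
      then show ?thesis using True by simp
    next
      case False
      have "0 \<le> sin ((\<phi> - \<theta>) / 2)" using False close by (intro sin_ge_zero) auto
      moreover have "sin ((\<theta> - \<phi>) / 2) = - sin ((\<phi> - \<theta>) / 2)"
        by (metis minus_diff_eq minus_divide_left sin_minus)
      ultimately show ?thesis using False by simp
    qed
    then have "sinh (?D / 2) / L = sin (\<bar>\<theta> - \<phi>\<bar> / 2)"
      using sinh_half_hdist_logpolar[OF s, of \<theta> \<phi>] L by (simp add: L_def)
    then have "arcsin (sinh (?D / 2) / L) = \<bar>\<theta> - \<phi>\<bar> / 2"
      using close by (simp add: arcsin_sin)
    then have "q ?D = L * \<bar>\<theta> - \<phi>\<bar>" by (simp add: q_def)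
    then show "hcirc s * \<bar>\<theta> - \<phi>\<bar> \<le> (1 + \<epsilon>) * ?D"
      using q_le[OF D0] D d(1) by (simp add: L_def)
  qed
qed

text \<open>On half of the circle two points determine their angle difference without ambiguity modulo \<open>2 \<pi>\<close>. So a
set of small diameter meets it in angles from an interval of almost the corresponding length, and the
intervals of a covering bound the Lebesgue measure.\<close>

lemma half_arc_le_hausdorff_outer:
  assumes s: "s < 0" and T: "{\<theta> \<in> {h..<h + pi}. logpolar s \<theta> \<in> E} \<in> sets borel"
  shows "ennreal (hcirc s) * emeasure lborel {\<theta> \<in> {h..<h + pi}. logpolar s \<theta> \<in> E} \<le> hausdorff_outer E"
proof -
  let ?T = "{\<theta> \<in> {h..<h + pi}. logpolar s \<theta> \<in> E}"
  define L where "L = hcirc s"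
  have L: "0 < L" using hcirc_pos[OF s] by (simp add: L_def)
  have "ennreal L * emeasure lborel ?T \<le> ennreal (1 + \<epsilon>) * hausdorff_outer E" if \<epsilon>: "0 < \<epsilon>" for \<epsilon>
  proof -
    obtain \<delta> where \<delta>: "0 < \<delta>"
      "\<And>\<theta> \<phi>. \<bar>\<theta> - \<phi>\<bar> < pi \<Longrightarrow> hdist (logpolar s \<theta>) (logpolar s \<phi>) \<le> \<delta> \<Longrightarrow>
         L * \<bar>\<theta> - \<phi>\<bar> \<le> (1 + \<epsilon>) * hdist (logpolar s \<theta>) (logpolar s \<phi>)"
      using arc_le_hdist_locally[OF s \<epsilon>] unfolding L_def by blast
    have "ennreal L * emeasure lborel ?T / ennreal (1 + \<epsilon>) \<le> hausdorff_content \<delta> E"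
    proof (rule hausdorff_content_greatest)
      fix C assume C: "cover \<delta> E C"
      define Q where "Q i l u \<longleftrightarrow> {\<theta> \<in> {h..<h + pi}. logpolar s \<theta> \<in> C i} \<subseteq> {l..u} \<and> l \<le> u \<and>
          ennreal (L * (u - l)) \<le> ennreal (1 + \<epsilon>) * hdiam (C i)" for i l u
      have ex: "\<exists>l u. Q i l u" for i
      proof -
        let ?X = "{\<theta> \<in> {h..<h + pi}. logpolar s \<theta> \<in> C i}"
        have "hdiam (C i) \<le> ennreal \<delta>" using C by (simp add: cover_def)
        then obtain D where D: "hdiam (C i) = ennreal D" "0 \<le> D" "D \<le> \<delta>"
          using \<delta>(1) by (cases "hdiam (C i)" rule: ennreal_cases) (auto simp: top_unique)
        have pair: "L * \<bar>\<theta> - \<phi>\<bar> \<le> (1 + \<epsilon>) * D" if "\<theta> \<in> ?X" "\<phi> \<in> ?X" for \<theta> \<phi>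
        proof -
          have "ennreal (hdist (logpolar s \<theta>) (logpolar s \<phi>)) \<le> ennreal D"
            using hdist_le_hdiam[of "logpolar s \<theta>" "C i" "logpolar s \<phi>"] that D by simp
          then have le: "hdist (logpolar s \<theta>) (logpolar s \<phi>) \<le> D" using D by simp
          have "L * \<bar>\<theta> - \<phi>\<bar> \<le> (1 + \<epsilon>) * hdist (logpolar s \<theta>) (logpolar s \<phi>)"
            using that le D by (intro \<delta>(2)) auto
          also have "\<dots> \<le> (1 + \<epsilon>) * D" using le \<epsilon> by (intro mult_left_mono) auto
          finally show ?thesis .
        qed
        define w where "w = (1 + \<epsilon>) * D / L"
        have w: "0 \<le> w" "L * w = (1 + \<epsilon>) * D" using D \<epsilon> L by (auto simp: w_def)
        have rhs: "ennreal (L * w) \<le> ennreal (1 + \<epsilon>) * hdiam (C i)"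
          using w \<epsilon> D by (simp add: ennreal_mult)
        show ?thesis
        proof (cases "?X = {}")
          case True
          then show ?thesis unfolding Q_def using rhs w by (intro exI[of _ 0] exI[of _ w]) auto
        next
          case False
          have bdd: "bdd_below ?X" by (rule bdd_belowI[of _ h]) auto
          have "\<theta> \<in> {Inf ?X..Inf ?X + w}" if "\<theta> \<in> ?X" for \<theta>
          proof -
            have "\<theta> - w \<le> Inf ?X"
            proof (rule cInf_greatest[OF False])
              fix \<phi> assume "\<phi> \<in> ?X"
              then have "L * (\<theta> - \<phi>) \<le> L * w" using pair[OF that, of \<phi>] L w(2)
                by (metis abs_ge_self mult_left_mono order_trans less_imp_le)
              then show "\<theta> - w \<le> \<phi>" using L by simp
            qed
            then show ?thesis using cInf_lower[OF that bdd] by simp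
          qed
          then show ?thesis unfolding Q_def using rhs w by (intro exI[of _ "Inf ?X"] exI[of _ "Inf ?X + w"]) auto
        qed
      qed
      then obtain l u where "\<And>i. Q i (l i) (u i)" by metis
      then have lu: "\<And>i. {\<theta> \<in> {h..<h + pi}. logpolar s \<theta> \<in> C i} \<subseteq> {l i..u i}" "\<And>i. l i \<le> u i"
          "\<And>i. ennreal (L * (u i - l i)) \<le> ennreal (1 + \<epsilon>) * hdiam (C i)" by (simp_all add: Q_def)
      have sub: "?T \<subseteq> (\<Union>i. {l i..u i})"
      proof
        fix \<theta> assume \<theta>: "\<theta> \<in> ?T"
        then have "logpolar s \<theta> \<in> (\<Union>i. C i)" using C unfolding cover_def by auto
        then obtain i where "logpolar s \<theta> \<in> C i" by auto
        then have "\<theta> \<in> {l i..u i}" using \<theta> lu(1)[of i] by auto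
        then show "\<theta> \<in> (\<Union>i. {l i..u i})" by auto
      qed
      have "emeasure lborel ?T \<le> emeasure lborel (\<Union>i. {l i..u i})"
        by (rule emeasure_mono[OF sub]) auto
      also have "\<dots> \<le> (\<Sum>i. emeasure lborel {l i..u i})" by (rule emeasure_subadditive_countably) auto
      also have "\<dots> = (\<Sum>i. ennreal (u i - l i))" using lu(2) by simp
      finally have "ennreal L * emeasure lborel ?T \<le> ennreal L * (\<Sum>i. ennreal (u i - l i))"
        by (intro mult_left_mono) auto
      also have "\<dots> = (\<Sum>i. ennreal (L * (u i - l i)))"
        using L lu(2) by (subst ennreal_suminf_cmult[symmetric]) (auto simp: ennreal_mult)
      also have "\<dots> \<le> (\<Sum>i. ennreal (1 + \<epsilon>) * hdiam (C i))" by (intro suminf_le lu(3)) auto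
      also have "\<dots> = (\<Sum>i. hdiam (C i)) * ennreal (1 + \<epsilon>)" by (simp add: mult.commute)
      finally show "ennreal L * emeasure lborel ?T / ennreal (1 + \<epsilon>) \<le> (\<Sum>i. hdiam (C i))"
        by (intro divide_le_posI_ennreal; (subst ennreal_less_zero_iff)?) (use \<epsilon> in \<open>auto simp: mult.commute\<close>)
    qed
    also have "\<dots> \<le> hausdorff_outer E" by (rule hausdorff_content_le_outer[OF \<delta>(1)])
    finally have le: "ennreal L * emeasure lborel ?T / ennreal (1 + \<epsilon>) \<le> hausdorff_outer E" .
    have "ennreal L * emeasure lborel ?T = ennreal (1 + \<epsilon>) * (ennreal L * emeasure lborel ?T / ennreal (1 + \<epsilon>))"
      unfolding ennreal_times_divide mult.commute[of "ennreal (1 + \<epsilon>)"]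
      using \<epsilon> by (intro mult_divide_eq_ennreal[symmetric]) (auto simp del: ennreal_plus)
    then show ?thesis using mult_left_mono[OF le, of "ennreal (1 + \<epsilon>)"] by simp
  qed
  note main = this
  show ?thesis
  proof (cases "hausdorff_outer E" rule: ennreal_cases)
    case (real r)
    show ?thesis
    proof (rule ennreal_le_epsilon)
      fix e :: real assume e: "0 < e"
      have "ennreal L * emeasure lborel ?T \<le> ennreal (1 + e / (r + 1)) * ennreal r"
        using main[of "e / (r + 1)"] real e by simp
      also have "\<dots> = ennreal (r + e * (r / (r + 1)))"
        using real(1) e by (subst ennreal_mult[symmetric]) (auto simp: field_simps)
      also have "\<dots> \<le> ennreal (r + e)"
        using real(1) e by (intro ennreal_leI add_left_mono mult_right_le_one_le) auto
      finally show "ennreal (hcirc s) * emeasure lborel ?T \<le> hausdorff_outer E + ennreal e"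
        using real e by (simp add: L_def)
    qed
  qed simp
qed

lemma measurable_logpolar [measurable]: "logpolar s \<in> borel_measurable borel"
  by (intro borel_measurable_continuous_onI continuous_intros)

lemma arc_le_hausdorff_outer:
  assumes s: "s < 0" and E: "E \<in> sets borel" "E \<subseteq> hplane"
  shows "ennreal (hcirc s) * emeasure lborel {\<theta> \<in> {0..<2 * pi}. logpolar s \<theta> \<in> E} \<le> hausdorff_outer E"
proof -
  \<comment> \<open>\<open>P\<close> and its complement contain the half-open upper and lower half of the circle.\<close>
  define P where "P = {z. 0 \<le> Im z} - {- of_real (exp s) :: complex}"
  have P [measurable]: "P \<in> sets borel"
    unfolding P_def by (intro sets.Diff borel_closed closed_Collect_le continuous_intros)
  note [measurable] = E(1)
  have im: "Im (logpolar s \<theta>) = exp s * sin \<theta>" "Re (logpolar s \<theta>) = exp s * cos \<theta>" for \<theta>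
    by (simp_all add: logpolar_def Im_exp Re_exp)
  have eq1: "{\<theta> \<in> {0..<0 + pi}. logpolar s \<theta> \<in> E \<inter> P} = {\<theta> \<in> {0..<pi}. logpolar s \<theta> \<in> E}"
  proof -
    have "logpolar s \<theta> \<in> P" if "\<theta> \<in> {0..<pi}" for \<theta>
    proof -
      have "0 \<le> sin \<theta>" using that by (intro sin_ge_zero) auto
      moreover have "logpolar s \<theta> \<noteq> - of_real (exp s)"
      proof
        assume "logpolar s \<theta> = - of_real (exp s)"
        then have "exp s * cos \<theta> = exp s * cos pi" using im(2)[of \<theta>] by simp
        then have "cos \<theta> = cos pi" by (metis exp_not_eq_zero mult_cancel_left)
        then show False using that cos_inj_pi[of \<theta> pi] by simp
      qed
      ultimately show ?thesis by (simp add: P_def im)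
    qed
    then show ?thesis by auto
  qed
  have eq2: "{\<theta> \<in> {pi..<pi + pi}. logpolar s \<theta> \<in> E - P} = {\<theta> \<in> {pi..<2 * pi}. logpolar s \<theta> \<in> E}"
  proof -
    have "logpolar s \<theta> \<notin> P" if "\<theta> \<in> {pi..<2 * pi}" for \<theta>
    proof (cases "\<theta> = pi")
      case True
      then have "logpolar s \<theta> = - of_real (exp s)" by (simp add: complex_eq_iff im)
      then show ?thesis by (simp add: P_def)
    next
      case False
      then have "sin \<theta> < 0" using that by (intro sin_lt_zero) auto
      then show ?thesis by (simp add: P_def im mult_less_0_iff not_le)
    qed
    then show ?thesis by auto
  qed
  have meas: "{\<theta> \<in> {a..<b}. logpolar s \<theta> \<in> X} \<in> sets borel" if "X \<in> sets borel" for a b :: real and X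
  proof -
    have "{a..<b} \<inter> (logpolar s -` X) \<in> sets borel"
      using measurable_sets[OF measurable_logpolar that] by auto
    moreover have "{\<theta> \<in> {a..<b}. logpolar s \<theta> \<in> X} = {a..<b} \<inter> (logpolar s -` X)" by auto
    ultimately show ?thesis by simp
  qed
  have sets: "E \<inter> P \<in> sets hyp_hausdorff" "E - P \<in> sets hyp_hausdorff" "E \<in> sets hyp_hausdorff"
    using E by (auto simp: sets_hyp_hausdorff sets_restrict_space_iff)
  have un: "{\<theta> \<in> {0..<2 * pi}. logpolar s \<theta> \<in> E} = {\<theta> \<in> {0..<pi}. logpolar s \<theta> \<in> E} \<union> {\<theta> \<in> {pi..<2 * pi}. logpolar s \<theta> \<in> E}"
    by auto
  have "emeasure lborel {\<theta> \<in> {0..<2 * pi}. logpolar s \<theta> \<in> E} =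
      emeasure lborel {\<theta> \<in> {0..<pi}. logpolar s \<theta> \<in> E} + emeasure lborel {\<theta> \<in> {pi..<2 * pi}. logpolar s \<theta> \<in> E}"
    unfolding un
  proof (rule plus_emeasure[symmetric])
    show "{\<theta> \<in> {0..<pi}. logpolar s \<theta> \<in> E} \<in> sets lborel" using meas[OF E(1), of 0 pi] by simp
    show "{\<theta> \<in> {pi..<2 * pi}. logpolar s \<theta> \<in> E} \<in> sets lborel" using meas[OF E(1), of pi "2 * pi"] by simp
  qed auto
  then have "ennreal (hcirc s) * emeasure lborel {\<theta> \<in> {0..<2 * pi}. logpolar s \<theta> \<in> E} =
      ennreal (hcirc s) * emeasure lborel {\<theta> \<in> {0..<0 + pi}. logpolar s \<theta> \<in> E \<inter> P} +
      ennreal (hcirc s) * emeasure lborel {\<theta> \<in> {pi..<pi + pi}. logpolar s \<theta> \<in> E - P}"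
    unfolding eq1 eq2 by (simp only: distrib_left)
  also have "\<dots> \<le> hausdorff_outer (E \<inter> P) + hausdorff_outer (E - P)"
    by (intro add_mono half_arc_le_hausdorff_outer[OF s] meas) (use E(1) P in auto)
  also have "\<dots> = emeasure hyp_hausdorff (E \<inter> P) + emeasure hyp_hausdorff (E - P)"
    using sets by (simp add: emeasure_hyp_hausdorff sets_hyp_hausdorff)
  also have "\<dots> = emeasure hyp_hausdorff E"
    using sets by (subst plus_emeasure) (auto simp: Int_Diff_Un)
  also have "\<dots> = hausdorff_outer E" using sets by (simp add: emeasure_hyp_hausdorff sets_hyp_hausdorff)
  finally show ?thesis .
qed

text \<open>For every Borel part of the circle the arc length is a lower bound, and for the whole circle it is also an
upper bound. Applied to a part and its complement, this leaves no room for a strict inequality.\<close>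

lemma emeasure_hyp_hausdorff_circle:
  assumes s: "s < 0" and E: "E \<in> sets borel"
  shows "emeasure hyp_hausdorff (E \<inter> sphere 0 (exp s))
       = ennreal (hcirc s) * emeasure lborel {\<theta> \<in> {0..<2 * pi}. logpolar s \<theta> \<in> E}"
proof -
  let ?S = "sphere 0 (exp s) :: complex set"
  define N where "N X = ennreal (hcirc s) * emeasure lborel {\<theta> \<in> {0..<2 * pi}. logpolar s \<theta> \<in> X}" for X
  define H where "H X = emeasure hyp_hausdorff X" for X
  have Ssub: "?S \<subseteq> hplane" using s by (auto simp: hplane_iff)
  have S [measurable]: "?S \<in> sets borel" by simp
  note [measurable] = E
  have meas: "{\<theta> \<in> {0..<2 * pi}. logpolar s \<theta> \<in> X} \<in> sets borel" if "X \<in> sets borel" for X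
  proof -
    have "{0..<2 * pi} \<inter> (logpolar s -` X) \<in> sets borel"
      using measurable_sets[OF measurable_logpolar that] by auto
    moreover have "{\<theta> \<in> {0..<2 * pi}. logpolar s \<theta> \<in> X} = {0..<2 * pi} \<inter> (logpolar s -` X)" by auto
    ultimately show ?thesis by simp
  qed
  have sets: "?S \<inter> X \<in> sets hyp_hausdorff" if "X \<in> sets borel" for X
    using that Ssub by (auto simp: sets_hyp_hausdorff sets_restrict_space_iff)
  have le: "N (?S \<inter> X) \<le> H (?S \<inter> X)" if "X \<in> sets borel" for X
    using arc_le_hausdorff_outer[OF s, of "?S \<inter> X"] that Ssub sets[OF that]
    by (auto simp: N_def H_def emeasure_hyp_hausdorff sets_hyp_hausdorff)
  have NS: "N X = N (?S \<inter> X)" for X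
  proof -
    have "{\<theta> \<in> {0..<2 * pi}. logpolar s \<theta> \<in> X} = {\<theta> \<in> {0..<2 * pi}. logpolar s \<theta> \<in> ?S \<inter> X}" by auto
    then show ?thesis by (simp add: N_def)
  qed
  have total: "H ?S \<le> ennreal (2 * pi * hcirc s)"
    using hausdorff_outer_circle_le[OF s] sets[of UNIV] by (simp add: H_def emeasure_hyp_hausdorff sets_hyp_hausdorff)
  have "{\<theta> \<in> {0..<2 * pi}. logpolar s \<theta> \<in> UNIV} = {0..<2 * pi}" by auto
  then have "N UNIV = ennreal (hcirc s) * ennreal (2 * pi)"
    unfolding N_def by (simp only:) simp
  then have "N UNIV = ennreal (2 * pi * hcirc s)"
    using hcirc_pos[OF s] by (simp add: ennreal_mult mult.commute)
  moreover have "N E + N (- E) = N UNIV"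
  proof -
    have "emeasure lborel {\<theta> \<in> {0..<2 * pi}. logpolar s \<theta> \<in> E} + emeasure lborel {\<theta> \<in> {0..<2 * pi}. logpolar s \<theta> \<in> - E}
       = emeasure lborel ({\<theta> \<in> {0..<2 * pi}. logpolar s \<theta> \<in> E} \<union> {\<theta> \<in> {0..<2 * pi}. logpolar s \<theta> \<in> - E})"
      using meas[of E] meas[of "- E"] E by (intro plus_emeasure) auto
    moreover have "{\<theta> \<in> {0..<2 * pi}. logpolar s \<theta> \<in> E} \<union> {\<theta> \<in> {0..<2 * pi}. logpolar s \<theta> \<in> - E} = {\<theta> \<in> {0..<2 * pi}. logpolar s \<theta> \<in> UNIV}"
      by auto
    ultimately show ?thesis unfolding N_def distrib_left[symmetric] by (simp only:)
  qed
  moreover have "H (?S \<inter> E) + H (?S \<inter> - E) = H ?S"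
  proof -
    have "(?S \<inter> E) \<union> (?S \<inter> - E) = ?S" by auto
    then show ?thesis using sets[of E] sets[of "- E"] E unfolding H_def
      by (subst plus_emeasure) auto
  qed
  ultimately have sum: "H (?S \<inter> E) + H (?S \<inter> - E) \<le> N E + N (- E)" and fin: "N E + N (- E) < top"
    using total by (auto simp: less_top)
  have "H (?S \<inter> E) \<le> N E"
  proof -
    have "H (?S \<inter> E) + N (- E) \<le> H (?S \<inter> E) + H (?S \<inter> - E)"
      using le[of "- E"] NS[of "- E"] E by (intro add_left_mono) auto
    also have "\<dots> \<le> N E + N (- E)" by (rule sum)
    finally have "N (- E) + H (?S \<inter> E) \<le> N (- E) + N E" by (simp add: add.commute)
    moreover have "N (- E) \<noteq> top" using fin by (auto simp: less_top)
    ultimately show ?thesis by (simp add: ennreal_add_left_cancel_le)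
  qed
  then show ?thesis using le[OF E] NS[of E] by (simp add: N_def H_def Int_commute antisym)
qed

lemma nn_integral_hyp_hausdorff_circle:
  fixes h :: "complex \<Rightarrow> ennreal"
  assumes s: "s < 0" and h: "h \<in> borel_measurable borel"
  shows "(\<integral>\<^sup>+z. h z * indicator (sphere 0 (exp s)) z \<partial>hyp_hausdorff)
       = (\<integral>\<^sup>+\<theta>. ennreal (hcirc s) * h (logpolar s \<theta>) * indicator {0..<2 * pi} \<theta> \<partial>lborel)"
proof -
  let ?S = "sphere 0 (exp s) :: complex set"
  have Ssub: "?S \<subseteq> hplane" using s by (auto simp: hplane_iff)
  have SH: "?S \<in> sets hyp_hausdorff" using Ssub by (auto simp: sets_hyp_hausdorff sets_restrict_space_iff)
  have hb: "f \<in> borel_measurable hyp_hausdorff" if "f \<in> borel_measurable borel" for f :: "complex \<Rightarrow> ennreal"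
    by (subst measurable_cong_sets[OF sets_hyp_hausdorff refl]) (intro measurable_restrict_space1 that)
  have lp: "logpolar s \<in> measurable borel hyp_hausdorff"
    by (subst measurable_cong_sets[OF refl sets_hyp_hausdorff])
       (intro measurable_restrict_space2 measurable_logpolar, use s in \<open>auto simp: hplane_iff\<close>)
  have "density hyp_hausdorff (indicator ?S) =
      distr (density lborel (\<lambda>\<theta>. ennreal (hcirc s) * indicator {0..<2 * pi} \<theta>)) hyp_hausdorff (logpolar s)"
  proof (rule measure_eqI)
    fix A assume "A \<in> sets (density hyp_hausdorff (indicator ?S))"
    then have A: "A \<in> sets hyp_hausdorff" by simp
    then have Ab: "A \<in> sets borel" by (simp add: sets_hyp_hausdorff sets_restrict_space_iff)
    have lA: "logpolar s -` A \<in> sets borel" using measurable_sets[OF measurable_logpolar Ab] by simp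
    have "emeasure (density hyp_hausdorff (indicator ?S)) A = (\<integral>\<^sup>+z. indicator ?S z * indicator A z \<partial>hyp_hausdorff)"
      using A SH by (subst emeasure_density) auto
    also have "\<dots> = (\<integral>\<^sup>+z. indicator (A \<inter> ?S) z \<partial>hyp_hausdorff)"
      by (intro nn_integral_cong) (simp split: split_indicator)
    also have "\<dots> = emeasure hyp_hausdorff (A \<inter> ?S)" using A SH by (intro nn_integral_indicator) auto
    also have "\<dots> = ennreal (hcirc s) * emeasure lborel {\<theta> \<in> {0..<2 * pi}. logpolar s \<theta> \<in> A}"
      by (rule emeasure_hyp_hausdorff_circle[OF s Ab])
    also have "{\<theta> \<in> {0..<2 * pi}. logpolar s \<theta> \<in> A} = {0..<2 * pi} \<inter> logpolar s -` A" by auto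
    also have "ennreal (hcirc s) * emeasure lborel ({0..<2 * pi} \<inter> logpolar s -` A) =
       (\<integral>\<^sup>+\<theta>. ennreal (hcirc s) * indicator ({0..<2 * pi} \<inter> logpolar s -` A) \<theta> \<partial>lborel)"
      using lA by (subst nn_integral_cmult_indicator) auto
    also have "\<dots> = (\<integral>\<^sup>+\<theta>. ennreal (hcirc s) * indicator {0..<2 * pi} \<theta> * indicator (logpolar s -` A) \<theta> \<partial>lborel)"
      by (intro nn_integral_cong) (simp split: split_indicator)
    also have "\<dots> = emeasure (density lborel (\<lambda>\<theta>. ennreal (hcirc s) * indicator {0..<2 * pi} \<theta>)) (logpolar s -` A)"
      using lA by (subst emeasure_density) auto
    also have "\<dots> = emeasure (distr (density lborel (\<lambda>\<theta>. ennreal (hcirc s) * indicator {0..<2 * pi} \<theta>)) hyp_hausdorff (logpolar s)) A"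
      using A lp by (subst emeasure_distr) auto
    finally show "emeasure (density hyp_hausdorff (indicator ?S)) A =
       emeasure (distr (density lborel (\<lambda>\<theta>. ennreal (hcirc s) * indicator {0..<2 * pi} \<theta>)) hyp_hausdorff (logpolar s)) A" .
  qed simp
  then have "(\<integral>\<^sup>+z. h z \<partial>density hyp_hausdorff (indicator ?S)) =
      (\<integral>\<^sup>+z. h z \<partial>distr (density lborel (\<lambda>\<theta>. ennreal (hcirc s) * indicator {0..<2 * pi} \<theta>)) hyp_hausdorff (logpolar s))"
    by simp
  also have "\<dots> = (\<integral>\<^sup>+\<theta>. h (logpolar s \<theta>) \<partial>density lborel (\<lambda>\<theta>. ennreal (hcirc s) * indicator {0..<2 * pi} \<theta>))"
    using lp hb[OF h] by (intro nn_integral_distr) auto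
  also have "\<dots> = (\<integral>\<^sup>+\<theta>. ennreal (hcirc s) * indicator {0..<2 * pi} \<theta> * h (logpolar s \<theta>) \<partial>lborel)"
    using h by (intro nn_integral_density) auto
  also have "(\<integral>\<^sup>+z. h z \<partial>density hyp_hausdorff (indicator ?S)) = (\<integral>\<^sup>+z. indicator ?S z * h z \<partial>hyp_hausdorff)"
    using hb[OF h] SH by (intro nn_integral_density) auto
  finally show ?thesis by (simp add: ac_simps)
qed

section \<open>Change of variables for injective holomorphic maps\<close>

definition vec_complex :: "real^2 \<Rightarrow> complex" where
  "vec_complex x = Complex (x $ 1) (x $ 2)"

definition complex_vec :: "complex \<Rightarrow> real^2" where
  "complex_vec z = vector [Re z, Im z]"

lemma vec_complex_inverse [simp]: "vec_complex (complex_vec z) = z" "complex_vec (vec_complex x) = x"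
  by (auto simp: vec_complex_def complex_vec_def vec_eq_iff forall_2)

lemma bounded_linear_vec_complex: "bounded_linear vec_complex"
  by (intro linear_conv_bounded_linear[THEN iffD1] linearI) (auto simp: vec_complex_def complex_eq_iff)

lemma bounded_linear_complex_vec: "bounded_linear complex_vec"
  by (intro linear_conv_bounded_linear[THEN iffD1] linearI)
     (auto simp: complex_vec_def vec_eq_iff forall_2)

lemma measurable_vec_complex [measurable]: "vec_complex \<in> borel_measurable borel"
  by (intro borel_measurable_continuous_onI bounded_linear.continuous_on[OF bounded_linear_vec_complex] continuous_on_id)

lemma prod_Basis_complex: "(\<Prod>b\<in>Basis. f b) = f 1 * f \<i>" for f :: "complex \<Rightarrow> real"
  by (simp add: Basis_complex_def)

lemma lborel_complex_vec: "lborel = distr lborel borel vec_complex"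
proof (rule lborel_eqI)
  fix l u :: complex assume le: "\<And>b. b \<in> Basis \<Longrightarrow> l \<bullet> b \<le> u \<bullet> b"
  have B: "Basis = {axis 1 1, axis 2 1 :: real^2}"
    by (auto simp: Basis_vec_def UNIV_2)
  have ne: "axis 1 1 \<noteq> (axis 2 1 :: real^2)" by (simp add: axis_eq_axis)
  have "vec_complex -` box l u = box (complex_vec l) (complex_vec u)"
    by (auto simp: in_box_complex_iff mem_box_cart forall_2 vec_complex_def complex_vec_def)
  moreover have "emeasure lborel (box (complex_vec l) (complex_vec u)) = ennreal ((Re u - Re l) * (Im u - Im l))"
    using le[of 1] le[of \<i>] ne
    by (subst emeasure_lborel_box) (auto simp: B inner_axis complex_vec_def Basis_complex_def)
  ultimately show "emeasure (distr lborel borel vec_complex) (box l u) = (\<Prod>b\<in>Basis. (u - l) \<bullet> b)"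
    by (simp add: emeasure_distr prod_Basis_complex)
qed simp

lemma lborel_complex_pair: "lborel = distr (lborel \<Otimes>\<^sub>M lborel) borel (\<lambda>(x, y). Complex x y)"
proof (rule lborel_eqI)
  fix l u :: complex assume le: "\<And>b. b \<in> Basis \<Longrightarrow> l \<bullet> b \<le> u \<bullet> b"
  have m: "(\<lambda>(x, y). Complex x y) \<in> borel_measurable (lborel \<Otimes>\<^sub>M lborel)"
  proof -
    have "(\<lambda>p::real \<times> real. of_real (fst p) + \<i> * of_real (snd p)) \<in> borel_measurable (lborel \<Otimes>\<^sub>M lborel)"
      by measurable
    then show ?thesis by (simp add: Complex_eq case_prod_unfold)
  qed
  have "(\<lambda>(x, y). Complex x y) -` box l u = {Re l<..<Re u} \<times> {Im l<..<Im u}"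
    by (auto simp: in_box_complex_iff)
  moreover have "emeasure (lborel \<Otimes>\<^sub>M lborel) ({Re l<..<Re u} \<times> {Im l<..<Im u}) = ennreal ((Re u - Re l) * (Im u - Im l))"
    using le[of 1] le[of \<i>]
    by (subst lborel.emeasure_pair_measure_Times) (auto simp: Basis_complex_def ennreal_mult)
  ultimately show "emeasure (distr (lborel \<Otimes>\<^sub>M lborel) borel (\<lambda>(x, y). Complex x y)) (box l u) = (\<Prod>b\<in>Basis. (u - l) \<bullet> b)"
    using m by (simp add: emeasure_distr prod_Basis_complex space_pair_measure)
qed simp

lemma det_complex_mult: "det (matrix (\<lambda>h. complex_vec (c * vec_complex h))) = (cmod c)\<^sup>2"
  by (subst cmod_power2)
     (simp add: det_2 matrix_def complex_vec_def vec_complex_def axis_def power2_eq_square)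

lemma holomorphic_image_borel:
  assumes "open S" "f holomorphic_on S" "inj_on f S" "A \<in> sets borel" "A \<subseteq> S"
  shows "f ` A \<in> sets borel"
proof -
  obtain g where g: "g holomorphic_on (f ` S)" "\<And>z. z \<in> S \<Longrightarrow> g (f z) = z"
    using holomorphic_has_inverse[OF assms(2,1,3)] by metis
  have o: "open (f ` S)" using open_mapping_thm3[OF assms(2,1,3)] .
  have "g -` A \<inter> f ` S \<in> sets (restrict_space borel (f ` S))"
    using measurable_sets[OF borel_measurable_continuous_on_restrict[OF holomorphic_on_imp_continuous_on[OF g(1)]] assms(4)]
    by (simp add: space_restrict_space)
  then have "g -` A \<inter> f ` S \<in> sets borel" using o by (auto simp: sets_restrict_space_iff)
  moreover have "g -` A \<inter> f ` S = f ` A" using g(2) assms(5) by (auto simp: image_iff)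
  ultimately show ?thesis by simp
qed

text \<open>The Jacobian determinant of a holomorphic map is the square of the modulus of its derivative. The change of
variables in \<open>real^2\<close> is transported by the coordinate map \<open>vec_complex\<close>.\<close>

lemma emeasure_holomorphic_image:
  assumes S: "open S" and f: "f holomorphic_on S" "inj_on f S" and A: "A \<in> sets borel" "A \<subseteq> S"
  shows "emeasure lborel (f ` A) = (\<integral>\<^sup>+z. ennreal ((cmod (deriv f z))\<^sup>2) * indicator A z \<partial>lborel)"
proof -
  define F where "F x = complex_vec (f (vec_complex x))" for x
  define A' where "A' = vec_complex -` A"
  define D where "D x h = complex_vec (deriv f (vec_complex x) * vec_complex h)" for x h
  define G where "G z = (cmod (deriv f z))\<^sup>2 * indicator A z" for z
  have fA: "f ` A \<in> sets borel" by (rule holomorphic_image_borel[OF S f A])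
  have A'_borel: "A' \<in> sets borel" unfolding A'_def using measurable_sets[OF measurable_vec_complex A(1)] by simp
  have der: "(F has_derivative D x) (at x within A')" if "x \<in> A'" for x
  proof -
    have "(f has_derivative (*) (deriv f (vec_complex x))) (at (vec_complex x))"
      using holomorphic_derivI[OF f(1) S] that A(2) by (auto simp: A'_def has_field_derivative_def)
    from has_derivative_compose[OF bounded_linear_imp_has_derivative[OF bounded_linear_vec_complex] this]
    have "((\<lambda>x. f (vec_complex x)) has_derivative (\<lambda>h. deriv f (vec_complex x) * vec_complex h)) (at x)" .
    from bounded_linear.has_derivative[OF bounded_linear_complex_vec this]
    show ?thesis unfolding F_def D_def by (rule has_derivative_at_withinI)
  qed
  have inj: "inj_on F A'"
  proof (rule inj_onI)
    fix x y assume xy: "x \<in> A'" "y \<in> A'" "F x = F y"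
    then have "f (vec_complex x) = f (vec_complex y)" unfolding F_def by (metis vec_complex_inverse(1))
    then have "vec_complex x = vec_complex y" using xy A(2) inj_onD[OF f(2)] by (auto simp: A'_def)
    then show "x = y" by (metis vec_complex_inverse(2))
  qed
  have FA: "F ` A' = vec_complex -` (f ` A)"
  proof (intro set_eqI iffI)
    fix x assume "x \<in> vec_complex -` (f ` A)"
    then obtain z where "z \<in> A" "vec_complex x = f z" by auto
    then show "x \<in> F ` A'"
      by (intro image_eqI[of _ _ "complex_vec z"]) (auto simp: F_def A'_def, metis vec_complex_inverse(2))
  qed (auto simp: F_def A'_def)
  have FA_borel: "F ` A' \<in> sets borel" unfolding FA using measurable_sets[OF measurable_vec_complex fA] by simp
  have em: "emeasure lborel (f ` A) = emeasure lborel (F ` A')"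
    unfolding FA by (subst lborel_complex_vec) (use fA in \<open>simp add: emeasure_distr\<close>)
  have det: "\<bar>det (matrix (D x))\<bar> = (cmod (deriv f (vec_complex x)))\<^sup>2" for x
    unfolding D_def by (subst det_complex_mult) simp
  have "continuous_on A (\<lambda>z. (cmod (deriv f z))\<^sup>2)"
    using holomorphic_on_imp_continuous_on[OF holomorphic_deriv[OF f(1) S]] A(2)
    by (intro continuous_intros) (auto intro: continuous_on_subset)
  from borel_measurable_continuous_on_indicator[OF A(1) this]
  have G_borel [measurable]: "G \<in> borel_measurable borel" unfolding G_def[abs_def] by (simp add: mult.commute)
  have G_nonneg: "0 \<le> G z" for z by (simp add: G_def)
  have int: "((\<lambda>x. G (vec_complex x)) has_integral m) UNIV \<longleftrightarrow> ((\<lambda>x. \<bar>det (matrix (D x))\<bar>) has_integral m) A'" for m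
  proof -
    have "(\<lambda>x. G (vec_complex x)) = (\<lambda>x. if x \<in> A' then \<bar>det (matrix (D x))\<bar> else 0)"
      by (auto simp: G_def det A'_def fun_eq_iff)
    then show ?thesis by (simp add: has_integral_restrict_UNIV)
  qed
  have iff: "F ` A' \<in> lmeasurable \<and> measure lebesgue (F ` A') = m \<longleftrightarrow> ((\<lambda>x. G (vec_complex x)) has_integral m) UNIV" for m
    unfolding int using A'_borel by (intro has_measure_differentiable_image der inj) auto
  have "(\<integral>\<^sup>+z. ennreal (G z) \<partial>lborel) = (\<integral>\<^sup>+x. ennreal (G (vec_complex x)) \<partial>lborel)"
    by (subst lborel_complex_vec) (simp add: nn_integral_distr)
  also have "\<dots> = emeasure lborel (F ` A')"
  proof (cases "\<integral>\<^sup>+x. ennreal (G (vec_complex x)) \<partial>lborel" rule: ennreal_cases)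
    case (real r)
    then have "((\<lambda>x. G (vec_complex x)) has_integral r) UNIV"
      by (intro nn_integral_has_integral) (auto simp: G_nonneg)
    then have "F ` A' \<in> lmeasurable" "measure lebesgue (F ` A') = r" using iff by auto
    then have "emeasure lebesgue (F ` A') = ennreal r" using emeasure_eq_measure2 by metis
    then show ?thesis using real FA_borel by simp
  next
    case top
    have "emeasure lborel (F ` A') = \<infinity>"
    proof (rule ccontr)
      assume "emeasure lborel (F ` A') \<noteq> \<infinity>"
      then have "F ` A' \<in> lmeasurable" using FA_borel by (simp add: fmeasurable_def top.not_eq_extremum)
      then have "((\<lambda>x. G (vec_complex x)) has_integral measure lebesgue (F ` A')) UNIV" using iff by blast
      then have "(\<integral>\<^sup>+x. ennreal (G (vec_complex x)) \<partial>lborel) = ennreal (measure lebesgue (F ` A'))"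
        by (intro nn_integral_has_integral_lborel) (auto simp: G_nonneg)
      then show False using top by simp
    qed
    then show ?thesis using top by simp
  qed
  finally show ?thesis
    unfolding em by (simp add: G_def ennreal_mult ennreal_indicator)
qed

lemma nn_integral_holomorphic_image:
  fixes h :: "complex \<Rightarrow> ennreal"
  assumes S: "open S" and f: "f holomorphic_on S" "inj_on f S" and h: "h \<in> borel_measurable borel"
  shows "(\<integral>\<^sup>+w. h w * indicator (f ` S) w \<partial>lborel)
       = (\<integral>\<^sup>+z. ennreal ((cmod (deriv f z))\<^sup>2) * h (f z) * indicator S z \<partial>lborel)"
proof -
  define f' where "f' z = (if z \<in> S then f z else 0)" for z
  define w where "w z = ennreal ((cmod (deriv f z))\<^sup>2) * indicator S z" for z
  have Sb [measurable]: "S \<in> sets borel" using S by simp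
  have fS [measurable]: "f ` S \<in> sets borel" using holomorphic_image_borel[OF S f Sb order_refl] .
  have f' [measurable]: "f' \<in> borel_measurable borel"
    unfolding f'_def[abs_def] using holomorphic_on_imp_continuous_on[OF f(1)] S
    by (intro borel_measurable_continuous_on_if) auto
  have "(\<lambda>z. indicator S z *\<^sub>R (cmod (deriv f z))\<^sup>2) \<in> borel_measurable borel"
    using holomorphic_on_imp_continuous_on[OF holomorphic_deriv[OF f(1) S]]
    by (intro borel_measurable_continuous_on_indicator continuous_intros) auto
  then have "(\<lambda>z. ennreal (indicator S z *\<^sub>R (cmod (deriv f z))\<^sup>2)) \<in> borel_measurable borel" by measurable
  moreover have "w = (\<lambda>z. ennreal (indicator S z *\<^sub>R (cmod (deriv f z))\<^sup>2))"
    by (auto simp: w_def fun_eq_iff split: split_indicator)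
  ultimately have w [measurable]: "w \<in> borel_measurable borel" by simp
  have "distr (density lborel w) borel f' = density lborel (indicator (f ` S))"
  proof (rule measure_eqI)
    fix B assume "B \<in> sets (distr (density lborel w) borel f')"
    then have B [measurable]: "B \<in> sets borel" by simp
    let ?A = "f' -` B \<inter> S"
    have A: "?A \<in> sets borel" using measurable_sets[OF f' B] by auto
    have "f ` ?A = f ` S \<inter> B" by (auto simp: f'_def)
    have "emeasure (distr (density lborel w) borel f') B = (\<integral>\<^sup>+z. w z * indicator (f' -` B) z \<partial>lborel)"
      using measurable_sets[OF f' B] by (simp add: emeasure_distr emeasure_density)
    also have "\<dots> = (\<integral>\<^sup>+z. ennreal ((cmod (deriv f z))\<^sup>2) * indicator ?A z \<partial>lborel)"
      by (intro nn_integral_cong) (auto simp: w_def split: split_indicator)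
    also have "\<dots> = emeasure lborel (f ` ?A)"
      by (rule emeasure_holomorphic_image[OF S f A, symmetric]) simp
    also have "\<dots> = emeasure (density lborel (indicator (f ` S))) B"
    proof -
      have "emeasure (density lborel (indicator (f ` S))) B = (\<integral>\<^sup>+z. indicator (f ` S) z * indicator B z \<partial>lborel)"
        by (subst emeasure_density) auto
      also have "\<dots> = (\<integral>\<^sup>+z. indicator (f ` S \<inter> B) z \<partial>lborel)"
        by (intro nn_integral_cong) (simp split: split_indicator)
      also have "\<dots> = emeasure lborel (f ` S \<inter> B)" by (rule nn_integral_indicator) auto
      finally show ?thesis by (simp add: \<open>f ` ?A = f ` S \<inter> B\<close>)
    qed
    finally show "emeasure (distr (density lborel w) borel f') B = emeasure (density lborel (indicator (f ` S))) B" .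
  qed simp
  then have "(\<integral>\<^sup>+v. h v \<partial>density lborel (indicator (f ` S))) = (\<integral>\<^sup>+v. h v \<partial>distr (density lborel w) borel f')"
    by simp
  also have "\<dots> = (\<integral>\<^sup>+z. h (f' z) \<partial>density lborel w)" by (rule nn_integral_distr) (use f' h in auto)
  finally have eq: "(\<integral>\<^sup>+v. h v \<partial>density lborel (indicator (f ` S))) = (\<integral>\<^sup>+z. h (f' z) \<partial>density lborel w)" .
  have "(\<integral>\<^sup>+v. h v * indicator (f ` S) v \<partial>lborel) = (\<integral>\<^sup>+z. w z * h (f' z) \<partial>lborel)"
    using eq h by (simp add: nn_integral_density mult.commute)
  also have "\<dots> = (\<integral>\<^sup>+z. ennreal ((cmod (deriv f z))\<^sup>2) * h (f z) * indicator S z \<partial>lborel)"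
    by (intro nn_integral_cong) (auto simp: w_def f'_def split: split_indicator)
  finally show ?thesis .
qed

section \<open>Hyperbolic area in polar coordinates\<close>

lemma sets_hyp_area: "sets hyp_area = sets (restrict_space borel hplane)"
  by (simp add: hyp_area_def sets_restrict_space)

lemma space_hyp_area: "space hyp_area = hplane"
  by (simp add: hyp_area_def space_restrict_space)

lemma conf_pos: "z \<in> hplane \<Longrightarrow> 0 < conf z"
  using one_minus_norm_pos by (simp add: conf_def)

lemma continuous_on_conf: "A \<subseteq> hplane \<Longrightarrow> continuous_on A conf"
  unfolding conf_def[abs_def] using one_minus_norm_pos by (intro continuous_intros) force

lemma measurable_conf [measurable]: "conf \<in> borel_measurable borel"
  unfolding conf_def[abs_def] by measurable

lemma nn_integral_hyp_area:
  assumes "h \<in> borel_measurable hyp_area"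
  shows "(\<integral>\<^sup>+z. h z \<partial>hyp_area) = (\<integral>\<^sup>+z. ennreal ((conf z)\<^sup>2) * h z * indicator hplane z \<partial>lborel)"
proof -
  have "h \<in> borel_measurable (restrict_space lborel hplane)" using assms by (simp add: hyp_area_def)
  moreover have "(\<lambda>z. ennreal ((conf z)\<^sup>2)) \<in> borel_measurable (restrict_space lborel hplane)"
    by (intro measurable_restrict_space1) measurable
  ultimately show ?thesis
    unfolding hyp_area_def by (subst nn_integral_density) (auto simp: nn_integral_restrict_space)
qed

lemma measurable_moeb_hyp_area [measurable]:
  assumes "p \<in> hplane" shows "moeb p \<in> measurable hyp_area hyp_area"
  using measurable_moeb_hyp_hausdorff[OF assms]
  by (simp add: measurable_cong_sets[OF sets_hyp_area sets_hyp_area]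
      measurable_cong_sets[OF sets_hyp_hausdorff sets_hyp_hausdorff])

text \<open>The conformal factor scales inversely to the derivative of an isometry, which cancels the Jacobian.\<close>

lemma distr_hyp_area_moeb:
  assumes "p \<in> hplane" shows "distr hyp_area hyp_area (moeb p) = hyp_area"
proof (rule measure_eqI)
  fix A assume "A \<in> sets (distr hyp_area hyp_area (moeb p))"
  then have A [measurable]: "A \<in> sets hyp_area" by simp
  then have Ab [measurable]: "A \<in> sets borel" by (simp add: sets_hyp_area sets_restrict_space_iff)
  let ?B = "moeb p -` A \<inter> space hyp_area"
  have B: "?B \<in> sets hyp_area" by (rule measurable_sets[OF measurable_moeb_hyp_area[OF assms] A])
  have "emeasure (distr hyp_area hyp_area (moeb p)) A = (\<integral>\<^sup>+z. indicator ?B z \<partial>hyp_area)"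
    using assms B by (simp add: emeasure_distr)
  also have "\<dots> = (\<integral>\<^sup>+z. ennreal ((conf z)\<^sup>2) * indicator ?B z * indicator hplane z \<partial>lborel)"
    by (rule nn_integral_hyp_area) (rule borel_measurable_indicator[OF B])
  also have "\<dots> = (\<integral>\<^sup>+z. ennreal ((cmod (deriv (moeb p) z))\<^sup>2) *
      (ennreal ((conf (moeb p z))\<^sup>2) * indicator A (moeb p z)) * indicator hplane z \<partial>lborel)"
  proof (intro nn_integral_cong)
    fix z
    have "(cmod (deriv (moeb p) z))\<^sup>2 * (conf (moeb p z))\<^sup>2 = (conf z)\<^sup>2" if "z \<in> hplane"
      using conf_moeb[OF assms that] by (metis mult.commute power_mult_distrib)
    then show "ennreal ((conf z)\<^sup>2) * indicator ?B z * indicator hplane z = ennreal ((cmod (deriv (moeb p) z))\<^sup>2) *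
      (ennreal ((conf (moeb p z))\<^sup>2) * indicator A (moeb p z)) * indicator hplane z"
      by (auto simp: space_hyp_area mult.assoc[symmetric] ennreal_mult[symmetric] split: split_indicator)
  qed
  also have "\<dots> = (\<integral>\<^sup>+w. (ennreal ((conf w)\<^sup>2) * indicator A w) * indicator (moeb p ` hplane) w \<partial>lborel)"
    by (rule nn_integral_holomorphic_image[symmetric]) (auto intro: holomorphic_moeb inj_on_moeb assms)
  also have "\<dots> = emeasure hyp_area A"
    using A unfolding moeb_image_hplane[OF assms] by (subst nn_integral_hyp_area[symmetric]) auto
  finally show "emeasure (distr hyp_area hyp_area (moeb p)) A = emeasure hyp_area A" .
qed simp

text \<open>The exponential maps the half-strip \<open>Re z < 0, 0 < Im z < 2 \<pi>\<close> injectively onto the disk without a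
radius, which is a null set. Its Jacobian \<open>exp (2 s)\<close> turns the conformal factor into \<open>hcirc s\<close>.\<close>

lemma polar_nn_integral_hyp_area:
  fixes h :: "complex \<Rightarrow> ennreal"
  assumes [measurable]: "h \<in> borel_measurable borel"
  shows "(\<integral>\<^sup>+z. h z \<partial>hyp_area) =
    (\<integral>\<^sup>+s. (\<integral>\<^sup>+\<theta>. ennreal ((hcirc s)\<^sup>2) * h (logpolar s \<theta>) * indicator {0<..<2 * pi} \<theta> \<partial>lborel) * indicator {..<0} s \<partial>lborel)"
proof -
  define S where "S = {z. Re z < 0 \<and> 0 < Im z \<and> Im z < 2 * pi}"
  have S: "open S"
    unfolding S_def by (intro open_Collect_conj open_Collect_less continuous_intros)
  have inj: "inj_on exp S"
  proof (rule inj_onI)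
    fix z w assume zw: "z \<in> S" "w \<in> S" "exp z = exp w"
    then obtain n :: int where n: "z = w + of_real (real_of_int (2 * n) * pi) * \<i>" using exp_eq by blast
    then have "Im z = Im w + 2 * pi * n" by simp
    moreover have "0 < Im z" "Im z < 2 * pi" "0 < Im w" "Im w < 2 * pi" using zw(1,2) by (auto simp: S_def)
    ultimately have "2 * pi * real_of_int n < 2 * pi * 1" "2 * pi * (- 1) < 2 * pi * real_of_int n" by linarith+
    then have "real_of_int n < 1" "- 1 < real_of_int n"
      by (metis mult_less_cancel_left_pos pi_gt_zero zero_less_mult_iff zero_less_numeral)+
    then have "n = 0" by linarith
    then show "z = w" using n by simp
  qed
  have img: "exp ` S = hplane - {z. Im z = 0 \<and> 0 \<le> Re z}"
  proof (intro set_eqI iffI)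
    fix z assume "z \<in> exp ` S"
    then obtain w where w: "w \<in> S" "z = exp w" by blast
    have "\<not> (Im z = 0 \<and> 0 \<le> Re z)"
    proof
      assume *: "Im z = 0 \<and> 0 \<le> Re z"
      then have "sin (Im w) = 0" "0 \<le> cos (Im w)"
        using w(2) by (auto simp: Im_exp Re_exp zero_le_mult_iff)
      moreover have "Im w = pi" if "sin (Im w) = 0"
      proof -
        obtain i :: int where i: "Im w = i * pi" using \<open>sin (Im w) = 0\<close> sin_zero_iff_int2 by blast
        then have "0 < real_of_int i" "real_of_int i < 2"
          using w(1) by (auto simp: S_def zero_less_mult_iff)
        then have "i = 1" by linarith
        then show ?thesis using i by simp
      qed
      ultimately show False by simp
    qed
    then show "z \<in> hplane - {z. Im z = 0 \<and> 0 \<le> Re z}" using w by (auto simp: hplane_iff S_def)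
  next
    fix z assume z: "z \<in> hplane - {z. Im z = 0 \<and> 0 \<le> Re z}"
    then have z0: "z \<noteq> 0" by auto
    have Re: "Re (Ln z) < 0" using z z0 by (auto simp: hplane_iff)
    have nz: "Im (Ln z) \<noteq> 0"
    proof
      assume "Im (Ln z) = 0"
      then have "Im (exp (Ln z)) = 0" "0 < Re (exp (Ln z))" by (auto simp: Im_exp Re_exp)
      then show False using z z0 by auto
    qed
    show "z \<in> exp ` S"
    proof (cases "0 < Im (Ln z)")
      case True
      then show ?thesis using Re z0 Im_Ln_le_pi[OF z0] pi_gt_zero
        by (intro image_eqI[of _ _ "Ln z"]) (auto simp: S_def simp del: pi_gt_zero)
    next
      case False
      then show ?thesis using Re z0 mpi_less_Im_Ln[OF z0] nz
        by (intro image_eqI[of _ _ "Ln z + 2 * of_real pi * \<i>"]) (auto simp: S_def exp_add exp_two_pi_i')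
    qed
  qed
  \<comment> \<open>The removed radius lies on the real line.\<close>
  have null: "AE z in lborel. \<not> (Im z = 0 \<and> 0 \<le> Re z)"
  proof -
    have "negligible {z. \<i> \<bullet> z = 0}" by (rule negligible_hyperplane) simp
    then have "{z::complex. \<i> \<bullet> z = 0} \<in> null_sets lebesgue" by (simp add: negligible_iff_null_sets)
    moreover have "{z::complex. \<i> \<bullet> z = 0} \<in> sets lborel" 
      by (auto intro!: closed_hyperplane)
    ultimately have "{z::complex. \<i> \<bullet> z = 0} \<in> null_sets lborel" by (simp add: null_sets_def)
    from AE_not_in[OF this] show ?thesis by (rule AE_mp) (auto simp: inner_complex_def)
  qed
  have "h \<in> borel_measurable hyp_area"
    by (subst measurable_cong_sets[OF sets_hyp_area refl]) (intro measurable_restrict_space1 assms)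
  then have "(\<integral>\<^sup>+z. h z \<partial>hyp_area) = (\<integral>\<^sup>+z. ennreal ((conf z)\<^sup>2) * h z * indicator hplane z \<partial>lborel)"
    by (rule nn_integral_hyp_area)
  also have "\<dots> = (\<integral>\<^sup>+z. (ennreal ((conf z)\<^sup>2) * h z) * indicator (exp ` S) z \<partial>lborel)"
    by (intro nn_integral_cong_AE, use null in eventually_elim) (auto simp: img split: split_indicator)
  also have "\<dots> = (\<integral>\<^sup>+z. ennreal ((cmod (deriv exp z))\<^sup>2) * (ennreal ((conf (exp z))\<^sup>2) * h (exp z)) * indicator S z \<partial>lborel)"
    by (rule nn_integral_holomorphic_image[OF S _ inj]) (auto intro: holomorphic_intros)
  also have "\<dots> = (\<integral>\<^sup>+z. ennreal ((hcirc (Re z))\<^sup>2) * h (exp z) * indicator S z \<partial>lborel)"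
  proof (intro nn_integral_cong)
    fix z
    have "(cmod (exp z))\<^sup>2 * (conf (exp z))\<^sup>2 = (hcirc (Re z))\<^sup>2" if "z \<in> S"
      using conf_logpolar[of "Re z" "Im z"] that
      by (simp add: logpolar_def S_def) (metis mult.commute power_mult_distrib)
    then show "ennreal ((cmod (deriv exp z))\<^sup>2) * (ennreal ((conf (exp z))\<^sup>2) * h (exp z)) * indicator S z
        = ennreal ((hcirc (Re z))\<^sup>2) * h (exp z) * indicator S z"
      using DERIV_imp_deriv[OF DERIV_exp, of z]
      by (auto simp: mult.assoc[symmetric] ennreal_mult[symmetric] simp del: norm_exp_eq_Re split: split_indicator)
  qed
  also have "\<dots> = (\<integral>\<^sup>+p. ennreal ((hcirc (fst p))\<^sup>2) * h (logpolar (fst p) (snd p)) *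
      (indicator {0<..<2 * pi} (snd p) * indicator {..<0} (fst p)) \<partial>(lborel \<Otimes>\<^sub>M lborel))"
  proof -
    have m: "(\<lambda>(x, y). Complex x y) \<in> borel_measurable (lborel \<Otimes>\<^sub>M lborel)"
    proof -
      have "(\<lambda>p::real \<times> real. of_real (fst p) + \<i> * of_real (snd p)) \<in> borel_measurable (lborel \<Otimes>\<^sub>M lborel)"
        by measurable
      then show ?thesis by (simp add: Complex_eq case_prod_unfold)
    qed
    have [measurable]: "S \<in> sets borel" using S by simp
    have [measurable]: "hcirc \<in> borel_measurable borel" unfolding hcirc_def[abs_def] sinh_def by measurable
    have ex: "(exp :: complex \<Rightarrow> complex) \<in> borel_measurable borel" by (intro borel_measurable_continuous_onI continuous_intros)
    have [measurable]: "Re \<in> borel_measurable borel" by (intro borel_measurable_continuous_onI continuous_intros)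
    have [measurable]: "(\<lambda>z. h (exp z)) \<in> borel_measurable borel" using ex by measurable
    show ?thesis
      by (subst lborel_complex_pair, subst nn_integral_distr[OF m])
         (auto simp: logpolar_def S_def case_prod_unfold intro!: nn_integral_cong split: split_indicator)
  qed
  also have "\<dots> = (\<integral>\<^sup>+s. \<integral>\<^sup>+\<theta>. ennreal ((hcirc s)\<^sup>2) * h (logpolar s \<theta>) *
      (indicator {0<..<2 * pi} \<theta> * indicator {..<0} s) \<partial>lborel \<partial>lborel)"
  proof -
    have [measurable]: "hcirc \<in> borel_measurable borel" unfolding hcirc_def[abs_def] sinh_def by measurable
    have [measurable]: "(\<lambda>p. logpolar (fst p) (snd p)) \<in> borel_measurable (borel \<Otimes>\<^sub>M borel)"
      unfolding borel_prod by (intro borel_measurable_continuous_onI continuous_intros)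
    show ?thesis
      by (subst lborel.nn_integral_fst[symmetric]) (auto simp: case_prod_unfold)
  qed
  also have "\<dots> = (\<integral>\<^sup>+s. (\<integral>\<^sup>+\<theta>. ennreal ((hcirc s)\<^sup>2) * h (logpolar s \<theta>) * indicator {0<..<2 * pi} \<theta> \<partial>lborel) * indicator {..<0} s \<partial>lborel)"
    by (intro nn_integral_cong) (auto split: split_indicator)
  finally show ?thesis .
qed

section \<open>Reduction to smooth test functions\<close>

definition dirichlet :: "complex set \<Rightarrow> (complex \<Rightarrow> complex) \<Rightarrow> real" where
  "dirichlet U \<phi> = (LINT z:U|hyp_area. (norm (hframe (grad \<phi>) z))\<^sup>2)"

definition mass :: "complex set \<Rightarrow> (complex \<Rightarrow> complex) \<Rightarrow> real" where
  "mass U \<phi> = (LINT z:U|hyp_area. (cmod (\<phi> z))\<^sup>2)"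

definition bmass :: "complex set \<Rightarrow> (complex \<Rightarrow> complex) \<Rightarrow> real" where
  "bmass U \<phi> = (LINT z:hboundary U|hyp_hausdorff. (cmod (\<phi> z))\<^sup>2)"

lemma mass_nonneg: "0 \<le> mass U \<phi>" and bmass_nonneg: "0 \<le> bmass U \<phi>"
  unfolding mass_def bmass_def set_lebesgue_integral_def
  by (intro Bochner_Integration.integral_nonneg; simp)+

lemma sq_norm_diff_le:
  fixes f g :: "'b::real_normed_vector"
  assumes "0 < \<eta>"
  shows "\<bar>(norm f)\<^sup>2 - (norm g)\<^sup>2\<bar> \<le> (1 + 1 / \<eta>) * (norm (f - g))\<^sup>2 + \<eta> * (norm g)\<^sup>2"
proof -
  define x where "x = norm f" define y where "y = norm g" define d where "d = norm (f - g)"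
  have xy: "\<bar>x - y\<bar> \<le> d" "0 \<le> x" "0 \<le> y" "0 \<le> d"
    unfolding x_def y_def d_def by (auto simp: norm_triangle_ineq3)
  have "\<bar>x\<^sup>2 - y\<^sup>2\<bar> = \<bar>x - y\<bar> * (x + y)"
    using xy by (simp add: power2_eq_square square_diff_square_factored abs_mult)
  also have "\<dots> \<le> d * (d + 2 * y)" using xy by (intro mult_mono) auto
  also have "\<dots> \<le> (1 + 1 / \<eta>) * d\<^sup>2 + \<eta> * y\<^sup>2"
  proof -
    have "0 \<le> (d - \<eta> * y)\<^sup>2 / \<eta>" using assms by simp
    also have "\<dots> = d\<^sup>2 / \<eta> - 2 * d * y + \<eta> * y\<^sup>2" using assms by (simp add: power2_eq_square field_simps)
    finally show ?thesis by (simp add: power2_eq_square algebra_simps)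
  qed
  finally show ?thesis by (simp add: x_def y_def d_def)
qed

text \<open>The difference of the squared norms is at most \<open>(1 + 1 / \<eta>)\<close> times the squared distance, which tends
to zero, plus \<open>\<eta>\<close> times the squared norm of the limit, which is small with \<open>\<eta>\<close>.\<close>

lemma L2_tendsto_norm_integral:
  fixes g :: "'a \<Rightarrow> 'b::{real_normed_vector, second_countable_topology}"
  assumes g: "L2_on M A g" and f: "\<And>n. set_borel_measurable M A (f n)" and lim: "L2_tendsto M A f g"
  shows "(\<lambda>n. LINT z:A|M. (norm (f n z))\<^sup>2) \<longlonglongrightarrow> (LINT z:A|M. (norm (g z))\<^sup>2)"
proof -
  define G where "G z = indicator A z *\<^sub>R g z" for z
  define F where "F n z = indicator A z *\<^sub>R f n z" for n z
  have [measurable]: "G \<in> borel_measurable M" "F n \<in> borel_measurable M" for n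
    using g f unfolding L2_on_def set_borel_measurable_def G_def[abs_def] F_def[abs_def] by auto
  have eqs: "(LINT z:A|M. (norm (g z))\<^sup>2) = (LINT z|M. (norm (G z))\<^sup>2)"
    "(LINT z:A|M. (norm (f n z))\<^sup>2) = (LINT z|M. (norm (F n z))\<^sup>2)" for n
    unfolding set_lebesgue_integral_def
    by (intro Bochner_Integration.integral_cong; simp add: G_def F_def power_mult_distrib split: split_indicator)+
  have intG: "integrable M (\<lambda>z. (norm (G z))\<^sup>2)"
  proof (rule integrableI_bounded)
    have "(\<integral>\<^sup>+z. ennreal (norm ((norm (G z))\<^sup>2)) \<partial>M) = (\<integral>\<^sup>+z\<in>A. ennreal ((norm (g z))\<^sup>2) \<partial>M)"
      by (intro nn_integral_cong) (simp add: G_def split: split_indicator)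
    then show "(\<integral>\<^sup>+z. ennreal (norm ((norm (G z))\<^sup>2)) \<partial>M) < \<infinity>" using g by (simp add: L2_on_def)
  qed simp
  define D where "D n = (\<integral>\<^sup>+z. ennreal ((norm (F n z - G z))\<^sup>2) \<partial>M)" for n
  have "D n = (\<integral>\<^sup>+z\<in>A. ennreal ((norm (f n z - g z))\<^sup>2) \<partial>M)" for n
    unfolding D_def by (intro nn_integral_cong) (simp add: G_def F_def split: split_indicator)
  then have "D = (\<lambda>n. \<integral>\<^sup>+z\<in>A. ennreal ((norm (f n z - g z))\<^sup>2) \<partial>M)" by (rule ext)
  then have D0: "D \<longlonglongrightarrow> 0" using lim by (simp add: L2_tendsto_def)
  have I0: "0 \<le> (LINT z|M. (norm (G z))\<^sup>2)" by simp
  show ?thesis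
    unfolding eqs
  proof (rule LIMSEQ_I)
    fix e :: real assume e: "0 < e"
    define I where "I = (LINT z|M. (norm (G z))\<^sup>2)"
    have In: "0 \<le> I" using I0 by (simp add: I_def)
    define \<eta> where "\<eta> = e / (2 * (I + 1))"
    have \<eta>: "0 < \<eta>" "\<eta> * I < e / 2"
    proof -
      have "0 < 2 * (I + 1)" using In by simp
      then show "0 < \<eta>" unfolding \<eta>_def by (rule divide_pos_pos[OF e])
      have "\<eta> * I < \<eta> * (I + 1)" using \<open>0 < \<eta>\<close> by simp
      also have "\<dots> = e / 2" using In by (simp add: \<eta>_def field_simps)
      finally show "\<eta> * I < e / 2" .
    qed
    define \<kappa> where "\<kappa> = (e / 2) / (1 + 1 / \<eta>)"
    define q where "q = 1 + 1 / \<eta>"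
    have "0 < q" using \<eta>(1) by (simp add: q_def add_pos_pos)
    then have \<kappa>: "0 < \<kappa>" "(1 + 1 / \<eta>) * \<kappa> = e / 2" using e by (simp_all add: \<kappa>_def q_def[symmetric])
    have "\<forall>\<^sub>F n in sequentially. D n < ennreal \<kappa>"
      using D0 \<kappa>(1) by (intro order_tendstoD(2)[OF D0]) auto
    then obtain n0 where n0: "\<And>n. n \<ge> n0 \<Longrightarrow> D n < ennreal \<kappa>" by (auto simp: eventually_sequentially)
    have "\<bar>(LINT z|M. (norm (F n z))\<^sup>2) - I\<bar> < e" if "n \<ge> n0" for n
    proof -
      have Dn: "D n < ennreal \<kappa>" using n0 that by blast
      have intD: "integrable M (\<lambda>z. (norm (F n z - G z))\<^sup>2)"
        using Dn by (intro integrableI_bounded) (auto simp: D_def intro: less_trans)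
      have dn: "(LINT z|M. (norm (F n z - G z))\<^sup>2) < \<kappa>"
      proof -
        have "ennreal (LINT z|M. (norm (F n z - G z))\<^sup>2) = D n"
          unfolding D_def by (rule nn_integral_eq_integral[symmetric]) (use intD in auto)
        then have "ennreal (LINT z|M. (norm (F n z - G z))\<^sup>2) < ennreal \<kappa>" using Dn by (simp only:)
        then show ?thesis by (subst (asm) ennreal_less_iff) auto
      qed
      have intF: "integrable M (\<lambda>z. (norm (F n z))\<^sup>2)"
      proof (rule Bochner_Integration.integrable_bound)
        show "integrable M (\<lambda>z. 2 * (norm (F n z - G z))\<^sup>2 + 2 * (norm (G z))\<^sup>2)" using intD intG by simp
        have "(norm (F n z))\<^sup>2 \<le> 2 * (norm (F n z - G z))\<^sup>2 + 2 * (norm (G z))\<^sup>2" for z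
          using sq_norm_diff_le[of 1 "F n z" "G z"] by simp
        then show "AE z in M. norm ((norm (F n z))\<^sup>2) \<le> norm (2 * (norm (F n z - G z))\<^sup>2 + 2 * (norm (G z))\<^sup>2)" by simp
      qed simp
      have "\<bar>(LINT z|M. (norm (F n z))\<^sup>2) - I\<bar> = \<bar>LINT z|M. (norm (F n z))\<^sup>2 - (norm (G z))\<^sup>2\<bar>"
        using intF intG by (simp add: I_def)
      also have "\<dots> \<le> (LINT z|M. \<bar>(norm (F n z))\<^sup>2 - (norm (G z))\<^sup>2\<bar>)" by (rule integral_abs_bound)
      also have "\<dots> \<le> (LINT z|M. (1 + 1 / \<eta>) * (norm (F n z - G z))\<^sup>2 + \<eta> * (norm (G z))\<^sup>2)"
        using intF intG intD \<eta> by (intro integral_mono sq_norm_diff_le) auto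
      also have "\<dots> = (1 + 1 / \<eta>) * (LINT z|M. (norm (F n z - G z))\<^sup>2) + \<eta> * I"
        using intG intD by (simp add: I_def)
      also have "\<dots> < (1 + 1 / \<eta>) * \<kappa> + e / 2"
        using dn \<eta> by (intro add_strict_mono mult_strict_left_mono) (auto intro: add_pos_pos)
      also have "\<dots> = e" unfolding \<kappa>(2) by simp
      finally show ?thesis .
    qed
    then show "\<exists>n0. \<forall>n\<ge>n0. norm ((LINT z|M. (norm (F n z))\<^sup>2) - (LINT z|M. (norm (G z))\<^sup>2)) < e"
      by (auto simp: I_def)
  qed
qed

lemma test_functionE:
  assumes "\<phi> \<in> test_functions U"
  obtains K where "compact K" "K \<subseteq> U" "\<And>z. z \<notin> K \<Longrightarrow> \<phi> z = 0" "\<And>z b. z \<notin> K \<Longrightarrow> partial b \<phi> z = 0"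
proof -
  obtain K where K: "compact K" "K \<subseteq> U" "\<And>z. z \<notin> K \<Longrightarrow> \<phi> z = 0"
    using assms unfolding test_functions_def by blast
  then show ?thesis using partial_eq_0_off_support[of K \<phi>] that by blast
qed

lemma bounded_if_compact_support:
  fixes f :: "complex \<Rightarrow> 'b::real_normed_vector"
  assumes "compact K" "\<And>z. z \<notin> K \<Longrightarrow> f z = 0" "continuous_on K f"
  obtains C where "0 \<le> C" "\<And>z. norm (f z) \<le> C"
proof -
  have "bounded (f ` K)" using assms by (intro compact_imp_bounded compact_continuous_image)
  then obtain C where C: "\<And>z. z \<in> K \<Longrightarrow> norm (f z) \<le> C" unfolding bounded_iff by blast
  have "norm (f z) \<le> max C 0" for z using C[of z] assms(2)[of z] by (cases "z \<in> K") auto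
  then show ?thesis by (intro that[of "max C 0"]) auto
qed

lemma borel_measurable_hyp_area:
  fixes h :: "complex \<Rightarrow> 'b::topological_space"
  assumes "continuous_on hplane h" shows "h \<in> borel_measurable hyp_area"
  using borel_measurable_continuous_on_restrict[OF assms] by (simp add: measurable_cong_sets[OF sets_hyp_area refl])

lemma integrable_hyp_area:
  fixes h :: "complex \<Rightarrow> real"
  assumes h: "continuous_on hplane h" and K: "compact K" "K \<subseteq> hplane" "\<And>z. z \<in> hplane \<Longrightarrow> z \<notin> K \<Longrightarrow> h z = 0"
  shows "integrable hyp_area h"
proof (rule integrableI_bounded)
  show m: "h \<in> borel_measurable hyp_area" by (rule borel_measurable_hyp_area[OF h])
  have "continuous_on K (\<lambda>z. (conf z)\<^sup>2 * \<bar>h z\<bar>)"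
    by (intro continuous_intros continuous_on_conf K continuous_on_subset[OF h])
  then have "bounded ((\<lambda>z. (conf z)\<^sup>2 * \<bar>h z\<bar>) ` K)" using K by (intro compact_imp_bounded compact_continuous_image)
  then obtain C where C: "\<And>z. z \<in> K \<Longrightarrow> (conf z)\<^sup>2 * \<bar>h z\<bar> \<le> C" unfolding bounded_iff by force
  have "(\<integral>\<^sup>+z. ennreal (norm (h z)) \<partial>hyp_area) = (\<integral>\<^sup>+z. ennreal ((conf z)\<^sup>2) * ennreal (norm (h z)) * indicator hplane z \<partial>lborel)"
    by (rule nn_integral_hyp_area) (use m in measurable)
  also have "\<dots> \<le> (\<integral>\<^sup>+z. ennreal C * indicator K z \<partial>lborel)"
  proof (rule nn_integral_mono)
    fix z
    show "ennreal ((conf z)\<^sup>2) * ennreal (norm (h z)) * indicator hplane z \<le> ennreal C * indicator K z"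
      using C[of z] K(2,3) by (cases "z \<in> K"; cases "z \<in> hplane") (auto simp: ennreal_mult[symmetric] intro: ennreal_leI)
  qed
  also have "\<dots> = ennreal C * emeasure lborel K"
    using K(1) by (intro nn_integral_cmult_indicator) (auto intro: borel_compact)
  also have "\<dots> < \<infinity>"
    using emeasure_bounded_finite[OF compact_imp_bounded[OF K(1)]] by (simp add: ennreal_mult_less_top)
  finally show "(\<integral>\<^sup>+z. ennreal (norm (h z)) \<partial>hyp_area) < \<infinity>" .
qed

definition gradsq :: "(complex \<Rightarrow> complex) \<Rightarrow> complex \<Rightarrow> real" where
  "gradsq \<phi> z = (cmod (partial 1 \<phi> z))\<^sup>2 + (cmod (partial \<i> \<phi> z))\<^sup>2"

lemma norm_hframe_grad: "(norm (hframe (grad \<phi>) z))\<^sup>2 = gradsq \<phi> z / (conf z)\<^sup>2"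
  by (simp add: hframe_def grad_def gradsq_def norm_Pair power_mult_distrib power_divide divide_inverse power_inverse algebra_simps)

lemma continuous_on_gradsq:
  assumes "\<phi> \<in> test_functions V" shows "continuous_on A (gradsq \<phi>)"
  unfolding gradsq_def[abs_def] by (intro continuous_intros test_function_continuous_partial[OF assms])

lemma conf_nonzero: "z \<in> hplane \<Longrightarrow> conf z \<noteq> 0"
  using conf_pos by force

lemma integrable_test_mass:
  assumes "\<phi> \<in> test_functions hplane"
  shows "integrable hyp_area (\<lambda>z. (cmod (\<phi> z))\<^sup>2)"
proof -
  obtain K where K: "compact K" "K \<subseteq> hplane" "\<And>z. z \<notin> K \<Longrightarrow> \<phi> z = 0" using test_functionE[OF assms] by metis
  then show ?thesis
    by (intro integrable_hyp_area[where K = K] continuous_intros test_function_continuous_on[OF assms]) auto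
qed

lemma integrable_test_dirichlet:
  assumes "\<phi> \<in> test_functions hplane"
  shows "integrable hyp_area (\<lambda>z. (norm (hframe (grad \<phi>) z))\<^sup>2)"
proof -
  obtain K where K: "compact K" "K \<subseteq> hplane" "\<And>z b. z \<notin> K \<Longrightarrow> partial b \<phi> z = 0" using test_functionE[OF assms] by metis
  then show ?thesis unfolding norm_hframe_grad
    by (intro integrable_hyp_area[where K = K] continuous_intros continuous_on_gradsq[OF assms] continuous_on_conf)
       (auto simp: conf_nonzero gradsq_def)
qed

lemma continuous_on_hframe_grad:
  assumes "\<phi> \<in> test_functions V" shows "continuous_on hplane (hframe (grad \<phi>))"
  unfolding hframe_def[abs_def] grad_def
  by (intro continuous_intros test_function_continuous_partial[OF assms] continuous_on_conf) (auto simp: conf_nonzero)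

lemma open_in_sets_hyp_area: "open U \<Longrightarrow> U \<subseteq> hplane \<Longrightarrow> U \<in> sets hyp_area"
  by (auto simp: sets_hyp_area sets_restrict_space_iff)

lemma L2_on_hyp_area:
  fixes f :: "complex \<Rightarrow> 'b::{real_normed_vector, second_countable_topology}"
  assumes U: "open U" "U \<subseteq> hplane" and f: "continuous_on hplane f" "integrable hyp_area (\<lambda>z. (norm (f z))\<^sup>2)"
  shows "L2_on hyp_area U f"
  unfolding L2_on_def
proof
  show "set_borel_measurable hyp_area U f"
    unfolding set_borel_measurable_def
    by (intro borel_measurable_scaleR borel_measurable_indicator open_in_sets_hyp_area U borel_measurable_hyp_area f)
  have "(\<integral>\<^sup>+z\<in>U. ennreal ((norm (f z))\<^sup>2) \<partial>hyp_area) \<le> (\<integral>\<^sup>+z. ennreal (norm ((norm (f z))\<^sup>2)) \<partial>hyp_area)"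
    by (intro nn_integral_mono) (simp split: split_indicator)
  also have "\<dots> < \<infinity>" using f(2) by (simp add: integrable_iff_bounded)
  finally show "(\<integral>\<^sup>+z\<in>U. ennreal ((norm (f z))\<^sup>2) \<partial>hyp_area) < \<infinity>" .
qed

lemma L2_on_test:
  assumes "open U" "U \<subseteq> hplane" "\<phi> \<in> test_functions hplane"
  shows "L2_on hyp_area U \<phi>" "L2_on hyp_area U (hframe (grad \<phi>))"
  using assms by (auto intro!: L2_on_hyp_area integrable_test_mass integrable_test_dirichlet
      continuous_on_hframe_grad test_function_continuous_on)

text \<open>The difference quotients of \<open>f\<close> have integral zero by translation invariance. They converge to the
partial derivative and are dominated, since \<open>f\<close> is Lipschitz with compact support.\<close>

lemma integral_partial_eq_0:
  assumes f: "f \<in> test_functions U"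
  shows "(LINT z|lborel. partial b f z) = 0" 
proof -
  obtain K where K: "compact K" "\<And>z. z \<notin> K \<Longrightarrow> f z = 0" "\<And>z b. z \<notin> K \<Longrightarrow> partial b f z = 0"
    using test_functionE[OF f] by metis
  obtain C1 where C1: "0 \<le> C1" "\<And>z. norm (partial 1 f z) \<le> C1"
    using bounded_if_compact_support[OF K(1) K(3) test_function_continuous_partial(1)[OF f]] by metis
  obtain C2 where C2: "0 \<le> C2" "\<And>z. norm (partial \<i> f z) \<le> C2"
    using bounded_if_compact_support[OF K(1) K(3) test_function_continuous_partial(2)[OF f]] by metis
  have cf [measurable]: "f \<in> borel_measurable borel"
    by (intro borel_measurable_continuous_onI test_function_continuous_on[OF f])
  have lip: "norm (f z - f w) \<le> (C1 + C2) * norm (z - w)" for z w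
  proof (rule differentiable_bound[of UNIV])
    fix z
    show "(f has_derivative (\<lambda>v. Re v *\<^sub>R partial 1 f z + Im v *\<^sub>R partial \<i> f z)) (at z)"
      by (rule has_derivative_partial[OF test_function_differentiable[OF f]])
    show "onorm (\<lambda>v. Re v *\<^sub>R partial 1 f z + Im v *\<^sub>R partial \<i> f z) \<le> C1 + C2"
    proof (rule onorm_bound)
      fix v
      have "norm (Re v *\<^sub>R partial 1 f z + Im v *\<^sub>R partial \<i> f z) \<le> \<bar>Re v\<bar> * C1 + \<bar>Im v\<bar> * C2"
        by (rule norm_triangle_le) (auto intro!: add_mono mult_left_mono C1 C2)
      also have "\<dots> \<le> norm v * C1 + norm v * C2"
        by (intro add_mono mult_right_mono abs_Re_le_cmod abs_Im_le_cmod C1 C2)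
      finally show "norm (Re v *\<^sub>R partial 1 f z + Im v *\<^sub>R partial \<i> f z) \<le> (C1 + C2) * norm v"
        by (simp add: algebra_simps)
    qed (use C1 C2 in simp)
  qed auto
  obtain r where r: "\<And>z. z \<in> K \<Longrightarrow> norm z \<le> r" using compact_imp_bounded[OF K(1)] unfolding bounded_iff by blast
  define g where "g n z = real (Suc n) *\<^sub>R (f (z + b /\<^sub>R real (Suc n)) - f z)" for n z
  have intf: "integrable lborel f"
  proof -
    have "integrable lborel (\<lambda>z. indicator K z *\<^sub>R f z)"
      using borel_integrable_compact[OF K(1) test_function_continuous_on[OF f]] .
    moreover have "(\<lambda>z. indicator K z *\<^sub>R f z) = f" using K(2) by (auto simp: fun_eq_iff split: split_indicator)
    ultimately show ?thesis by simp
  qed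
  have shift: "integrable lborel (\<lambda>z. f (z + c))" "(LINT z|lborel. f (z + c)) = (LINT z|lborel. f z)" for c
  proof -
    have "lborel = distr lborel borel ((+) c)" by (rule lborel_distr_plus[symmetric])
    then show "(LINT z|lborel. f (z + c)) = (LINT z|lborel. f z)"
      using integral_distr[of "(+) c" lborel borel f] by (simp add: add.commute)
    show "integrable lborel (\<lambda>z. f (z + c))"
      using integrable_distr_eq[of "(+) c" lborel borel f] intf lborel_distr_plus[of c] by (simp add: add.commute)
  qed
  have g0: "(LINT z|lborel. g n z) = 0" for n
    unfolding g_def using shift[of "b /\<^sub>R real (Suc n)"] intf by (simp del: of_nat_Suc)
  have "(\<lambda>n. LINT z|lborel. g n z) \<longlonglongrightarrow> (LINT z|lborel. partial b f z)"
  proof (rule integral_dominated_convergence)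
    show "(\<lambda>z. partial b f z) \<in> borel_measurable lborel"
    proof -
      have "partial b f z = Re b *\<^sub>R partial 1 f z + Im b *\<^sub>R partial \<i> f z" for z
        by (rule partial_eqI[OF has_derivative_partial[OF test_function_differentiable[OF f]]])
      then have "continuous_on UNIV (\<lambda>z. partial b f z)"
        using test_function_continuous_partial[OF f] by (simp only:) (intro continuous_intros)
      then show ?thesis by (simp add: borel_measurable_continuous_onI)
    qed
    show "g n \<in> borel_measurable lborel" for n unfolding g_def[abs_def] by measurable
    show "integrable lborel (\<lambda>z. ((C1 + C2) * norm b) * indicator (cball (0::complex) (r + norm b)) z :: real)"
      using emeasure_lborel_cball_finite[of "0::complex" "r + norm b"] 
      by (intro integrable_mult_right integrable_real_indicator) auto
    show "AE z in lborel. (\<lambda>n. g n z) \<longlonglongrightarrow> partial b f z"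
    proof (rule AE_I2)
      fix z
      show "(\<lambda>n. g n z) \<longlonglongrightarrow> partial b f z"
      proof (cases "b = 0")
        case False
        obtain f' where f': "(f has_derivative f') (at z)"
          using test_function_differentiable[OF f] unfolding differentiable_def by blast
        interpret f': bounded_linear f' using f' by (rule has_derivative_bounded_linear)
        have "((\<lambda>h. norm (f (z + h) - f z - f' h) / norm h) \<longlongrightarrow> 0) (at 0)"
          using f' by (simp add: has_derivative_at)
        moreover have "filterlim (\<lambda>n. b /\<^sub>R real (Suc n)) (at 0) sequentially"
          unfolding filterlim_at
        proof
          have "(\<lambda>n. inverse (real (Suc n)) *\<^sub>R b) \<longlonglongrightarrow> 0 *\<^sub>R b"
            by (intro tendsto_scaleR LIMSEQ_inverse_real_of_nat tendsto_const)
          then show "(\<lambda>n. b /\<^sub>R real (Suc n)) \<longlonglongrightarrow> 0" by simp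
          show "\<forall>\<^sub>F n in sequentially. b /\<^sub>R real (Suc n) \<in> UNIV \<and> b /\<^sub>R real (Suc n) \<noteq> 0" using False by simp
        qed
        ultimately have "(\<lambda>n. norm (f (z + b /\<^sub>R real (Suc n)) - f z - f' (b /\<^sub>R real (Suc n))) / norm (b /\<^sub>R real (Suc n))) \<longlonglongrightarrow> 0"
          by (rule filterlim_compose)
        then have "(\<lambda>n. norm b * (norm (f (z + b /\<^sub>R real (Suc n)) - f z - f' (b /\<^sub>R real (Suc n))) / norm (b /\<^sub>R real (Suc n)))) \<longlonglongrightarrow> norm b * 0"
          by (intro tendsto_intros)
        moreover have "norm b * (norm (f (z + b /\<^sub>R real (Suc n)) - f z - f' (b /\<^sub>R real (Suc n))) / norm (b /\<^sub>R real (Suc n)))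
            = norm (g n z - f' b)" for n
        proof -
          have "g n z - f' b = real (Suc n) *\<^sub>R (f (z + b /\<^sub>R real (Suc n)) - f z - f' (b /\<^sub>R real (Suc n)))"
            unfolding g_def f'.scaleR by (simp add: scaleR_diff_right del: of_nat_Suc)
          moreover have "norm b * (norm d / norm (b /\<^sub>R real (Suc n))) = norm (real (Suc n) *\<^sub>R d)" for d :: complex
            using False by (simp add: field_simps del: of_nat_Suc)
          ultimately show ?thesis by (simp only:)
        qed
        ultimately have "(\<lambda>n. norm (g n z - f' b)) \<longlonglongrightarrow> 0" by simp
        then have "(\<lambda>n. g n z) \<longlonglongrightarrow> f' b" by (simp add: tendsto_norm_zero_iff LIM_zero_iff)
        then show ?thesis by (simp add: partial_eqI[OF f'])
      next
        case True
        have "partial 0 f z = 0"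
          using partial_eqI[OF has_derivative_partial[OF test_function_differentiable[OF f]], of 0 z] by simp
        then show ?thesis using True by (simp add: g_def)
      qed
    qed
    show "AE z in lborel. norm (g n z) \<le> ((C1 + C2) * norm b) * indicator (cball 0 (r + norm b)) z" for n
    proof (rule AE_I2)
      fix z
      let ?h = "b /\<^sub>R real (Suc n)"
      have nh: "norm ?h \<le> norm b" by (simp add: divide_simps mult_left_le_one_le del: of_nat_Suc) (simp add: distrib_left)
      show "norm (g n z) \<le> ((C1 + C2) * norm b) * indicator (cball 0 (r + norm b)) z"
      proof (cases "norm z \<le> r + norm b")
        case True
        have "norm (g n z) = real (Suc n) * norm (f (z + ?h) - f z)" by (simp add: g_def del: of_nat_Suc)
        also have "\<dots> \<le> real (Suc n) * ((C1 + C2) * norm ?h)"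
          using lip[of "z + ?h" z] by (intro mult_left_mono) auto
        also have "\<dots> = (C1 + C2) * norm b" by (simp del: of_nat_Suc)
        finally show ?thesis using True by simp
      next
        case False
        then have "z \<notin> K" using r[of z] norm_ge_zero[of b] by linarith
        moreover have "z + ?h \<notin> K"
        proof
          assume "z + ?h \<in> K"
          then have "norm (z + ?h) \<le> r" using r by blast
          then have "norm z \<le> r + norm ?h" using norm_triangle_ineq4[of "z + ?h" ?h] by simp
          then show False using False nh by linarith
        qed
        ultimately have "g n z = 0" using K(2) by (simp add: g_def)
        then show ?thesis using C1 C2 by simp
      qed
    qed
  qed
  then show ?thesis unfolding g0 LIMSEQ_const_iff by (rule sym)
qed

lemma test_function_mult:
  assumes "\<phi> \<in> test_functions U" "\<psi> \<in> test_functions V"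
  shows "(\<lambda>z. \<phi> z * \<psi> z) \<in> test_functions V"
proof -
  obtain K where K: "compact K" "K \<subseteq> V" "\<And>z. z \<notin> K \<Longrightarrow> \<psi> z = 0" using assms(2) unfolding test_functions_def by blast
  have "Ck k (\<lambda>z. \<phi> z * \<psi> z)" for k
    unfolding Ck_eq_Ck_on_UNIV by (intro Ck_on_mult test_function_Ck_on[OF assms(1)] test_function_Ck_on[OF assms(2)]) simp
  moreover have "\<forall>z. z \<notin> K \<longrightarrow> \<phi> z * \<psi> z = 0" using K(3) by simp
  ultimately show ?thesis using K(1,2) unfolding test_functions_def mem_Collect_eq by blast
qed

text \<open>Integration by parts: the derivative of the product \<open>\<phi> * \<psi>\<close> has integral zero.\<close>

lemma weak_grad_test:
  assumes \<phi>: "\<phi> \<in> test_functions V" shows "weak_grad U \<phi> (grad \<phi>)"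
  unfolding weak_grad_def
proof
  fix \<psi> assume \<psi>: "\<psi> \<in> test_functions U"
  obtain K where K: "compact K" "K \<subseteq> U" "\<And>z. z \<notin> K \<Longrightarrow> \<psi> z = 0" "\<And>z b. z \<notin> K \<Longrightarrow> partial b \<psi> z = 0"
    using test_functionE[OF \<psi>] by metis
  have main: "(LINT z:U|lborel. \<phi> z * partial b \<psi> z) = - (LINT z:U|lborel. partial b \<phi> z * \<psi> z)"
    if c: "continuous_on UNIV (partial b \<phi>)" "continuous_on UNIV (partial b \<psi>)" for b
  proof -
    have int: "integrable lborel h" if "continuous_on UNIV h" "\<And>z. z \<notin> K \<Longrightarrow> h z = 0" for h :: "complex \<Rightarrow> complex"
    proof -
      have "integrable lborel (\<lambda>z. indicator K z *\<^sub>R h z)"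
        using borel_integrable_compact[OF K(1) continuous_on_subset[OF that(1)]] by simp
      moreover have "(\<lambda>z. indicator K z *\<^sub>R h z) = h" using that(2) by (auto simp: fun_eq_iff split: split_indicator)
      ultimately show ?thesis by simp
    qed
    have p: "partial b (\<lambda>z. \<phi> z * \<psi> z) z = \<phi> z * partial b \<psi> z + partial b \<phi> z * \<psi> z" for z
    proof -
      have d: "\<exists>f'. (f has_derivative f') (at z) \<and> f' b = partial b f z" if "f differentiable (at z)" for f
        using that partial_eqI unfolding differentiable_def by metis
      obtain f' g' where "(\<phi> has_derivative f') (at z)" "f' b = partial b \<phi> z"
        "(\<psi> has_derivative g') (at z)" "g' b = partial b \<psi> z"
        using d test_function_differentiable[OF \<phi>] test_function_differentiable[OF \<psi>] by metis
      then show ?thesis using partial_eqI[OF has_derivative_mult[of \<phi> f' z UNIV \<psi> g']] by simp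
    qed
    have "0 = (LINT z|lborel. partial b (\<lambda>z. \<phi> z * \<psi> z) z)"
      by (rule integral_partial_eq_0[OF test_function_mult[OF \<phi> \<psi>], symmetric])
    also have "\<dots> = (LINT z|lborel. \<phi> z * partial b \<psi> z) + (LINT z|lborel. partial b \<phi> z * \<psi> z)"
      unfolding p using K c
      by (intro Bochner_Integration.integral_add int continuous_intros test_function_continuous_on[OF \<phi>] test_function_continuous_on[OF \<psi>]) auto
    also have "(LINT z|lborel. \<phi> z * partial b \<psi> z) = (LINT z:U|lborel. \<phi> z * partial b \<psi> z)"
      unfolding set_lebesgue_integral_def using K by (intro Bochner_Integration.integral_cong) (auto split: split_indicator)
    also have "(LINT z|lborel. partial b \<phi> z * \<psi> z) = (LINT z:U|lborel. partial b \<phi> z * \<psi> z)"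
      unfolding set_lebesgue_integral_def using K by (intro Bochner_Integration.integral_cong) (auto split: split_indicator)
    finally show ?thesis by (simp add: eq_neg_iff_add_eq_0)
  qed
  show "(LINT z:U|lborel. \<phi> z * partial 1 \<psi> z) = - (LINT z:U|lborel. fst (grad \<phi> z) * \<psi> z) \<and>
        (LINT z:U|lborel. \<phi> z * partial \<i> \<psi> z) = - (LINT z:U|lborel. snd (grad \<phi> z) * \<psi> z)"
    using main[of 1] main[of \<i>] test_function_continuous_partial[OF \<phi>] test_function_continuous_partial[OF \<psi>]
    by (simp add: grad_def)
qed

lemma hboundary_disk_measurable:
  assumes "p \<in> hplane" "0 < R"
  shows "hboundary (exterior (geodesic_disk p R)) \<in> sets hyp_hausdorff"
    "emeasure hyp_hausdorff (hboundary (exterior (geodesic_disk p R))) < \<infinity>"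
proof -
  let ?S = "sphere 0 (tanh (R / 2)) :: complex set"
  note \<rho> = tanh_half_bounds[OF assms(2)]
  have sub: "?S \<subseteq> hplane" using \<rho> by (auto simp: hplane_iff)
  have "compact (moeb p ` ?S)" by (intro compact_continuous_image continuous_on_moeb assms sub compact_sphere)
  moreover have msub: "moeb p ` ?S \<subseteq> hplane" using sub moeb_in_hplane[OF assms(1)] by blast
  ultimately have 1: "moeb p ` ?S \<in> sets (restrict_space borel hplane)"
    by (auto simp: sets_restrict_space_iff borel_compact)
  then show "hboundary (exterior (geodesic_disk p R)) \<in> sets hyp_hausdorff"
    by (simp add: hboundary_exterior[OF assms] sets_hyp_hausdorff)
  have "emeasure hyp_hausdorff (moeb p ` ?S) = hausdorff_outer ?S"
    using 1 hausdorff_outer_moeb[OF assms(1) sub] by (simp add: emeasure_hyp_hausdorff)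
  also have "\<dots> \<le> ennreal (2 * pi * hcirc (ln (tanh (R / 2))))"
    using hausdorff_outer_circle_le[of "ln (tanh (R / 2))"] \<rho> by simp
  also have "\<dots> < \<infinity>" by simp
  finally show "emeasure hyp_hausdorff (hboundary (exterior (geodesic_disk p R))) < \<infinity>"
    by (simp add: hboundary_exterior[OF assms])
qed

lemma L2_on_test_boundary:
  assumes "p \<in> hplane" "0 < R" "\<phi> \<in> test_functions V"
  shows "L2_on hyp_hausdorff (hboundary (exterior (geodesic_disk p R))) \<phi>" (is "L2_on _ ?B _")
  unfolding L2_on_def
proof
  note B = hboundary_disk_measurable[OF assms(1,2)]
  have m: "\<phi> \<in> borel_measurable hyp_hausdorff"
    using borel_measurable_continuous_onI[OF test_function_continuous_on[OF assms(3)]]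
    by (subst measurable_cong_sets[OF sets_hyp_hausdorff refl]) (rule measurable_restrict_space1)
  show "set_borel_measurable hyp_hausdorff ?B \<phi>"
    unfolding set_borel_measurable_def by (intro borel_measurable_scaleR borel_measurable_indicator B m)
  obtain K where K: "compact K" "\<And>z. z \<notin> K \<Longrightarrow> \<phi> z = 0" using test_functionE[OF assms(3)] by metis
  obtain C where C: "0 \<le> C" "\<And>z. norm (\<phi> z) \<le> C"
    using bounded_if_compact_support[OF K test_function_continuous_on[OF assms(3)]] by metis
  have "(\<integral>\<^sup>+z\<in>?B. ennreal ((norm (\<phi> z))\<^sup>2) \<partial>hyp_hausdorff) \<le> (\<integral>\<^sup>+z. ennreal (C\<^sup>2) * indicator ?B z \<partial>hyp_hausdorff)"
    using C by (intro nn_integral_mono mult_right_mono ennreal_leI power_mono) auto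
  also have "\<dots> = ennreal (C\<^sup>2) * emeasure hyp_hausdorff ?B" by (rule nn_integral_cmult_indicator[OF B(1)])
  also have "\<dots> < \<infinity>" using B(2) by (simp add: ennreal_mult_less_top)
  finally show "(\<integral>\<^sup>+z\<in>?B. ennreal ((norm (\<phi> z))\<^sup>2) \<partial>hyp_hausdorff) < \<infinity>" .
qed

text \<open>Traces are defined through smooth approximation, in norms for which all three integrals of the
  Rayleigh quotient are continuous.\<close>

theorem robin_lambda_eq_INF_test:
  assumes p: "p \<in> hplane" and R: "0 < R"
  defines "U \<equiv> exterior (geodesic_disk p R)"
  shows "robin_lambda \<alpha> U = (INF \<phi>\<in>{\<phi> \<in> test_functions hplane. 0 < mass U \<phi>}.
           ereal ((dirichlet U \<phi> + \<alpha> * bmass U \<phi>) / mass U \<phi>))" (is "_ = ?I")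
proof (rule antisym)
  have U: "open U" "U \<subseteq> hplane" unfolding U_def by (rule open_exterior exterior_subset_hplane)+
  show "robin_lambda \<alpha> U \<le> ?I"
  proof (rule INF_greatest)
    fix \<phi> assume "\<phi> \<in> {\<phi> \<in> test_functions hplane. 0 < mass U \<phi>}"
    then have \<phi>: "\<phi> \<in> test_functions hplane" and pos: "0 < mass U \<phi>" by auto
    have W: "W12 U \<phi> (grad \<phi>)" unfolding W12_def using L2_on_test[OF U \<phi>] weak_grad_test[OF \<phi>] by auto
    have T: "has_trace U \<phi> (grad \<phi>) \<phi>"
      unfolding has_trace_def U_def using L2_on_test_boundary[OF p R \<phi>] \<phi>
      by (auto intro!: exI[of _ "\<lambda>_. \<phi>"] simp: L2_tendsto_def)
    have "\<not> (AE z in hyp_area. z \<in> U \<longrightarrow> \<phi> z = 0)"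
    proof
      assume "AE z in hyp_area. z \<in> U \<longrightarrow> \<phi> z = 0"
      then have "AE z in hyp_area. indicator U z *\<^sub>R (cmod (\<phi> z))\<^sup>2 = 0" by eventually_elim (auto split: split_indicator)
      then have "mass U \<phi> = 0" unfolding mass_def set_lebesgue_integral_def by (rule integral_eq_zero_AE)
      then show False using pos by simp
    qed
    then show "robin_lambda \<alpha> U \<le> ereal ((dirichlet U \<phi> + \<alpha> * bmass U \<phi>) / mass U \<phi>)"
      unfolding robin_lambda_def using W T
      by (intro Inf_lower) (auto simp: robin_quotient_def dirichlet_def mass_def bmass_def)
  qed
  show "?I \<le> robin_lambda \<alpha> U"
    unfolding robin_lambda_def
  proof (rule Inf_greatest)
    fix x assume "x \<in> {ereal (robin_quotient \<alpha> U u G v) |u G v.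
        W12 U u G \<and> has_trace U u G v \<and> \<not> (AE z in hyp_area. z \<in> U \<longrightarrow> u z = 0)}"
    then obtain u G v where x: "x = ereal (robin_quotient \<alpha> U u G v)" and W: "W12 U u G"
      and T: "has_trace U u G v" and nz: "\<not> (AE z in hyp_area. z \<in> U \<longrightarrow> u z = 0)" by blast
    obtain \<phi> where \<phi>: "\<And>n. \<phi> n \<in> test_functions hplane" and lim: "L2_tendsto hyp_area U \<phi> u"
      "L2_tendsto hyp_area U (\<lambda>n. hframe (grad (\<phi> n))) (hframe G)"
      "L2_tendsto hyp_hausdorff (hboundary U) \<phi> v" and v: "L2_on hyp_hausdorff (hboundary U) v"
      using T unfolding has_trace_def by blast
    define m where "m = (LINT z:U|hyp_area. (cmod (u z))\<^sup>2)"
    have m: "(\<lambda>n. mass U (\<phi> n)) \<longlonglongrightarrow> m"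
      unfolding mass_def m_def using W L2_on_test[OF U \<phi>] lim
      by (intro L2_tendsto_norm_integral) (auto simp: W12_def L2_on_def)
    have d: "(\<lambda>n. dirichlet U (\<phi> n)) \<longlonglongrightarrow> (LINT z:U|hyp_area. (norm (hframe G z))\<^sup>2)"
      unfolding dirichlet_def using W L2_on_test[OF U \<phi>] lim
      by (intro L2_tendsto_norm_integral) (auto simp: W12_def L2_on_def)
    have b: "(\<lambda>n. bmass U (\<phi> n)) \<longlonglongrightarrow> (LINT z:hboundary U|hyp_hausdorff. (cmod (v z))\<^sup>2)"
      unfolding bmass_def using v L2_on_test_boundary[OF p R \<phi>] lim
      by (intro L2_tendsto_norm_integral) (auto simp: L2_on_def U_def)
    have mpos: "0 < m"
    proof -
      have u: "L2_on hyp_area U u" using W by (simp add: W12_def)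
      let ?f = "\<lambda>z. indicator U z *\<^sub>R (cmod (u z))\<^sup>2"
      have eq: "?f = (\<lambda>z. (norm (indicator U z *\<^sub>R u z))\<^sup>2)" by (auto simp: fun_eq_iff split: split_indicator)
      have int: "integrable hyp_area ?f"
      proof (rule integrableI_bounded)
        have "(\<lambda>z. indicator U z *\<^sub>R u z) \<in> borel_measurable hyp_area"
          using u unfolding L2_on_def set_borel_measurable_def by blast
        then show "?f \<in> borel_measurable hyp_area"
          unfolding eq by (intro borel_measurable_power measurable_compose[OF _ borel_measurable_norm])
        have "(\<integral>\<^sup>+z. ennreal (norm (?f z)) \<partial>hyp_area) = (\<integral>\<^sup>+z\<in>U. ennreal ((norm (u z))\<^sup>2) \<partial>hyp_area)"
          by (intro nn_integral_cong) (simp split: split_indicator)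
        then show "(\<integral>\<^sup>+z. ennreal (norm (?f z)) \<partial>hyp_area) < \<infinity>" using u by (simp add: L2_on_def)
      qed
      have "m \<noteq> 0"
      proof
        assume "m = 0"
        then have "AE z in hyp_area. ?f z = 0"
          using integral_nonneg_eq_0_iff_AE[OF int] by (simp add: m_def set_lebesgue_integral_def)
        then have "AE z in hyp_area. z \<in> U \<longrightarrow> u z = 0" by eventually_elim (auto split: split_indicator)
        then show False using nz by simp
      qed
      moreover have "0 \<le> m" unfolding m_def set_lebesgue_integral_def by (intro Bochner_Integration.integral_nonneg) simp
      ultimately show ?thesis by simp
    qed
    have "(\<lambda>n. (dirichlet U (\<phi> n) + \<alpha> * bmass U (\<phi> n)) / mass U (\<phi> n)) \<longlonglongrightarrow> robin_quotient \<alpha> U u G v"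
      unfolding robin_quotient_def m_def[symmetric] using mpos by (intro tendsto_intros d b m) auto
    then have "(\<lambda>n. ereal ((dirichlet U (\<phi> n) + \<alpha> * bmass U (\<phi> n)) / mass U (\<phi> n))) \<longlonglongrightarrow> x"
      unfolding x by (simp add: lim_ereal)
    moreover have "\<forall>\<^sub>F n in sequentially. ?I \<le> ereal ((dirichlet U (\<phi> n) + \<alpha> * bmass U (\<phi> n)) / mass U (\<phi> n))"
      using order_tendstoD(1)[OF m mpos] by eventually_elim (intro INF_lower, use \<phi> in auto)
    ultimately show "?I \<le> x" by (rule tendsto_lowerbound) simp
  qed
qed

section \<open>Independence of the centre\<close>

text \<open>Conformality: the differential of \<open>h\<close> is a rotation followed by a dilation by \<open>cmod c\<close>.\<close>

lemma gradsq_compose_holomorphic: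
  assumes "f differentiable (at (h z))" "(h has_field_derivative c) (at z)"
  shows "gradsq (\<lambda>z. f (h z)) z = (cmod c)\<^sup>2 * gradsq f (h z)"
proof -
  have d: "((\<lambda>z. f (h z)) has_derivative (\<lambda>v. Re (c * v) *\<^sub>R partial 1 f (h z) + Im (c * v) *\<^sub>R partial \<i> f (h z))) (at z)"
    using assms(2)
    by (intro has_derivative_compose[where g = f and f = h and f' = "\<lambda>v. c * v"
          and g' = "\<lambda>v. Re v *\<^sub>R partial 1 f (h z) + Im v *\<^sub>R partial \<i> f (h z)"]
        has_derivative_partial[OF assms(1)]) (simp add: has_field_derivative_def)
  show ?thesis
    unfolding gradsq_def partial_eqI[OF d]
    by (simp add: cmod_power2) (simp add: power2_eq_square algebra_simps)
qed

lemma gradsq_cong_open: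
  "open U \<Longrightarrow> z \<in> U \<Longrightarrow> (\<And>w. w \<in> U \<Longrightarrow> f w = g w) \<Longrightarrow> gradsq f z = gradsq g z"
  unfolding gradsq_def using partial_cong_open[of U z f g] by simp

lemma forms_moeb:
  assumes p: "p \<in> hplane" and R: "0 < R" and \<phi>: "\<phi> \<in> test_functions hplane"
    and \<psi>: "\<And>z. z \<in> hplane \<Longrightarrow> \<psi> z = \<phi> (moeb p z)"
  shows "dirichlet (exterior (geodesic_disk p R)) \<phi> = dirichlet (exterior (geodesic_disk 0 R)) \<psi>"
    "mass (exterior (geodesic_disk p R)) \<phi> = mass (exterior (geodesic_disk 0 R)) \<psi>"
    "bmass (exterior (geodesic_disk p R)) \<phi> = bmass (exterior (geodesic_disk 0 R)) \<psi>"
proof -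
  let ?U = "exterior (geodesic_disk p R)" and ?V = "exterior (geodesic_disk 0 R)"
  have 0: "0 \<in> hplane" by (simp add: hplane_iff)
  have m0: "moeb 0 = id" by (simp add: moeb_def fun_eq_iff)
  have inj: "moeb p z \<in> moeb p ` A \<longleftrightarrow> z \<in> A" if "z \<in> hplane" "A \<subseteq> hplane" for z A
    using inj_on_image_mem_iff[OF inj_on_moeb[OF p] that] .
  have U: "indicator ?U (moeb p z) = (indicator ?V z :: real)" if "z \<in> hplane" for z
    using inj[OF that, of "{z \<in> hplane. tanh (R / 2) < cmod z}"]
    by (simp add: exterior_geodesic_disk[OF p R] exterior_geodesic_disk[OF 0 R] m0 indicator_def)
  have B: "indicator (hboundary ?U) (moeb p z) = (indicator (hboundary ?V) z :: real)" if "z \<in> hplane" for z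
    using inj[OF that, of "sphere 0 (tanh (R / 2))"] tanh_half_bounds[OF R]
    by (auto simp: hboundary_exterior[OF p R] hboundary_exterior[OF 0 R] m0 indicator_def hplane_iff subset_iff)
  have U_sets: "?U \<in> sets hyp_area" by (intro open_in_sets_hyp_area open_exterior exterior_subset_hplane)
  have area: "(LINT z:?U|hyp_area. F z) = (LINT z:?V|hyp_area. F (moeb p z))" if "continuous_on hplane F" for F :: "complex \<Rightarrow> real"
  proof -
    have "(LINT z:?U|hyp_area. F z) = (LINT z|distr hyp_area hyp_area (moeb p). indicator ?U z *\<^sub>R F z)"
      unfolding set_lebesgue_integral_def distr_hyp_area_moeb[OF p] ..
    also have "\<dots> = (LINT z|hyp_area. indicator ?U (moeb p z) *\<^sub>R F (moeb p z))"
      by (intro integral_distr measurable_moeb_hyp_area p borel_measurable_scaleR borel_measurable_indicator U_sets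
            borel_measurable_hyp_area that)
    also have "\<dots> = (LINT z:?V|hyp_area. F (moeb p z))"
      unfolding set_lebesgue_integral_def
      by (intro Bochner_Integration.integral_cong refl) (simp add: space_hyp_area U)
    finally show ?thesis .
  qed
  have cong: "(LINT z:A|M. F z) = (LINT z:A|M. F' z)" if "\<And>z. z \<in> space M \<Longrightarrow> F z = F' z" for A F and F' :: "complex \<Rightarrow> real" and M
    unfolding set_lebesgue_integral_def by (intro Bochner_Integration.integral_cong refl) (simp add: that)
  have "mass ?U \<phi> = (LINT z:?V|hyp_area. (cmod (\<phi> (moeb p z)))\<^sup>2)"
    unfolding mass_def by (intro area continuous_intros test_function_continuous_on[OF \<phi>])
  also have "\<dots> = mass ?V \<psi>" unfolding mass_def by (intro cong) (simp add: space_hyp_area \<psi>)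
  finally show "mass ?U \<phi> = mass ?V \<psi>" .
  have "dirichlet ?U \<phi> = (LINT z:?V|hyp_area. (norm (hframe (grad \<phi>) (moeb p z)))\<^sup>2)"
    unfolding dirichlet_def by (intro area continuous_intros continuous_on_hframe_grad[OF \<phi>])
  also have "\<dots> = dirichlet ?V \<psi>"
    unfolding dirichlet_def
  proof (rule cong)
    fix z assume "z \<in> space hyp_area"
    then have z: "z \<in> hplane" by (simp add: space_hyp_area)
    have "gradsq \<psi> z = gradsq (\<lambda>z. \<phi> (moeb p z)) z" by (rule gradsq_cong_open[OF open_hplane z \<psi>])
    also have "\<dots> = (cmod (deriv (moeb p) z))\<^sup>2 * gradsq \<phi> (moeb p z)"
      by (intro gradsq_compose_holomorphic test_function_differentiable[OF \<phi>] holomorphic_derivI[OF holomorphic_moeb[OF p] open_hplane z])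
    finally have "gradsq \<psi> z = (cmod (deriv (moeb p) z))\<^sup>2 * gradsq \<phi> (moeb p z)" .
    moreover have "(conf z)\<^sup>2 = (conf (moeb p z))\<^sup>2 * (cmod (deriv (moeb p) z))\<^sup>2"
      unfolding conf_moeb[OF p z, symmetric] by (rule power_mult_distrib)
    moreover have "cmod (deriv (moeb p) z) \<noteq> 0" using conf_moeb[OF p z] conf_nonzero[OF z] by auto
    ultimately show "(norm (hframe (grad \<phi>) (moeb p z)))\<^sup>2 = (norm (hframe (grad \<psi>) z))\<^sup>2"
      unfolding norm_hframe_grad by simp
  qed
  finally show "dirichlet ?U \<phi> = dirichlet ?V \<psi>" .
  have m: "(\<lambda>z. (cmod (\<phi> z))\<^sup>2) \<in> borel_measurable hyp_hausdorff"
    by (subst measurable_cong_sets[OF sets_hyp_hausdorff refl])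
       (intro measurable_restrict_space1 borel_measurable_continuous_onI continuous_intros test_function_continuous_on[OF \<phi>])
  have "bmass ?U \<phi> = (LINT z|distr hyp_hausdorff hyp_hausdorff (moeb p). indicator (hboundary ?U) z *\<^sub>R (cmod (\<phi> z))\<^sup>2)"
    unfolding bmass_def set_lebesgue_integral_def distr_hyp_hausdorff_moeb[OF p] ..
  also have "\<dots> = (LINT z|hyp_hausdorff. indicator (hboundary ?U) (moeb p z) *\<^sub>R (cmod (\<phi> (moeb p z)))\<^sup>2)"
    by (intro integral_distr measurable_moeb_hyp_hausdorff p borel_measurable_scaleR borel_measurable_indicator
          hboundary_disk_measurable R m)
  also have "\<dots> = bmass ?V \<psi>"
    unfolding bmass_def set_lebesgue_integral_def
    by (intro Bochner_Integration.integral_cong refl) (simp add: space_hyp_hausdorff B \<psi>)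
  finally show "bmass ?U \<phi> = bmass ?V \<psi>" .
qed

theorem robin_lambda_centre:
  assumes p: "p \<in> hplane" and R: "0 < R"
  shows "robin_lambda \<alpha> (exterior (geodesic_disk p R)) = robin_lambda \<alpha> (exterior (geodesic_disk 0 R))"
proof (rule antisym)
  let ?U = "exterior (geodesic_disk p R)" and ?V = "exterior (geodesic_disk 0 R)"
  have 0: "0 \<in> hplane" by (simp add: hplane_iff)
  show "robin_lambda \<alpha> ?V \<le> robin_lambda \<alpha> ?U"
    unfolding robin_lambda_eq_INF_test[OF p R] robin_lambda_eq_INF_test[OF 0 R]
  proof (rule INF_mono)
    fix \<phi> assume "\<phi> \<in> {\<phi> \<in> test_functions hplane. 0 < mass ?U \<phi>}"
    then have \<phi>: "\<phi> \<in> test_functions hplane" and pos: "0 < mass ?U \<phi>" by auto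
    let ?\<psi> = "\<lambda>z. if z \<in> hplane then \<phi> (moeb p z) else 0"
    have "dirichlet ?U \<phi> = dirichlet ?V ?\<psi>" "mass ?U \<phi> = mass ?V ?\<psi>" "bmass ?U \<phi> = bmass ?V ?\<psi>"
      using forms_moeb[OF p R \<phi>, of ?\<psi>] by simp_all
    then show "\<exists>\<psi>\<in>{\<phi> \<in> test_functions hplane. 0 < mass ?V \<phi>}.
        ereal ((dirichlet ?V \<psi> + \<alpha> * bmass ?V \<psi>) / mass ?V \<psi>) \<le> ereal ((dirichlet ?U \<phi> + \<alpha> * bmass ?U \<phi>) / mass ?U \<phi>)"
      using pos test_function_moeb[OF p \<phi>] by (intro bexI[of _ ?\<psi>]) auto
  qed
  show "robin_lambda \<alpha> ?U \<le> robin_lambda \<alpha> ?V"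
    unfolding robin_lambda_eq_INF_test[OF p R] robin_lambda_eq_INF_test[OF 0 R]
  proof (rule INF_mono)
    fix \<psi> assume "\<psi> \<in> {\<phi> \<in> test_functions hplane. 0 < mass ?V \<phi>}"
    then have \<psi>: "\<psi> \<in> test_functions hplane" and pos: "0 < mass ?V \<psi>" by auto
    let ?\<phi> = "\<lambda>z. if z \<in> hplane then \<psi> (moeb (- p) z) else 0"
    have \<phi>: "?\<phi> \<in> test_functions hplane" using test_function_moeb[of "- p" \<psi>] p \<psi> by simp
    have "\<psi> z = ?\<phi> (moeb p z)" if "z \<in> hplane" for z
      using moeb_uminus_moeb[OF p that] moeb_in_hplane[OF p that] by simp
    then have "dirichlet ?U ?\<phi> = dirichlet ?V \<psi>" "mass ?U ?\<phi> = mass ?V \<psi>" "bmass ?U ?\<phi> = bmass ?V \<psi>"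
      using forms_moeb[OF p R \<phi>, of \<psi>] by blast+
    then show "\<exists>\<phi>\<in>{\<phi> \<in> test_functions hplane. 0 < mass ?U \<phi>}.
        ereal ((dirichlet ?U \<phi> + \<alpha> * bmass ?U \<phi>) / mass ?U \<phi>) \<le> ereal ((dirichlet ?V \<psi> + \<alpha> * bmass ?V \<psi>) / mass ?V \<psi>)"
      using pos \<phi> by (intro bexI[of _ ?\<phi>]) auto
  qed
qed

section \<open>One-dimensional inequalities\<close>

lemma has_real_derivative_hcirc:
  assumes "s < 0" shows "(hcirc has_real_derivative cosh s * (hcirc s)\<^sup>2) (at s within S)"
proof -
  have "(sinh has_real_derivative cosh s) (at s within S)"
    by (auto intro!: derivative_eq_intros)
  moreover have "sinh s \<noteq> 0" using assms by simp
  ultimately have "((\<lambda>s. - inverse (sinh s)) has_real_derivative - (- (inverse (sinh s) * cosh s * inverse (sinh s)))) (at s within S)"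
    by (intro DERIV_minus DERIV_inverse')
  moreover have "(\<lambda>s. - inverse (sinh s)) = hcirc" by (simp add: hcirc_def fun_eq_iff inverse_eq_divide)
  moreover have "- (- (inverse (sinh s) * cosh s * inverse (sinh s))) = cosh s * (hcirc s)\<^sup>2"
    by (simp add: hcirc_def inverse_eq_divide power2_eq_square)
  ultimately show ?thesis by (simp only:)
qed

lemma continuous_on_hcirc: "A \<subseteq> {..<0} \<Longrightarrow> continuous_on A hcirc"
  by (intro DERIV_continuous_on[where D = "\<lambda>s. cosh s * (hcirc s)\<^sup>2"] has_real_derivative_hcirc) auto

text \<open>What is left of a test function after averaging over circles: \<open>N\<close> is the mean of its square on the circle
with parameter \<open>s\<close>, \<open>P\<close> the derivative of \<open>N\<close>, and \<open>K\<close> the mean of the squared gradient. The inequality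
quantified over \<open>w\<close> is a form of \<open>P\<^sup>2 \<le> 4 K N\<close> (Cauchy and Schwarz), linear in the profile.\<close>

definition radial_profile :: "real \<Rightarrow> (real \<Rightarrow> real) \<Rightarrow> (real \<Rightarrow> real) \<Rightarrow> (real \<Rightarrow> real) \<Rightarrow> bool" where
  "radial_profile b N P K \<longleftrightarrow> b < 0 \<and>
     (\<forall>s<0. (N has_real_derivative P s) (at s)) \<and> continuous_on {..<0} P \<and> continuous_on {..<0} K \<and>
     (\<forall>s<0. 0 \<le> N s) \<and> (\<forall>s w. s < 0 \<longrightarrow> w * P s \<le> K s + w\<^sup>2 * N s) \<and>
     (\<forall>s. b \<le> s \<and> s < 0 \<longrightarrow> N s = 0)"

lemma radial_profileD:
  assumes "radial_profile b N P K"
  shows "b < 0" "s < 0 \<Longrightarrow> (N has_real_derivative P s) (at s within S)"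
    "A \<subseteq> {..<0} \<Longrightarrow> continuous_on A P" "A \<subseteq> {..<0} \<Longrightarrow> continuous_on A K" "A \<subseteq> {..<0} \<Longrightarrow> continuous_on A N"
    "s < 0 \<Longrightarrow> 0 \<le> N s" "s < 0 \<Longrightarrow> w * P s \<le> K s + w\<^sup>2 * N s" "b \<le> s \<Longrightarrow> s < 0 \<Longrightarrow> N s = 0"
proof -
  have N: "\<And>s S. s < 0 \<Longrightarrow> (N has_real_derivative P s) (at s within S)"
    using assms unfolding radial_profile_def by (blast intro: has_field_derivative_at_within)
  then show "s < 0 \<Longrightarrow> (N has_real_derivative P s) (at s within S)" .
  show "A \<subseteq> {..<0} \<Longrightarrow> continuous_on A N" by (intro DERIV_continuous_on[where D = P] N) auto
qed (use assms continuous_on_subset in \<open>auto simp: radial_profile_def\<close>)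

text \<open>Integrated over \<open>s\<close>, this gives the hyperbolic mass: \<open>(hcirc s)\<^sup>2\<close> is the density of the area.\<close>

definition mass_density :: "(real \<Rightarrow> real) \<Rightarrow> real \<Rightarrow> real" where
  "mass_density N s = (hcirc s)\<^sup>2 * N s"

text \<open>Integrate the derivative of \<open>W * N\<close> and use \<open>W * P \<le> K + W\<^sup>2 * N\<close>; then \<open>W' + W\<^sup>2\<close> is left as a
potential. In terms of the radius, \<open>W = w * hcirc\<close> corresponds to the logarithmic derivative \<open>w\<close>.\<close>

lemma barta:
  assumes prof: "radial_profile b N P K" and ac: "a \<le> c" "c < 0"
    and W: "\<And>s. s \<in> {a..c} \<Longrightarrow> (W has_real_derivative W' s) (at s within {a..c})"
    and W': "continuous_on {a..c} W'"
    and ineq: "\<And>s. s \<in> {a..c} \<Longrightarrow> W' s + (W s)\<^sup>2 \<le> - k * (hcirc s)\<^sup>2"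
  shows "W c * N c - W a * N a + k * integral {a..c} (mass_density N) \<le> integral {a..c} K"
proof -
  note D = radial_profileD[OF prof]
  have sub: "{a..c} \<subseteq> {..<0}" using ac by auto
  have Wc: "continuous_on {a..c} W" using W DERIV_continuous_on by blast
  have int: "((\<lambda>s. W' s * N s + P s * W s) has_integral W c * N c - W a * N a) {a..c}"
  proof (rule fundamental_theorem_of_calculus[OF ac(1)])
    fix s assume s: "s \<in> {a..c}"
    then have "s < 0" using ac by auto
    from DERIV_mult[OF W[OF s] D(2)[OF this]]
    show "((\<lambda>s. W s * N s) has_vector_derivative W' s * N s + P s * W s) (at s within {a..c})"
      by (simp add: has_real_derivative_iff_has_vector_derivative)
  qed
  have i1: "(\<lambda>s. W' s * N s + P s * W s) integrable_on {a..c}" using int by blast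
  have i2: "K integrable_on {a..c}" by (intro integrable_continuous_real D sub)
  have i3: "mass_density N integrable_on {a..c}"
    unfolding mass_density_def[abs_def] by (intro integrable_continuous_real continuous_intros D sub continuous_on_hcirc)
  have i4: "(\<lambda>s. k * mass_density N s) integrable_on {a..c}"
    unfolding mass_density_def[abs_def] by (intro integrable_continuous_real continuous_intros D sub continuous_on_hcirc)
  have "W c * N c - W a * N a + k * integral {a..c} (mass_density N)
      = integral {a..c} (\<lambda>s. W' s * N s + P s * W s) + integral {a..c} (\<lambda>s. k * mass_density N s)"
    using integral_unique[OF int] by simp
  also have "\<dots> = integral {a..c} (\<lambda>s. W' s * N s + P s * W s + k * mass_density N s)"
    by (rule Henstock_Kurzweil_Integration.integral_add[symmetric, OF i1 i4])
  also have "\<dots> \<le> integral {a..c} K"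
  proof (rule integral_le)
    show "(\<lambda>s. W' s * N s + P s * W s + k * mass_density N s) integrable_on {a..c}"
      by (rule integrable_add[OF i1 i4])
    fix s assume s: "s \<in> {a..c}"
    then have s0: "s < 0" using ac by auto
    have "W' s * N s + (W s)\<^sup>2 * N s + k * mass_density N s = (W' s + (W s)\<^sup>2 + k * (hcirc s)\<^sup>2) * N s"
      by (simp add: mass_density_def algebra_simps)
    also have "\<dots> \<le> 0"
      using ineq[OF s] D(6)[OF s0] by (intro mult_nonpos_nonneg) auto
    finally show "W' s * N s + P s * W s + k * mass_density N s \<le> K s"
      using D(7)[OF s0, of "W s"] by (simp add: mult.commute)
  qed (rule i2)
  finally show ?thesis .
qed

lemma cosh_mono_neg: "s \<le> t \<Longrightarrow> t \<le> 0 \<Longrightarrow> cosh t \<le> cosh (s::real)"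
  using cosh_real_nonneg_le_iff[of "- t" "- s"] by simp

text \<open>A constant logarithmic derivative \<open>w \<le> 0\<close> has the potential \<open>- w\<^sup>2 - w coth r\<close>, which is smallest at the
outer end \<open>c\<close>.\<close>

lemma barta_const:
  assumes prof: "radial_profile b N P K" and ac: "a \<le> c" "c < 0"
    and w: "w \<le> 0" and k: "k \<le> - w\<^sup>2 - w * cosh c"
  shows "w * hcirc c * N c - w * hcirc a * N a + k * integral {a..c} (mass_density N) \<le> integral {a..c} K"
proof (rule barta[OF prof ac, where W' = "\<lambda>s. w * (cosh s * (hcirc s)\<^sup>2)"])
  fix s assume s: "s \<in> {a..c}"
  then show "((\<lambda>s. w * hcirc s) has_real_derivative w * (cosh s * (hcirc s)\<^sup>2)) (at s within {a..c})"
    using ac by (intro DERIV_cmult has_real_derivative_hcirc) auto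
  have "w * cosh s \<le> w * cosh c" using s ac w cosh_mono_neg[of s c] by (intro mult_left_mono_neg) auto
  then have "w * cosh s + w\<^sup>2 \<le> - k" using k by simp
  then have "(w * cosh s + w\<^sup>2) * (hcirc s)\<^sup>2 \<le> - k * (hcirc s)\<^sup>2" by (intro mult_right_mono) auto
  then show "w * (cosh s * (hcirc s)\<^sup>2) + (w * hcirc s)\<^sup>2 \<le> - k * (hcirc s)\<^sup>2"
    by (simp add: algebra_simps power_mult_distrib)
qed (use ac in \<open>auto intro!: continuous_intros continuous_on_hcirc\<close>)

text \<open>The value \<open>w = - 1 / 2\<close> maximises \<open>- w\<^sup>2 - w\<close>, the limit of the potential at infinity; the maximum \<open>1 / 4\<close>
is the bottom of the essential spectrum.\<close>

lemma tail_bound: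
  assumes prof: "radial_profile b N P K" and ac: "a \<le> e" "b \<le> e" "e < 0"
  shows "hcirc a * N a / 2 + integral {a..e} (mass_density N) / 4 \<le> integral {a..e} K"
proof -
  have "1 / 4 \<le> - (- 1 / 2)\<^sup>2 - (- 1 / 2) * cosh e" using cosh_real_ge_1[of e] by (simp add: power2_eq_square)
  from barta_const[OF prof ac(1,3) _ this] radial_profileD(8)[OF prof ac(2,3)]
  show ?thesis by simp
qed

text \<open>The logarithmic derivative is \<open>\<alpha>\<close> at \<open>a\<close>, so that the boundary term is the Robin term, runs linearly to
\<open>- 1 / 2\<close> at \<open>a'\<close>, and continues as in \<open>tail_bound\<close>. The price is a potential bounded from below on
the layer between \<open>a\<close> and \<open>a'\<close>.\<close>

lemma boundary_layer_bound:
  assumes "a < a'" "a' < 0"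
  obtains C where "0 \<le> C" and
    "\<And>b N P K e. radial_profile b N P K \<Longrightarrow> a' \<le> e \<Longrightarrow> b \<le> e \<Longrightarrow> e < 0 \<Longrightarrow>
       integral {a'..e} (mass_density N) / 4 - C * integral {a..a'} (mass_density N)
         \<le> integral {a..e} K + \<alpha> * hcirc a * N a"
proof -
  define w1 where "w1 = (- 1 / 2 - \<alpha>) / (a' - a)"
  define w where "w s = \<alpha> + w1 * (s - a)" for s
  define W' where "W' s = w1 * hcirc s + w s * (cosh s * (hcirc s)\<^sup>2)" for s
  have sub: "{a..a'} \<subseteq> {..<0}" using assms by auto
  have w: "w a = \<alpha>" "w a' = - 1 / 2" using assms by (auto simp: w_def w1_def)
  have wc: "continuous_on {a..a'} w" unfolding w_def by (intro continuous_intros)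
  have W'c: "continuous_on {a..a'} W'"
    unfolding W'_def by (intro continuous_intros wc continuous_on_hcirc sub)
  have der: "((\<lambda>s. w s * hcirc s) has_real_derivative W' s) (at s within {a..a'})" if "s \<in> {a..a'}" for s
  proof -
    have "(w has_real_derivative w1) (at s within {a..a'})"
      unfolding w_def by (auto intro!: derivative_eq_intros)
    from DERIV_mult[OF this has_real_derivative_hcirc[of s]] show ?thesis
      using that assms by (simp add: W'_def algebra_simps)
  qed
  have hn: "hcirc s \<noteq> 0" if "s \<in> {a..a'}" for s using hcirc_pos[of s] that assms by force
  have "continuous_on {a..a'} (\<lambda>s. (W' s + (w s * hcirc s)\<^sup>2) / (hcirc s)\<^sup>2)"
    by (intro continuous_intros wc W'c continuous_on_hcirc sub) (auto simp: hn)
  then have "bounded ((\<lambda>s. (W' s + (w s * hcirc s)\<^sup>2) / (hcirc s)\<^sup>2) ` {a..a'})"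
    by (intro compact_imp_bounded compact_continuous_image) auto
  then obtain C0 where "\<forall>y\<in>(\<lambda>s. (W' s + (w s * hcirc s)\<^sup>2) / (hcirc s)\<^sup>2) ` {a..a'}. norm y \<le> C0"
    unfolding bounded_iff by blast
  then have C0: "\<bar>(W' s + (w s * hcirc s)\<^sup>2) / (hcirc s)\<^sup>2\<bar> \<le> C0" if "s \<in> {a..a'}" for s
    using that by (simp only: real_norm_def) blast
  define C where "C = max C0 0"
  have C: "W' s + (w s * hcirc s)\<^sup>2 \<le> - (- C) * (hcirc s)\<^sup>2" if "s \<in> {a..a'}" for s
  proof -
    have "(W' s + (w s * hcirc s)\<^sup>2) / (hcirc s)\<^sup>2 \<le> C"
      using order_trans[OF abs_ge_self C0[OF that]] unfolding C_def by (simp add: le_max_iff_disj)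
    then show ?thesis using hn[OF that] by (simp add: pos_divide_le_eq)
  qed
  show ?thesis
  proof (rule that[of C])
    show "0 \<le> C" by (simp add: C_def)
    fix b N P K and e :: real
    assume prof: "radial_profile b N P K" and e: "a' \<le> e" "b \<le> e" "e < 0"
    have "{a..e} \<subseteq> {..<0}" using e by auto
    then have Kint: "K integrable_on {a..e}" by (intro integrable_continuous_real radial_profileD(4)[OF prof])
    have "integral {a..a'} K + integral {a'..e} K = integral {a..e} K"
      using assms e Kint by (intro Henstock_Kurzweil_Integration.integral_combine) auto
    then show "integral {a'..e} (mass_density N) / 4 - C * integral {a..a'} (mass_density N)
         \<le> integral {a..e} K + \<alpha> * hcirc a * N a"
      using barta[OF prof less_imp_le[OF assms(1)] assms(2) der W'c C] tail_bound[OF prof e] by (simp add: w)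
  qed
qed

lemma mass_density_split:
  assumes prof: "radial_profile b N P K" and "a \<le> a'" "a' \<le> e" "e < 0"
  shows "integral {a..a'} (mass_density N) + integral {a'..e} (mass_density N) = integral {a..e} (mass_density N)"
    "0 \<le> integral {a..a'} (mass_density N)" "0 \<le> integral {a'..e} (mass_density N)"
proof -
  have i: "mass_density N integrable_on {x..y}" if "y < 0" for x y
    unfolding mass_density_def[abs_def] using that
    by (intro integrable_continuous_real continuous_intros radial_profileD(5)[OF prof] continuous_on_hcirc) auto
  then show "integral {a..a'} (mass_density N) + integral {a'..e} (mass_density N) = integral {a..e} (mass_density N)"
    using assms by (intro Henstock_Kurzweil_Integration.integral_combine) auto
  show "0 \<le> integral {a..a'} (mass_density N)" "0 \<le> integral {a'..e} (mass_density N)"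
    using assms by (auto intro!: Henstock_Kurzweil_Integration.integral_nonneg i simp: mass_density_def radial_profileD(6)[OF prof])
qed

lemma semibounded:
  assumes "a < 0"
  obtains C where "0 \<le> C" and
    "\<And>b N P K e. radial_profile b N P K \<Longrightarrow> a / 2 \<le> e \<Longrightarrow> b \<le> e \<Longrightarrow> e < 0 \<Longrightarrow>
       - C * integral {a..e} (mass_density N) \<le> integral {a..e} K + \<alpha> * hcirc a * N a"
proof -
  have a2: "a < a / 2" "a / 2 < 0" using assms by auto
  obtain C where C: "0 \<le> C" "\<And>b N P K e. radial_profile b N P K \<Longrightarrow> a / 2 \<le> e \<Longrightarrow> b \<le> e \<Longrightarrow> e < 0 \<Longrightarrow>
       integral {a / 2..e} (mass_density N) / 4 - C * integral {a..a / 2} (mass_density N)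
         \<le> integral {a..e} K + \<alpha> * hcirc a * N a"
    using boundary_layer_bound[OF a2, of \<alpha>] by blast
  show ?thesis
  proof (rule that[OF C(1)])
    fix b N P K and e :: real
    assume prof: "radial_profile b N P K" and e: "a / 2 \<le> e" "b \<le> e" "e < 0"
    note m = mass_density_split[OF prof less_imp_le[OF a2(1)] e(1,3)]
    have "0 \<le> C * integral {a / 2..e} (mass_density N)" using C(1) m by simp
    then have "- C * integral {a..e} (mass_density N) \<le> - C * integral {a..a / 2} (mass_density N)"
      unfolding m(1)[symmetric] by (simp add: algebra_simps)
    also have "\<dots> \<le> integral {a..e} K + \<alpha> * hcirc a * N a" using C(2)[OF prof e] m(3) by simp
    finally show "- C * integral {a..e} (mass_density N) \<le> integral {a..e} K + \<alpha> * hcirc a * N a" .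
  qed
qed

text \<open>Two bounds for the energy outside \<open>a\<close> are combined. With the constant \<open>w = \<alpha>\<close> on the layer and the
assumed bound outside \<open>a'\<close>, the energy exceeds \<open>L\<close> times the mass by \<open>\<delta>\<close> times the mass of the layer.
The bound \<open>boundary_layer_bound\<close> gains \<open>1 / 4 - L\<close> on the mass outside \<open>a'\<close> and loses on the layer. A small
portion \<open>t\<close> of the second keeps a gain everywhere.\<close>

lemma enlarging_gains:
  assumes a: "a < a'" "a' < 0" and \<alpha>: "\<alpha> \<le> 0" and L: "L < 1 / 4" "L < - \<alpha>\<^sup>2 - \<alpha> * cosh a'"
  obtains \<tau> where "0 < \<tau>" and
    "\<And>b N P K e. radial_profile b N P K \<Longrightarrow> a' \<le> e \<Longrightarrow> b \<le> e \<Longrightarrow> e < 0 \<Longrightarrow>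
       L * integral {a'..e} (mass_density N) \<le> integral {a'..e} K + \<alpha> * hcirc a' * N a' \<Longrightarrow>
       (L + \<tau>) * integral {a..e} (mass_density N) \<le> integral {a..e} K + \<alpha> * hcirc a * N a"
proof -
  define \<delta> where "\<delta> = - \<alpha>\<^sup>2 - \<alpha> * cosh a' - L"
  have \<delta>: "0 < \<delta>" using L by (simp add: \<delta>_def)
  obtain C where C: "0 \<le> C" "\<And>b N P K e. radial_profile b N P K \<Longrightarrow> a' \<le> e \<Longrightarrow> b \<le> e \<Longrightarrow> e < 0 \<Longrightarrow>
       integral {a'..e} (mass_density N) / 4 - C * integral {a..a'} (mass_density N)
         \<le> integral {a..e} K + \<alpha> * hcirc a * N a"
    using boundary_layer_bound[OF a, of \<alpha>] by blast
  \<comment> \<open>The portion of the second bound is so small that its loss on the layer is at most half of \<open>\<delta>\<close>.\<close>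
  define t where "t = min (1 / 2) (\<delta> / (2 * (C + 1)))"
  have "0 < t" using \<delta> C(1) by (simp add: t_def)
  moreover have "t \<le> 1 / 2" unfolding t_def by (rule min.cobounded1)
  ultimately have t: "0 < t" "t \<le> 1 / 2" by auto
  have "t * (C + 1) \<le> \<delta> / (2 * (C + 1)) * (C + 1)" using C(1) by (intro mult_right_mono) (auto simp: t_def)
  moreover have "\<delta> / (2 * c) * c = \<delta> / 2" if "0 < c" for c :: real using that by simp
  ultimately have tC: "t * (C + 1) \<le> \<delta> / 2" using C(1) by (metis add_nonneg_pos zero_less_one)
  show ?thesis
  proof (rule that[of "t * (1 / 4 - L)"])
    show "0 < t * (1 / 4 - L)" using t L by simp
    fix b N P K and e :: real
    assume prof: "radial_profile b N P K" and e: "a' \<le> e" "b \<le> e" "e < 0"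
      and outer: "L * integral {a'..e} (mass_density N) \<le> integral {a'..e} K + \<alpha> * hcirc a' * N a'"
    define m1 where "m1 = integral {a..a'} (mass_density N)"
    define m2 where "m2 = integral {a'..e} (mass_density N)"
    define E where "E = integral {a..e} K + \<alpha> * hcirc a * N a"
    have m: "m1 + m2 = integral {a..e} (mass_density N)" "0 \<le> m1" "0 \<le> m2"
      using mass_density_split[OF prof less_imp_le[OF a(1)] e(1,3)] by (auto simp: m1_def m2_def)
    have "{a..e} \<subseteq> {..<0}" using e by auto
    then have Kint: "K integrable_on {a..e}" by (intro integrable_continuous_real radial_profileD(4)[OF prof])
    have "integral {a..a'} K + integral {a'..e} K = integral {a..e} K"
      using a e Kint by (intro Henstock_Kurzweil_Integration.integral_combine) auto
    moreover have "\<alpha> * hcirc a' * N a' - \<alpha> * hcirc a * N a + (L + \<delta>) * m1 \<le> integral {a..a'} K"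
      unfolding m1_def by (rule barta_const[OF prof less_imp_le[OF a(1)] a(2) \<alpha>]) (simp add: \<delta>_def)
    ultimately have EA: "L * (m1 + m2) + \<delta> * m1 \<le> E"
      using outer by (simp add: E_def m2_def algebra_simps)
    have EB: "m2 / 4 - C * m1 \<le> E" using C(2)[OF prof e] by (simp add: E_def m1_def m2_def)
    have "(1 - t) * (L * (m1 + m2) + \<delta> * m1) + t * (m2 / 4 - C * m1) \<le> (1 - t) * E + t * E"
      using t EA EB by (intro add_mono mult_left_mono) auto
    then have "L * (m1 + m2) + t * (1 / 4 - L) * m2 + ((1 - t) * \<delta> - t * L - t * C) * m1 \<le> E"
      by (simp add: algebra_simps)
    moreover have "t * (1 / 4 - L) * m1 \<le> ((1 - t) * \<delta> - t * L - t * C) * m1"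
    proof (rule mult_right_mono[OF _ m(2)])
      have "(1 - t) * \<delta> \<ge> 1 / 2 * \<delta>" using t \<delta> by (intro mult_right_mono) auto
      moreover have "t * C + t * (1 / 4) \<le> t * (C + 1)" using t by (simp add: algebra_simps)
      ultimately show "t * (1 / 4 - L) \<le> (1 - t) * \<delta> - t * L - t * C" using tC by (simp add: algebra_simps)
    qed
    moreover have "(L + t * (1 / 4 - L)) * (m1 + m2) = L * (m1 + m2) + t * (1 / 4 - L) * m2 + t * (1 / 4 - L) * m1"
      by (simp add: algebra_simps)
    ultimately have "(L + t * (1 / 4 - L)) * (m1 + m2) \<le> E" by linarith
    then show "(L + t * (1 / 4 - L)) * integral {a..e} (mass_density N) \<le> integral {a..e} K + \<alpha> * hcirc a * N a"
      by (simp add: m E_def)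
  qed
qed

section \<open>Angular averages of a test function\<close>

definition circle_mean :: "(complex \<Rightarrow> complex) \<Rightarrow> real \<Rightarrow> real" where
  "circle_mean \<phi> s = integral {0..2 * pi} (\<lambda>\<theta>. (cmod (\<phi> (logpolar s \<theta>)))\<^sup>2)"

definition circle_energy :: "(complex \<Rightarrow> complex) \<Rightarrow> real \<Rightarrow> real" where
  "circle_energy \<phi> s = integral {0..2 * pi} (\<lambda>\<theta>. exp (2 * s) * gradsq \<phi> (logpolar s \<theta>))"

text \<open>The derivative of \<open>\<phi>\<close> along the field \<open>z\<close>, which is the derivative with respect to \<open>s\<close> in the
coordinates \<open>logpolar\<close>.\<close>

definition log_gradient :: "(complex \<Rightarrow> complex) \<Rightarrow> complex \<Rightarrow> complex" where
  "log_gradient \<phi> z = Re z *\<^sub>R partial 1 \<phi> z + Im z *\<^sub>R partial \<i> \<phi> z"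

definition circle_slope :: "(complex \<Rightarrow> complex) \<Rightarrow> real \<Rightarrow> real" where
  "circle_slope \<phi> s = integral {0..2 * pi} (\<lambda>\<theta>. 2 * (\<phi> (logpolar s \<theta>) \<bullet> log_gradient \<phi> (logpolar s \<theta>)))"

lemma continuous_on_circle_integral:
  fixes g :: "complex \<Rightarrow> real"
  assumes "continuous_on V g" "\<And>s \<theta>. s \<in> A \<Longrightarrow> logpolar s \<theta> \<in> V"
  shows "continuous_on A (\<lambda>s. integral {0..2 * pi} (\<lambda>\<theta>. g (logpolar s \<theta>)))"
proof -
  have "continuous_on (A \<times> cbox 0 (2 * pi)) (\<lambda>(s, \<theta>). g (logpolar s \<theta>))"
    unfolding case_prod_unfold
    by (rule continuous_on_compose2[OF assms(1)]) (use assms(2) in \<open>auto intro!: continuous_intros\<close>)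
  from integral_continuous_on_param[OF this] show ?thesis by simp
qed

lemma has_vector_derivative_logpolar:
  assumes "\<phi> differentiable (at (logpolar s \<theta>))"
  shows "((\<lambda>s. \<phi> (logpolar s \<theta>)) has_vector_derivative log_gradient \<phi> (logpolar s \<theta>)) (at s within S)"
proof -
  have "((\<lambda>s. exp (of_real s + \<i> * of_real \<theta>)) has_vector_derivative exp (of_real s + \<i> * of_real \<theta>)) (at s within S)"
    by (auto intro!: derivative_eq_intros has_vector_derivative_real_field)
  then have "((\<lambda>s. logpolar s \<theta>) has_derivative (\<lambda>h. h *\<^sub>R logpolar s \<theta>)) (at s within S)"
    by (simp add: logpolar_def Complex_eq has_vector_derivative_def)
  from has_derivative_compose[OF this has_derivative_partial[OF assms]]
  have "((\<lambda>s. \<phi> (logpolar s \<theta>)) has_derivative (\<lambda>h. Re (h *\<^sub>R logpolar s \<theta>) *\<^sub>R partial 1 \<phi> (logpolar s \<theta>) +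
      Im (h *\<^sub>R logpolar s \<theta>) *\<^sub>R partial \<i> \<phi> (logpolar s \<theta>))) (at s within S)" .
  then show ?thesis
    unfolding has_vector_derivative_def log_gradient_def
    by (rule has_derivative_eq_rhs) (simp add: fun_eq_iff scaleR_add_right)
qed

lemma norm_log_gradient_le: "(cmod (log_gradient \<phi> z))\<^sup>2 \<le> (cmod z)\<^sup>2 * gradsq \<phi> z"
proof -
  let ?p = "cmod (partial 1 \<phi> z)" and ?q = "cmod (partial \<i> \<phi> z)"
  have "cmod (log_gradient \<phi> z) \<le> \<bar>Re z\<bar> * ?p + \<bar>Im z\<bar> * ?q"
    unfolding log_gradient_def by (rule norm_triangle_le) simp
  then have "(cmod (log_gradient \<phi> z))\<^sup>2 \<le> (\<bar>Re z\<bar> * ?p + \<bar>Im z\<bar> * ?q)\<^sup>2" by (intro power_mono) auto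
  also have "\<dots> \<le> (\<bar>Re z\<bar>\<^sup>2 + \<bar>Im z\<bar>\<^sup>2) * (?p\<^sup>2 + ?q\<^sup>2)"
  proof -
    have "(x * p + y * q)\<^sup>2 \<le> (x\<^sup>2 + y\<^sup>2) * (p\<^sup>2 + q\<^sup>2)" for x y p q :: real
    proof -
      have "0 \<le> (x * q - y * p)\<^sup>2" by simp
      then show ?thesis by (simp only: power2_eq_square) (simp add: algebra_simps)
    qed
    then show ?thesis .
  qed
  finally show ?thesis by (simp add: gradsq_def cmod_power2)
qed

text \<open>Differentiation under the integral gives the derivative of the mean; the inequality for every \<open>w\<close> is the
average of \<open>0 \<le> \<bar>log_gradient \<phi> - w \<phi>\<bar>\<^sup>2\<close>.\<close>

lemma radial_profile_test:
  assumes \<phi>: "\<phi> \<in> test_functions V" and b: "b < 0" and supp: "\<And>z. exp b \<le> cmod z \<Longrightarrow> \<phi> z = 0"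
  shows "radial_profile b (circle_mean \<phi>) (circle_slope \<phi>) (circle_energy \<phi>)"
  unfolding radial_profile_def
proof (intro conjI allI impI)
  note c\<phi> = test_function_continuous_on[OF \<phi>] and cp = test_function_continuous_partial[OF \<phi>]
  have cg: "continuous_on A (log_gradient \<phi>)" for A
    unfolding log_gradient_def[abs_def] by (intro continuous_intros cp)
  have cs: "continuous_on A (\<lambda>z. 2 * (\<phi> z \<bullet> log_gradient \<phi> z))" for A by (intro continuous_intros c\<phi> cg)
  show "continuous_on {..<0} (circle_slope \<phi>)"
    unfolding circle_slope_def by (rule continuous_on_circle_integral[OF cs[of UNIV]]) simp
  have "continuous_on {..<0} (\<lambda>s. exp (2 * s) * integral {0..2 * pi} (\<lambda>\<theta>. gradsq \<phi> (logpolar s \<theta>)))"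
    by (intro continuous_intros continuous_on_circle_integral[OF continuous_on_gradsq[OF \<phi>, of UNIV]]) simp
  then show "continuous_on {..<0} (circle_energy \<phi>)" unfolding circle_energy_def by simp
  fix s :: real assume s: "s < 0"
  have cl: "continuous_on {0..2 * pi} (\<lambda>\<theta>. g (logpolar s \<theta>))" if "continuous_on UNIV g" for g :: "complex \<Rightarrow> real" and s
    by (rule continuous_on_compose2[OF that]) (auto intro!: continuous_intros)
  have cl': "continuous_on {0..2 * pi} (\<lambda>\<theta>. (cmod (\<phi> (logpolar s \<theta>)))\<^sup>2)" for s
    by (rule cl) (intro continuous_intros c\<phi>)
  show "0 \<le> circle_mean \<phi> s"
    unfolding circle_mean_def by (intro Henstock_Kurzweil_Integration.integral_nonneg integrable_continuous_real cl') simp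
  have "((\<lambda>s. integral (cbox 0 (2 * pi)) (\<lambda>\<theta>. (cmod (\<phi> (logpolar s \<theta>)))\<^sup>2)) has_field_derivative
      integral (cbox 0 (2 * pi)) (\<lambda>\<theta>. 2 * (\<phi> (logpolar s \<theta>) \<bullet> log_gradient \<phi> (logpolar s \<theta>)))) (at s within {..<0})"
  proof (rule leibniz_rule_field_derivative)
    fix s \<theta> :: real
    let ?d = "log_gradient \<phi> (logpolar s \<theta>)"
    have d: "((\<lambda>s. \<phi> (logpolar s \<theta>)) has_derivative (\<lambda>h. h *\<^sub>R ?d)) (at s within {..<0})"
      using has_vector_derivative_logpolar[OF test_function_differentiable[OF \<phi>]] by (simp add: has_vector_derivative_def)
    from has_derivative_inner[OF d d]
    show "((\<lambda>s. (cmod (\<phi> (logpolar s \<theta>)))\<^sup>2) has_field_derivative 2 * (\<phi> (logpolar s \<theta>) \<bullet> ?d)) (at s within {..<0})"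
      unfolding has_field_derivative_def power2_norm_eq_inner
      by (rule has_derivative_eq_rhs) (simp add: fun_eq_iff inner_commute)
  next
    show "(\<lambda>\<theta>. (cmod (\<phi> (logpolar s \<theta>)))\<^sup>2) integrable_on cbox 0 (2 * pi)" for s
      using integrable_continuous_real[OF cl'] by simp
    show "continuous_on ({..<0} \<times> cbox 0 (2 * pi)) (\<lambda>(s, \<theta>). 2 * (\<phi> (logpolar s \<theta>) \<bullet> log_gradient \<phi> (logpolar s \<theta>)))"
      unfolding case_prod_unfold
      by (rule continuous_on_compose2[OF cs[of UNIV]]) (auto intro!: continuous_intros)
  qed (use s in auto)
  then show "(circle_mean \<phi> has_real_derivative circle_slope \<phi> s) (at s)"
    using s by (simp add: circle_mean_def[abs_def] circle_slope_def at_within_open[of s "{..<0}"])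
  fix w :: real
  have "w * circle_slope \<phi> s = integral {0..2 * pi} (\<lambda>\<theta>. w * (2 * (\<phi> (logpolar s \<theta>) \<bullet> log_gradient \<phi> (logpolar s \<theta>))))"
    unfolding circle_slope_def by simp
  also have "\<dots> \<le> integral {0..2 * pi} (\<lambda>\<theta>. exp (2 * s) * gradsq \<phi> (logpolar s \<theta>) + w\<^sup>2 * (cmod (\<phi> (logpolar s \<theta>)))\<^sup>2)"
  proof (rule integral_le)
    show "(\<lambda>\<theta>. w * (2 * (\<phi> (logpolar s \<theta>) \<bullet> log_gradient \<phi> (logpolar s \<theta>)))) integrable_on {0..2 * pi}"
      by (intro integrable_continuous_real continuous_on_mult_left cl cs)
    show "(\<lambda>\<theta>. exp (2 * s) * gradsq \<phi> (logpolar s \<theta>) + w\<^sup>2 * (cmod (\<phi> (logpolar s \<theta>)))\<^sup>2) integrable_on {0..2 * pi}"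
      by (intro integrable_continuous_real continuous_on_add continuous_on_mult_left cl cl' continuous_on_gradsq[OF \<phi>])
    fix \<theta>
    let ?f = "\<phi> (logpolar s \<theta>)" and ?d = "log_gradient \<phi> (logpolar s \<theta>)"
    have "(norm (?d - w *\<^sub>R ?f))\<^sup>2 = (norm ?d)\<^sup>2 - 2 * w * (?f \<bullet> ?d) + w\<^sup>2 * (norm ?f)\<^sup>2"
      by (simp only: power2_norm_eq_inner inner_diff_left inner_diff_right inner_scaleR_left inner_scaleR_right)
         (simp add: inner_commute algebra_simps power2_eq_square)
    moreover have "0 \<le> (norm (?d - w *\<^sub>R ?f))\<^sup>2" by simp
    ultimately have "2 * w * (?f \<bullet> ?d) \<le> (norm ?d)\<^sup>2 + w\<^sup>2 * (norm ?f)\<^sup>2" by linarith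
    moreover have "(norm ?d)\<^sup>2 \<le> exp (2 * s) * gradsq \<phi> (logpolar s \<theta>)"
      using norm_log_gradient_le[of \<phi> "logpolar s \<theta>"] by (simp add: exp_double)
    ultimately show "w * (2 * (?f \<bullet> ?d)) \<le> exp (2 * s) * gradsq \<phi> (logpolar s \<theta>) + w\<^sup>2 * (cmod ?f)\<^sup>2"
      by simp
  qed
  also have "\<dots> = circle_energy \<phi> s + w\<^sup>2 * circle_mean \<phi> s"
    unfolding circle_energy_def circle_mean_def
    by (subst Henstock_Kurzweil_Integration.integral_add)
       (auto intro!: integrable_continuous_real continuous_on_mult_left cl continuous_on_gradsq[OF \<phi>]
          continuous_on_power continuous_on_norm c\<phi>)
  finally show "w * circle_slope \<phi> s \<le> circle_energy \<phi> s + w\<^sup>2 * circle_mean \<phi> s" .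
next
  show "b < 0" by (rule b)
  fix s assume "b \<le> s \<and> s < 0"
  then have "\<phi> (logpolar s \<theta>) = 0" for \<theta> by (intro supp) simp
  then show "circle_mean \<phi> s = 0" by (simp add: circle_mean_def)
qed

lemma polar_integral_hyp_area:
  fixes g :: "complex \<Rightarrow> real"
  assumes g: "continuous_on hplane g" "\<And>z. 0 \<le> g z" and b: "b < 0"
    and supp: "\<And>z. z \<in> hplane \<Longrightarrow> exp b \<le> cmod z \<Longrightarrow> g z = 0"
  shows "(LINT z:{z \<in> hplane. exp a < cmod z}|hyp_area. g z)
       = integral {a..b} (\<lambda>s. (hcirc s)\<^sup>2 * integral {0..2 * pi} (\<lambda>\<theta>. g (logpolar s \<theta>)))"
proof -
  let ?U = "{z \<in> hplane. exp a < cmod z}"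
  define \<Phi> where "\<Phi> s = (hcirc s)\<^sup>2 * integral {0..2 * pi} (\<lambda>\<theta>. g (logpolar s \<theta>))" for s
  have U: "?U \<in> sets borel" "?U \<subseteq> hplane"
  proof -
    have "?U = hplane \<inter> {z. exp a < cmod z}" by auto
    also have "\<dots> \<in> sets borel"
      by (intro sets.Int borel_open open_hplane open_Collect_less continuous_intros)
    finally show "?U \<in> sets borel" .
  qed auto
  define h where "h z = ennreal (indicator ?U z * (if z \<in> hplane then g z else 0))" for z
  have hm [measurable]: "h \<in> borel_measurable borel"
  proof -
    have "(\<lambda>z. if z \<in> hplane then g z else 0) \<in> borel_measurable borel"
      using g(1) by (intro borel_measurable_continuous_on_if) auto
    then show ?thesis unfolding h_def[abs_def] using U(1) by measurable
  qed
  have "(LINT z:?U|hyp_area. g z) = enn2real (\<integral>\<^sup>+z. ennreal (indicator ?U z *\<^sub>R g z) \<partial>hyp_area)"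
    unfolding set_lebesgue_integral_def
  proof (rule integral_eq_nn_integral)
    show "(\<lambda>z. indicator ?U z *\<^sub>R g z) \<in> borel_measurable hyp_area"
      using U by (intro borel_measurable_scaleR borel_measurable_indicator borel_measurable_hyp_area g)
        (auto simp: sets_hyp_area sets_restrict_space_iff)
  qed (simp add: g)
  also have "(\<integral>\<^sup>+z. ennreal (indicator ?U z *\<^sub>R g z) \<partial>hyp_area) = (\<integral>\<^sup>+z. h z \<partial>hyp_area)"
    by (intro nn_integral_cong) (simp add: h_def space_hyp_area)
  also have "\<dots> = (\<integral>\<^sup>+s. (\<integral>\<^sup>+\<theta>. ennreal ((hcirc s)\<^sup>2) * h (logpolar s \<theta>) * indicator {0<..<2 * pi} \<theta> \<partial>lborel) * indicator {..<0} s \<partial>lborel)"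
    by (rule polar_nn_integral_hyp_area[OF hm])
  also have "\<dots> = (\<integral>\<^sup>+s. ennreal (\<Phi> s) * indicator {a<..<b} s \<partial>lborel)"
  proof (rule nn_integral_cong)
    fix s :: real
    consider "a < s \<and> s < b" | "s \<le> a" | "b \<le> s" "s < 0" | "0 \<le> s" by linarith
    then show "(\<integral>\<^sup>+\<theta>. ennreal ((hcirc s)\<^sup>2) * h (logpolar s \<theta>) * indicator {0<..<2 * pi} \<theta> \<partial>lborel) * indicator {..<0} s
        = ennreal (\<Phi> s) * indicator {a<..<b} s"
    proof cases
      case 1
      then have s: "s < 0" using b by simp
      have "continuous_on {0..2 * pi} (\<lambda>\<theta>. (hcirc s)\<^sup>2 * g (logpolar s \<theta>))"
        using s by (intro continuous_on_mult_left continuous_on_compose2[OF g(1)])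
          (auto intro!: continuous_intros logpolar_in_hplane)
      then have "((\<lambda>\<theta>. (hcirc s)\<^sup>2 * g (logpolar s \<theta>)) has_integral integral {0..2 * pi} (\<lambda>\<theta>. (hcirc s)\<^sup>2 * g (logpolar s \<theta>))) {0..2 * pi}"
        by (intro integrable_integral integrable_continuous_real)
      then have "((\<lambda>\<theta>. (hcirc s)\<^sup>2 * g (logpolar s \<theta>)) has_integral \<Phi> s) {0<..<2 * pi}"
        by (simp add: has_integral_Icc_iff_Ioo \<Phi>_def)
      then have "(\<integral>\<^sup>+\<theta>. ennreal ((hcirc s)\<^sup>2 * g (logpolar s \<theta>)) * indicator {0<..<2 * pi} \<theta> \<partial>lborel) = ennreal (\<Phi> s)"
        by (intro nn_integral_has_integral_lebesgue') (simp add: g)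
      moreover have "ennreal ((hcirc s)\<^sup>2) * h (logpolar s \<theta>) = ennreal ((hcirc s)\<^sup>2 * g (logpolar s \<theta>))" for \<theta>
        using 1 s by (simp add: h_def logpolar_in_hplane ennreal_mult g)
      ultimately show ?thesis using 1 s by simp
    next
      case 2
      then have "h (logpolar s \<theta>) = 0" for \<theta> by (simp add: h_def)
      then show ?thesis using 2 by simp
    next
      case 3
      then have "h (logpolar s \<theta>) = 0" for \<theta> using supp[of "logpolar s \<theta>"] by (simp add: h_def)
      then show ?thesis using 3 by simp
    qed (use b in simp)
  qed
  also have "\<dots> = ennreal (integral {a..b} \<Phi>)"
  proof (rule nn_integral_has_integral_lebesgue')
    have "continuous_on {a..b} \<Phi>"
      unfolding \<Phi>_def[abs_def] using b
      by (intro continuous_intros continuous_on_hcirc continuous_on_circle_integral[OF g(1)]) (auto intro!: logpolar_in_hplane)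
    then show "(\<Phi> has_integral integral {a..b} \<Phi>) {a<..<b}"
      by (simp add: has_integral_Icc_iff_Ioo[symmetric] integrable_integral integrable_continuous_real)
    have cont: "continuous_on {0..2 * pi} (\<lambda>\<theta>. g (logpolar s \<theta>))" if "s < 0" for s
      using that by (intro continuous_on_compose2[OF g(1)]) (auto intro!: continuous_intros logpolar_in_hplane)
    show "0 \<le> \<Phi> s" if "s \<in> {a<..<b}" for s
      unfolding \<Phi>_def using that b
      by (intro mult_nonneg_nonneg Henstock_Kurzweil_Integration.integral_nonneg integrable_continuous_real cont) (auto simp: g)
  qed
  finally show ?thesis
  proof -
    assume *: "(LINT z:?U|hyp_area. g z) = enn2real (ennreal (integral {a..b} \<Phi>))"
    have cont: "continuous_on {0..2 * pi} (\<lambda>\<theta>. g (logpolar s \<theta>))" if "s < 0" for s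
      using that by (intro continuous_on_compose2[OF g(1)]) (auto intro!: continuous_intros logpolar_in_hplane)
    have "continuous_on {a..b} \<Phi>"
      unfolding \<Phi>_def[abs_def] using b
      by (intro continuous_intros continuous_on_hcirc continuous_on_circle_integral[OF g(1)]) (auto intro!: logpolar_in_hplane)
    then have "0 \<le> integral {a..b} \<Phi>"
      unfolding \<Phi>_def using b
      by (intro Henstock_Kurzweil_Integration.integral_nonneg integrable_continuous_real)
         (auto intro!: mult_nonneg_nonneg Henstock_Kurzweil_Integration.integral_nonneg integrable_continuous_real cont simp: g)
    then show ?thesis using * by (simp add: \<Phi>_def[abs_def])
  qed
qed

text \<open>The three integrals of the Rayleigh quotient become one-dimensional. Any \<open>e\<close> beyond the support may serve as
the upper end, so the same \<open>e\<close> can be used for two different disks.\<close>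

lemma forms_radial:
  assumes R: "0 < R" and a: "exp a = tanh (R / 2)" and \<phi>: "\<phi> \<in> test_functions hplane"
    and e: "e < 0" and supp: "\<And>z. exp e \<le> cmod z \<Longrightarrow> \<phi> z = 0" "\<And>z c. exp e \<le> cmod z \<Longrightarrow> partial c \<phi> z = 0"
  shows "dirichlet (exterior (geodesic_disk 0 R)) \<phi> = integral {a..e} (circle_energy \<phi>)"
    "mass (exterior (geodesic_disk 0 R)) \<phi> = integral {a..e} (mass_density (circle_mean \<phi>))"
    "bmass (exterior (geodesic_disk 0 R)) \<phi> = hcirc a * circle_mean \<phi> a"
proof -
  have 0: "0 \<in> hplane" by (simp add: hplane_iff)
  have m0: "moeb 0 = id" by (simp add: moeb_def fun_eq_iff)
  have U: "exterior (geodesic_disk 0 R) = {z \<in> hplane. exp a < cmod z}"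
    by (simp add: exterior_geodesic_disk[OF 0 R] m0 a)
  have B: "hboundary (exterior (geodesic_disk 0 R)) = sphere 0 (exp a)"
    by (simp add: hboundary_exterior[OF 0 R] m0 a)
  have a0: "a < 0" using tanh_half_bounds[OF R] a by (metis exp_less_one_iff)
  show "mass (exterior (geodesic_disk 0 R)) \<phi> = integral {a..e} (mass_density (circle_mean \<phi>))"
    unfolding mass_def U mass_density_def[abs_def] circle_mean_def
    by (rule polar_integral_hyp_area) (auto intro!: continuous_intros test_function_continuous_on[OF \<phi>] simp: e supp)
  have "dirichlet (exterior (geodesic_disk 0 R)) \<phi>
      = integral {a..e} (\<lambda>s. (hcirc s)\<^sup>2 * integral {0..2 * pi} (\<lambda>\<theta>. (norm (hframe (grad \<phi>) (logpolar s \<theta>)))\<^sup>2))"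
    unfolding dirichlet_def U
  proof (rule polar_integral_hyp_area[OF _ _ e])
    show "continuous_on hplane (\<lambda>z. (norm (hframe (grad \<phi>) z))\<^sup>2)"
      by (intro continuous_intros continuous_on_hframe_grad[OF \<phi>])
  qed (auto simp: norm_hframe_grad gradsq_def supp)
  also have "\<dots> = integral {a..e} (circle_energy \<phi>)"
  proof (rule Henstock_Kurzweil_Integration.integral_cong)
    fix s assume "s \<in> {a..e}"
    then have s: "s < 0" using e by simp
    have "(hcirc s)\<^sup>2 * (norm (hframe (grad \<phi>) (logpolar s \<theta>)))\<^sup>2 = exp (2 * s) * gradsq \<phi> (logpolar s \<theta>)" for \<theta>
      unfolding norm_hframe_grad conf_logpolar[OF s, of \<theta>, symmetric]
      using conf_nonzero[OF logpolar_in_hplane[OF s]] by (simp add: power_mult_distrib exp_double)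
    then show "(hcirc s)\<^sup>2 * integral {0..2 * pi} (\<lambda>\<theta>. (norm (hframe (grad \<phi>) (logpolar s \<theta>)))\<^sup>2) = circle_energy \<phi> s"
      unfolding circle_energy_def by (simp flip: Henstock_Kurzweil_Integration.integral_mult_right)
  qed
  finally show "dirichlet (exterior (geodesic_disk 0 R)) \<phi> = integral {a..e} (circle_energy \<phi>)" .
  have cm: "continuous_on {0..2 * pi} (\<lambda>\<theta>. (cmod (\<phi> (logpolar a \<theta>)))\<^sup>2)"
    by (intro continuous_intros continuous_on_compose2[OF test_function_continuous_on[OF \<phi>, of UNIV]]) auto
  have m\<phi>: "(\<lambda>z. (cmod (\<phi> z))\<^sup>2) \<in> borel_measurable borel"
    by (intro borel_measurable_continuous_onI continuous_intros test_function_continuous_on[OF \<phi>])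
  have S: "sphere 0 (exp a) \<in> sets hyp_hausdorff" using hboundary_disk_measurable(1)[OF 0 R] by (simp add: B)
  have "bmass (exterior (geodesic_disk 0 R)) \<phi> = enn2real (\<integral>\<^sup>+z. ennreal (indicator (sphere 0 (exp a)) z *\<^sub>R (cmod (\<phi> z))\<^sup>2) \<partial>hyp_hausdorff)"
    unfolding bmass_def set_lebesgue_integral_def B
  proof (rule integral_eq_nn_integral)
    have "(\<lambda>z. (cmod (\<phi> z))\<^sup>2) \<in> borel_measurable hyp_hausdorff"
      by (subst measurable_cong_sets[OF sets_hyp_hausdorff refl]) (rule measurable_restrict_space1[OF m\<phi>])
    then show "(\<lambda>z. indicator (sphere 0 (exp a)) z *\<^sub>R (cmod (\<phi> z))\<^sup>2) \<in> borel_measurable hyp_hausdorff"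
      by (intro borel_measurable_scaleR borel_measurable_indicator S)
  qed simp
  also have "(\<integral>\<^sup>+z. ennreal (indicator (sphere 0 (exp a)) z *\<^sub>R (cmod (\<phi> z))\<^sup>2) \<partial>hyp_hausdorff)
      = (\<integral>\<^sup>+z. ennreal ((cmod (\<phi> z))\<^sup>2) * indicator (sphere 0 (exp a)) z \<partial>hyp_hausdorff)"
    by (intro nn_integral_cong) (simp split: split_indicator)
  also have "\<dots> = (\<integral>\<^sup>+\<theta>. ennreal (hcirc a) * ennreal ((cmod (\<phi> (logpolar a \<theta>)))\<^sup>2) * indicator {0..<2 * pi} \<theta> \<partial>lborel)"
    by (rule nn_integral_hyp_hausdorff_circle[OF a0]) (use m\<phi> in measurable)
  also have "\<dots> = (\<integral>\<^sup>+\<theta>. ennreal (hcirc a * (cmod (\<phi> (logpolar a \<theta>)))\<^sup>2) * indicator {0..<2 * pi} \<theta> \<partial>lborel)"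
    using hcirc_pos[OF a0] by (simp add: ennreal_mult)
  also have "\<dots> = ennreal (hcirc a * circle_mean \<phi> a)"
  proof (rule nn_integral_has_integral_lebesgue')
    have "((\<lambda>\<theta>. hcirc a * (cmod (\<phi> (logpolar a \<theta>)))\<^sup>2) has_integral hcirc a * circle_mean \<phi> a) {0..2 * pi}"
      unfolding circle_mean_def by (intro has_integral_mult_right integrable_integral integrable_continuous_real cm)
    then show "((\<lambda>\<theta>. hcirc a * (cmod (\<phi> (logpolar a \<theta>)))\<^sup>2) has_integral hcirc a * circle_mean \<phi> a) {0..<2 * pi}"
      by (rule has_integral_spike_set_eq[THEN iffD1, rotated 2])
         (auto intro!: negligible_subset[OF negligible_sing[of "2 * pi"]])
  qed (use hcirc_pos[OF a0] in simp)
  finally show "bmass (exterior (geodesic_disk 0 R)) \<phi> = hcirc a * circle_mean \<phi> a"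
  proof -
    assume *: "bmass (exterior (geodesic_disk 0 R)) \<phi> = enn2real (ennreal (hcirc a * circle_mean \<phi> a))"
    have "0 \<le> circle_mean \<phi> a"
      unfolding circle_mean_def by (intro Henstock_Kurzweil_Integration.integral_nonneg integrable_continuous_real cm) simp
    then show ?thesis using * hcirc_pos[OF a0] by simp
  qed
qed

section \<open>A trial function\<close>

definition smooth_step :: "real \<Rightarrow> real" where
  "smooth_step x = flat 0 x / (flat 0 x + flat 0 (1 - x))"

lemma continuous_on_flat: "continuous_on A (flat n)"
  using has_field_derivative_at_within[OF has_real_derivative_flat] by (rule DERIV_continuous_on)

lemma flat_nonneg: "0 \<le> flat n x" by (simp add: flat_def)

lemma flat_pos: "0 < x \<Longrightarrow> 0 < flat n x" by (simp add: flat_def)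

lemma flat_eq_0: "x \<le> 0 \<Longrightarrow> flat n x = 0" by (simp add: flat_def)

lemma flat_sum_pos: "0 < flat 0 x + flat 0 (1 - x)"
proof (cases "0 < x")
  case True
  then show ?thesis using flat_pos[of x 0] flat_nonneg[of 0 "1 - x"] by linarith
next
  case False
  then show ?thesis using flat_pos[of "1 - x" 0] flat_nonneg[of 0 x] by linarith
qed

lemma smooth_step_eq_0: "x \<le> 0 \<Longrightarrow> smooth_step x = 0"
  by (simp add: smooth_step_def flat_eq_0)

lemma smooth_step_eq_1: "1 \<le> x \<Longrightarrow> smooth_step x = 1"
  using flat_pos[of x 0] by (simp add: smooth_step_def flat_eq_0)

text \<open>With \<open>t = 1 / (2 x)\<close> the claim is \<open>(2 t)\<^sup>2 \<le> (exp t)\<^sup>2\<close>, and \<open>2 t \<le> exp 1 * exp (t - 1)\<close>.\<close>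

lemma flat_2_le_1: "flat 2 x \<le> 1"
proof (cases "0 < x")
  case True
  define t where "t = 1 / (2 * x)"
  have t: "0 < t" using True by (simp add: t_def)
  have "2 \<le> exp (1::real)" using exp_ge_add_one_self[of 1] by simp
  moreover have "t \<le> exp (t - 1)" using exp_ge_add_one_self[of "t - 1"] by simp
  ultimately have "2 * t \<le> exp 1 * exp (t - 1)" using t by (intro mult_mono) auto
  then have "2 * t \<le> exp t" by (simp add: exp_add[symmetric])
  then have "(2 * t)\<^sup>2 \<le> (exp t)\<^sup>2" using t by (intro power_mono) auto
  then have "(1 / x)\<^sup>2 \<le> exp (1 / x)" using True by (simp add: t_def exp_double[symmetric])
  then have "exp (- 1 / x) * (1 / x)\<^sup>2 \<le> exp (- 1 / x) * exp (1 / x)" by (intro mult_left_mono) auto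
  also have "\<dots> = 1" by (simp add: exp_add[symmetric])
  finally show ?thesis using True by (simp add: flat_def power_divide)
qed (simp add: flat_def)

text \<open>The hyperbolic distance from the origin to a point of Euclidean norm \<open>exp s\<close>.\<close>

definition hradius :: "real \<Rightarrow> real" where
  "hradius s = ln (1 + exp s) - ln (1 - exp s)"

lemma has_real_derivative_hradius:
  assumes "s < 0" shows "(hradius has_real_derivative hcirc s) (at s within S)"
proof -
  define x where "x = exp s"
  have x: "0 < x" "x < 1" using assms by (auto simp: x_def)
  have "(hradius has_real_derivative exp s / (1 + exp s) - (- exp s) / (1 - exp s)) (at s within S)"
    unfolding hradius_def[abs_def] using assms by (auto intro!: derivative_eq_intros simp: add_pos_pos)
  moreover have "exp s / (1 + exp s) - (- exp s) / (1 - exp s) = hcirc s"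
  proof -
    have "x * x < 1 * 1" using x by (intro mult_strict_mono) auto
    then have n0: "1 + x \<noteq> 0" "1 - x \<noteq> 0" "1 - x * x \<noteq> 0" using x by auto
    have "x / (1 + x) - (- x) / (1 - x) = 2 * x / (1 - x\<^sup>2)"
      unfolding power2_eq_square using n0 by (simp add: divide_simps) (simp add: algebra_simps)
    also have "\<dots> = hcirc s" using conf_logpolar[OF assms, of 0] by (simp add: conf_def x_def)
    finally show ?thesis by (simp add: x_def)
  qed
  ultimately show ?thesis by simp
qed

lemma hradius_ln_tanh:
  assumes "0 < r" shows "hradius (ln (tanh (r / 2))) = r"
proof -
  have t: "0 < tanh (r / 2)" "tanh (r / 2) < 1" using tanh_half_bounds[OF assms] .
  have c: "0 < cosh (r / 2)" by (rule cosh_real_pos)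
  have "1 + tanh (r / 2) = exp (r / 2) / cosh (r / 2)" "1 - tanh (r / 2) = exp (- (r / 2)) / cosh (r / 2)"
    using c by (simp_all add: tanh_def field_simps cosh_plus_sinh cosh_minus_sinh)
  then show ?thesis using t c by (simp add: hradius_def ln_div)
qed

lemma hradius_mono:
  assumes "s \<le> t" "t < 0" shows "hradius s \<le> hradius t"
proof (rule DERIV_nonneg_imp_nondecreasing[OF assms(1)])
  fix x assume "s \<le> x" "x \<le> t"
  then have "x < 0" using assms by simp
  then show "\<exists>y. (hradius has_real_derivative y) (at x) \<and> 0 \<le> y"
    using has_real_derivative_hradius hcirc_pos by (intro exI[of _ "hcirc x"]) (simp add: less_imp_le)
qed

lemma hradius_pos:
  assumes "s < 0" shows "0 < hradius s"
proof -
  have "ln (1 - exp s) < ln (1 + exp s)"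
    using assms by (subst ln_less_cancel_iff) (auto simp: add_pos_pos)
  then show ?thesis by (simp add: hradius_def)
qed

lemma hcirc_times_exp_le: "s < 0 \<Longrightarrow> hcirc s * exp (- hradius s) \<le> 1 / 2"
proof -
  assume s: "s < 0"
  define x where "x = exp s"
  have x: "0 < x" "x < 1" using s by (auto simp: x_def)
  have e: "exp (- hradius s) = (1 - x) / (1 + x)"
    using x by (simp add: hradius_def x_def[symmetric] exp_diff)
  have h: "hcirc s = 2 * x / ((1 - x) * (1 + x))"
    using conf_logpolar[OF s, of 0] by (simp add: conf_def x_def power2_eq_square algebra_simps)
  have "hcirc s * exp (- hradius s) = 2 * x / (1 + x)\<^sup>2"
    unfolding e h using x by (simp add: power2_eq_square)
  also have "\<dots> \<le> 1 / 2"
  proof -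
    have "0 \<le> (1 - x)\<^sup>2" by simp
    then have "2 * (2 * x) \<le> (1 + x)\<^sup>2" by (simp add: power2_eq_square algebra_simps)
    then show ?thesis using x by (simp add: pos_divide_le_eq)
  qed
  finally show ?thesis .
qed

text \<open>The exponential \<open>exp (\<alpha> r)\<close>, cut off at \<open>r = n\<close>. The cutoff \<open>flat 0 (1 - r / n)\<close> is nowhere
constant inside, but its slope is of order \<open>1 / n\<close>.\<close>

definition trial_profile :: "real \<Rightarrow> nat \<Rightarrow> real \<Rightarrow> real" where
  "trial_profile \<alpha> n s = exp (\<alpha> * hradius s) * flat 0 (1 - hradius s / real n)"

text \<open>The factor \<open>smooth_step\<close> removes the singularity of the distance at the origin and equals 1 outside the disk
with parameter \<open>a\<close>, where the integrals are taken.\<close>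

definition trial :: "real \<Rightarrow> real \<Rightarrow> nat \<Rightarrow> complex \<Rightarrow> complex" where
  "trial \<alpha> a n z = (if z \<in> hplane \<and> z \<noteq> 0 then
     of_real (smooth_step (2 * (cmod z)\<^sup>2 / (exp a)\<^sup>2 - 1) * trial_profile \<alpha> n (ln (cmod z))) else 0)"

lemma trial_logpolar:
  assumes "a \<le> s" "s < 0" shows "trial \<alpha> a n (logpolar s \<theta>) = of_real (trial_profile \<alpha> n s)"
proof -
  have "(exp a)\<^sup>2 \<le> (exp s)\<^sup>2" using assms by (intro power_mono) auto
  then have "1 \<le> 2 * (exp s)\<^sup>2 / (exp a)\<^sup>2 - 1" by (simp add: field_simps)
  moreover have "logpolar s \<theta> \<noteq> 0" by (simp add: logpolar_def)
  ultimately show ?thesis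
    using assms by (simp add: trial_def logpolar_in_hplane smooth_step_eq_1)
qed

lemma trial_eq_0:
  assumes "0 < n" "tanh (real n / 2) \<le> cmod z" shows "trial \<alpha> a n z = 0"
proof (cases "z \<in> hplane \<and> z \<noteq> 0")
  case True
  then have z: "0 < cmod z" "cmod z < 1" by (auto simp: hplane_iff)
  have n: "0 < tanh (real n / 2)" using assms by simp
  have "real n = hradius (ln (tanh (real n / 2)))" using assms by (simp add: hradius_ln_tanh)
  also have "\<dots> \<le> hradius (ln (cmod z))" using z n assms by (intro hradius_mono) auto
  finally have "1 - hradius (ln (cmod z)) / real n \<le> 0" using assms by simp
  then show ?thesis by (simp add: trial_def trial_profile_def flat_eq_0)
qed (auto simp: trial_def)

text \<open>Away from the origin all ingredients are compositions of holomorphic functions, \<open>flat 0\<close> and the polynomial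
\<open>z * cnj z\<close>; near the origin the step makes the function vanish.\<close>

lemma trial_test_function:
  assumes n: "0 < n" shows "trial \<alpha> a n \<in> test_functions hplane"
proof (rule test_functionsI[of _ "cball 0 (tanh (real n / 2))"])
  have "tanh (real n / 2) < 1" by (rule tanh_real_lt_1)
  then show "cball 0 (tanh (real n / 2)) \<subseteq> hplane" by (auto simp: hplane_iff)
  fix z :: complex assume "z \<notin> cball 0 (tanh (real n / 2))"
  then show "trial \<alpha> a n z = 0" using n by (intro trial_eq_0) auto
next
  fix k
  define U where "U = hplane - {0}"
  have U: "open U" unfolding U_def by (intro open_delete open_hplane)
  have sq: "Ck_on k U (\<lambda>z. z * cnj z)"
    by (intro Ck_on_mult U Ck_on_id Ck_on_bounded_linear[OF U bounded_linear_cnj])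
  have Re_sq: "Re (z * cnj z) = (cmod z)\<^sup>2" "z * cnj z = of_real ((cmod z)\<^sup>2)" for z
    by (simp_all only: complex_norm_square[symmetric] Re_complex_of_real)
  have half: "open {z::complex. 0 < Re z}" by (rule open_halfspace_Re_gt)
  have hol_Ln: "Ln holomorphic_on {z. 0 < Re z}"
    by (intro holomorphic_on_Ln) (auto simp: complex_nonpos_Reals_iff)
  have hol_csqrt: "csqrt holomorphic_on {z. 0 < Re z}"
    by (rule holomorphic_on_subset[OF holomorphic_on_csqrt]) (auto simp: complex_nonpos_Reals_iff)
  have "Ck_on k U (\<lambda>z. csqrt (z * cnj z))"
    by (rule Ck_on_holomorphic_compose[OF U half _ hol_csqrt sq]) (simp add: Re_sq U_def)
  then have nrm: "Ck_on k U (\<lambda>z. of_real (cmod z))"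
    by (rule Ck_on_cong[OF U, rotated]) (simp add: Re_sq)
  have lin: "Ck_on k U (\<lambda>z. c + d * f z)" if "Ck_on k U f" for c d :: complex and f
    by (intro Ck_on_add Ck_on_mult Ck_on_const U that)
  have l1: "Ck_on k U (\<lambda>z. Ln (1 + 1 * of_real (cmod z)))"
    by (rule Ck_on_holomorphic_compose[OF U half _ hol_Ln lin[OF nrm]]) (auto simp: add_pos_nonneg)
  have l2: "Ck_on k U (\<lambda>z. Ln (1 + (- 1) * of_real (cmod z)))"
    by (rule Ck_on_holomorphic_compose[OF U half _ hol_Ln lin[OF nrm]]) (auto simp: U_def hplane_iff)
  have c1: "Ck_on k U (\<lambda>z. Ln (1 + 1 * of_real (cmod z)) + (- 1) * Ln (1 + (- 1) * of_real (cmod z)))"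
    by (intro Ck_on_add Ck_on_mult Ck_on_const U l1 l2)
  have c2: "Ln (1 + 1 * of_real (cmod z)) + (- 1) * Ln (1 + (- 1) * of_real (cmod z)) = of_real (hradius (ln (cmod z)))"
    if "z \<in> U" for z
  proof -
    have z: "0 < cmod z" "cmod z < 1" using that by (auto simp: U_def hplane_iff)
    have "Ln (1 + 1 * of_real (cmod z)) = of_real (ln (1 + cmod z))"
      using z Ln_of_real[of "1 + cmod z"] add_pos_pos[OF zero_less_one z(1)] by simp
    moreover have "Ln (1 + (- 1) * of_real (cmod z)) = of_real (ln (1 - cmod z))"
      using z Ln_of_real[of "1 - cmod z"] by simp
    ultimately show ?thesis using z by (simp add: hradius_def)
  qed
  have rad: "Ck_on k U (\<lambda>z. of_real (hradius (ln (cmod z))))"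
    by (rule Ck_on_cong[OF U c2 c1])
  have ex: "Ck_on k U (\<lambda>z. exp (of_real \<alpha> * of_real (hradius (ln (cmod z)))))"
    by (rule Ck_on_holomorphic_compose[OF U open_UNIV _ _ Ck_on_mult[OF U Ck_on_const[OF U] rad]])
       (auto intro!: holomorphic_intros)
  have cut: "Ck_on k U (\<lambda>z. of_real (flat 0 (Re (1 + (- 1 / of_nat n) * of_real (hradius (ln (cmod z)))))))"
    by (rule Ck_on_compose[OF U open_UNIV _ Ck_on_flat[OF open_UNIV] lin[OF rad]]) simp
  let ?g = "\<lambda>z. (- 1) + (2 / of_real ((exp a)\<^sup>2)) * (z * cnj z)"
  let ?g' = "\<lambda>z. 2 + (- 2 / of_real ((exp a)\<^sup>2)) * (z * cnj z)"
  have f1: "Ck_on k U (\<lambda>z. of_real (flat 0 (Re (?g z))))"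
    by (rule Ck_on_compose[OF U open_UNIV _ Ck_on_flat[OF open_UNIV] lin[OF sq]]) simp
  have f2: "Ck_on k U (\<lambda>z. of_real (flat 0 (Re (?g' z))))"
    by (rule Ck_on_compose[OF U open_UNIV _ Ck_on_flat[OF open_UNIV] lin[OF sq]]) simp
  have Reg: "Re (?g z) = 2 * (cmod z)\<^sup>2 / (exp a)\<^sup>2 - 1" "Re (?g' z) = 1 - (2 * (cmod z)\<^sup>2 / (exp a)\<^sup>2 - 1)" for z
    unfolding Re_sq(2) by (simp_all add: Re_divide_of_real)
  have f12: "Ck_on k U (\<lambda>z. of_real (flat 0 (Re (?g z))) + of_real (flat 0 (Re (?g' z))))"
    by (rule Ck_on_add[OF U f1 f2])
  have Re_sum: "Re (complex_of_real x + complex_of_real y) = x + y" for x y by simp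
  have fp: "0 < Re (complex_of_real (flat 0 (Re (?g z))) + complex_of_real (flat 0 (Re (?g' z))))" for z
    unfolding Re_sum Reg by (rule flat_sum_pos)
  have hol_inv: "inverse holomorphic_on {z. 0 < Re z}" by (auto intro!: holomorphic_intros)
  have inv: "Ck_on k U (\<lambda>z. inverse (of_real (flat 0 (Re (?g z))) + of_real (flat 0 (Re (?g' z)))))"
    by (rule Ck_on_holomorphic_compose[OF U half _ hol_inv f12]) (unfold mem_Collect_eq, rule fp)
  have "Ck_on k U (\<lambda>z. (of_real (flat 0 (Re (?g z))) * inverse (of_real (flat 0 (Re (?g z))) + of_real (flat 0 (Re (?g' z))))) *
      (exp (of_real \<alpha> * of_real (hradius (ln (cmod z)))) *
       of_real (flat 0 (Re (1 + (- 1 / of_nat n) * of_real (hradius (ln (cmod z))))))))"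
    by (intro Ck_on_mult[OF U] f1 inv ex cut)
  then have away: "Ck_on k U (trial \<alpha> a n)"
  proof (rule Ck_on_cong[OF U, rotated])
    fix z assume z: "z \<in> U"
    have 1: "Re (1 + (- 1 / of_nat n) * complex_of_real (hradius (ln (cmod z)))) = 1 - hradius (ln (cmod z)) / real n"
      by simp
    show "(of_real (flat 0 (Re (?g z))) * inverse (of_real (flat 0 (Re (?g z))) + of_real (flat 0 (Re (?g' z))))) *
      (exp (of_real \<alpha> * of_real (hradius (ln (cmod z)))) *
       of_real (flat 0 (Re (1 + (- 1 / of_nat n) * of_real (hradius (ln (cmod z))))))) = trial \<alpha> a n z"
      unfolding Reg 1 using z
      by (simp add: trial_def U_def trial_profile_def smooth_step_def exp_of_real[symmetric] divide_inverse)
  qed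
  have "Ck_on k (ball 0 (exp a / 2)) (trial \<alpha> a n)"
  proof (rule Ck_on_cong[of _ "\<lambda>_. 0"])
    fix z :: complex assume "z \<in> ball 0 (exp a / 2)"
    then have "(cmod z)\<^sup>2 \<le> (exp a / 2)\<^sup>2" by (intro power_mono) auto
    then have "(cmod z)\<^sup>2 \<le> (exp a)\<^sup>2 / 4" by (simp add: power_divide)
    then have "2 * (cmod z)\<^sup>2 \<le> (exp a)\<^sup>2" using zero_le_power2[of "exp a"] by linarith
    then have "2 * (cmod z)\<^sup>2 / (exp a)\<^sup>2 - 1 \<le> 0" by (simp add: divide_le_eq_1)
    then show "0 = trial \<alpha> a n z" by (simp add: trial_def smooth_step_eq_0)
  qed auto
  then have "Ck_on k (U \<union> ball 0 (exp a / 2)) (trial \<alpha> a n)" using U away by (intro Ck_on_Un) auto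
  then show "Ck_on k hplane (trial \<alpha> a n)" by (rule Ck_on_subset) (auto simp: U_def)
qed auto

definition trial_slope :: "real \<Rightarrow> nat \<Rightarrow> real \<Rightarrow> real" where
  "trial_slope \<alpha> n s = hcirc s * exp (\<alpha> * hradius s) *
     (\<alpha> * flat 0 (1 - hradius s / real n) - flat 2 (1 - hradius s / real n) / real n)"

lemma has_real_derivative_trial_profile:
  assumes "s < 0" shows "(trial_profile \<alpha> n has_real_derivative trial_slope \<alpha> n s) (at s within S)"
proof -
  have h: "(flat 0 has_real_derivative flat 2 x) (at x)" for x
    using has_real_derivative_flat[of 0 x] by (simp add: numeral_2_eq_2)
  have g: "((\<lambda>s. 1 - hradius s / real n) has_real_derivative - hcirc s / real n) (at s within S)"
    by (rule DERIV_cong[OF DERIV_diff[OF DERIV_const DERIV_cdivide[OF has_real_derivative_hradius[OF assms]]]]) simp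
  have f: "((\<lambda>s. flat 0 (1 - hradius s / real n)) has_real_derivative
      flat 2 (1 - hradius s / real n) * (- hcirc s / real n)) (at s within S)"
    by (rule DERIV_chain2[OF h g])
  have e: "((\<lambda>s. exp (\<alpha> * hradius s)) has_real_derivative exp (\<alpha> * hradius s) * (\<alpha> * hcirc s)) (at s within S)"
    by (auto intro!: derivative_eq_intros has_real_derivative_hradius assms)
  from DERIV_mult[OF e f] show ?thesis
    by (simp add: trial_profile_def[abs_def] trial_slope_def algebra_simps)
qed

lemma circle_mean_trial:
  assumes "a \<le> s" "s < 0" shows "circle_mean (trial \<alpha> a n) s = 2 * pi * (trial_profile \<alpha> n s)\<^sup>2"
  using assms by (simp add: circle_mean_def trial_logpolar)

lemma circle_energy_trial:
  assumes n: "0 < n" and s: "a < s" "s < 0"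
  shows "circle_energy (trial \<alpha> a n) s = 2 * pi * (trial_slope \<alpha> n s)\<^sup>2"
proof -
  have "exp (2 * s) * gradsq (trial \<alpha> a n) (logpolar s \<theta>) = (trial_slope \<alpha> n s)\<^sup>2" for \<theta>
  proof -
    define \<zeta> where "\<zeta> = Complex s \<theta>"
    define V where "V = {z. a < Re z} \<inter> {z. Re z < 0}"
    have V: "open V" unfolding V_def by (intro open_Int open_halfspace_Re_gt open_halfspace_Re_lt)
    have \<zeta>: "\<zeta> \<in> V" using s by (simp add: V_def \<zeta>_def)
    have "(cmod (exp \<zeta>))\<^sup>2 * gradsq (trial \<alpha> a n) (exp \<zeta>) = gradsq (\<lambda>z. trial \<alpha> a n (exp z)) \<zeta>"
      by (rule gradsq_compose_holomorphic[symmetric]) (auto intro!: test_function_differentiable[OF trial_test_function[OF n]] DERIV_exp)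
    also have "\<dots> = gradsq (\<lambda>z. of_real (trial_profile \<alpha> n (Re z))) \<zeta>"
    proof (rule gradsq_cong_open[OF V \<zeta>])
      fix w assume w: "w \<in> V"
      then have "trial \<alpha> a n (logpolar (Re w) (Im w)) = of_real (trial_profile \<alpha> n (Re w))"
        by (intro trial_logpolar) (auto simp: V_def)
      then show "trial \<alpha> a n (exp w) = of_real (trial_profile \<alpha> n (Re w))" by (simp add: logpolar_def)
    qed
    also have "\<dots> = (trial_slope \<alpha> n s)\<^sup>2"
    proof -
      have "(trial_profile \<alpha> n has_derivative (\<lambda>h. h * trial_slope \<alpha> n s)) (at (Re \<zeta>))"
        using has_real_derivative_trial_profile[OF s(2), of \<alpha> n UNIV]
        by (simp add: has_field_derivative_def \<zeta>_def mult_commute_abs)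
      from has_derivative_of_real[OF has_derivative_compose[OF bounded_linear_imp_has_derivative[OF bounded_linear_Re] this]]
      have d: "((\<lambda>z. complex_of_real (trial_profile \<alpha> n (Re z))) has_derivative (\<lambda>v. of_real (Re v * trial_slope \<alpha> n s))) (at \<zeta>)" .
      show ?thesis by (simp add: gradsq_def partial_eqI[OF d])
    qed
    finally show ?thesis by (simp add: \<zeta>_def logpolar_def exp_double)
  qed
  then show ?thesis by (simp add: circle_energy_def)
qed

text \<open>Completing the square turns the Rayleigh quotient of the truncated exponential into the
  quotient with potential \<open>- \<alpha>\<^sup>2 - \<alpha> * cosh s\<close>, up to an error caused by the cutoff only.\<close>

lemma trial_energy:
  assumes a: "a \<le> e" "e < 0" and n: "0 < n" and fe: "trial_profile \<alpha> n e = 0"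
  shows "integral {a..e} (\<lambda>s. (trial_slope \<alpha> n s)\<^sup>2) + \<alpha> * hcirc a * (trial_profile \<alpha> n a)\<^sup>2
    = integral {a..e} (\<lambda>s. (hcirc s)\<^sup>2 * ((exp (\<alpha> * hradius s) * flat 2 (1 - hradius s / real n) / real n)\<^sup>2
        - (\<alpha>\<^sup>2 + \<alpha> * cosh s) * (trial_profile \<alpha> n s)\<^sup>2))"
proof -
  let ?f = "trial_profile \<alpha> n" and ?g = "trial_slope \<alpha> n"
  let ?d = "\<lambda>s. \<alpha> * (cosh s * (hcirc s)\<^sup>2) * (?f s)\<^sup>2 + 2 * ?f s * ?g s * (\<alpha> * hcirc s)"
  have sub: "{a..e} \<subseteq> {..<0}" using a by auto
  have int: "(?d has_integral \<alpha> * hcirc e * (?f e)\<^sup>2 - \<alpha> * hcirc a * (?f a)\<^sup>2) {a..e}"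
  proof (rule fundamental_theorem_of_calculus[OF a(1)])
    fix s assume "s \<in> {a..e}"
    then have s: "s < 0" using a by auto
    have "((\<lambda>s. \<alpha> * hcirc s * (?f s)\<^sup>2) has_real_derivative ?d s) (at s within {a..e})"
      using s by (auto intro!: derivative_eq_intros has_real_derivative_hcirc has_real_derivative_trial_profile)
    then show "((\<lambda>s. \<alpha> * hcirc s * (?f s)\<^sup>2) has_vector_derivative ?d s) (at s within {a..e})"
      by (simp add: has_real_derivative_iff_has_vector_derivative)
  qed
  have cr: "continuous_on {a..e} hradius"
    by (rule DERIV_continuous_on) (use a in \<open>auto intro!: has_real_derivative_hradius\<close>)
  have cfl: "continuous_on {a..e} (\<lambda>s. flat m (1 - hradius s / real n))" for m
    by (rule continuous_on_compose2[OF continuous_on_flat[of UNIV]]) (use n in \<open>auto intro!: continuous_intros cr\<close>)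
  have cg: "continuous_on {a..e} ?g"
    unfolding trial_slope_def using n by (intro continuous_intros cr cfl continuous_on_hcirc sub) auto
  have i1: "(\<lambda>s. (?g s)\<^sup>2) integrable_on {a..e}" by (intro integrable_continuous_real continuous_intros cg)
  have "integral {a..e} (\<lambda>s. (?g s)\<^sup>2) + \<alpha> * hcirc a * (?f a)\<^sup>2
      = integral {a..e} (\<lambda>s. (?g s)\<^sup>2) - integral {a..e} ?d"
    using integral_unique[OF int] fe by simp
  also have "\<dots> = integral {a..e} (\<lambda>s. (?g s)\<^sup>2 - ?d s)"
    using int by (intro Henstock_Kurzweil_Integration.integral_diff[symmetric] i1) blast
  also have "\<dots> = integral {a..e} (\<lambda>s. (hcirc s)\<^sup>2 * ((exp (\<alpha> * hradius s) * flat 2 (1 - hradius s / real n) / real n)\<^sup>2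
        - (\<alpha>\<^sup>2 + \<alpha> * cosh s) * (?f s)\<^sup>2))"
  proof (rule Henstock_Kurzweil_Integration.integral_cong)
    fix s
    have g: "?g s - \<alpha> * hcirc s * ?f s = - hcirc s * (exp (\<alpha> * hradius s) * flat 2 (1 - hradius s / real n) / real n)"
      by (simp add: trial_slope_def trial_profile_def algebra_simps)
    have "(?g s)\<^sup>2 - ?d s = (?g s - \<alpha> * hcirc s * ?f s)\<^sup>2 - (hcirc s)\<^sup>2 * ((\<alpha>\<^sup>2 + \<alpha> * cosh s) * (?f s)\<^sup>2)"
      by (simp add: power2_eq_square algebra_simps)
    then show "(?g s)\<^sup>2 - ?d s = (hcirc s)\<^sup>2 * ((exp (\<alpha> * hradius s) * flat 2 (1 - hradius s / real n) / real n)\<^sup>2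
        - (\<alpha>\<^sup>2 + \<alpha> * cosh s) * (?f s)\<^sup>2)"
      unfolding g by (simp add: power2_eq_square algebra_simps)
  qed
  finally show ?thesis .
qed

text \<open>Since \<open>2 \<alpha> \<le> - 1\<close>, the weight \<open>(hcirc s)\<^sup>2 exp (2 \<alpha> r)\<close> is at most \<open>hcirc s / 2\<close>, and \<open>hcirc\<close> is the
derivative of the radius. So the error is at most the radius of the support times \<open>1 / (2 n\<^sup>2)\<close>.\<close>

lemma trial_cutoff_error:
  assumes \<alpha>: "\<alpha> \<le> - 1 / 2" and a: "a \<le> e" "e < 0" and n: "0 < n"
  shows "integral {a..e} (\<lambda>s. (hcirc s)\<^sup>2 * (exp (\<alpha> * hradius s) * flat 2 (1 - hradius s / real n) / real n)\<^sup>2)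
    \<le> hradius e / (2 * (real n)\<^sup>2)"
proof -
  have sub: "{a..e} \<subseteq> {..<0}" using a by auto
  have cr: "continuous_on {a..e} hradius"
    by (rule DERIV_continuous_on) (use a in \<open>auto intro!: has_real_derivative_hradius\<close>)
  have cfl: "continuous_on {a..e} (\<lambda>s. flat 2 (1 - hradius s / real n))"
    by (rule continuous_on_compose2[OF continuous_on_flat[of UNIV]])
       (use n in \<open>auto intro!: continuous_intros cr\<close>)
  have int: "(hcirc has_integral hradius e - hradius a) {a..e}"
    by (rule fundamental_theorem_of_calculus[OF a(1)])
       (use a has_real_derivative_hradius in \<open>auto simp: has_real_derivative_iff_has_vector_derivative[symmetric]\<close>)
  have "integral {a..e} (\<lambda>s. (hcirc s)\<^sup>2 * (exp (\<alpha> * hradius s) * flat 2 (1 - hradius s / real n) / real n)\<^sup>2)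
      \<le> integral {a..e} (\<lambda>s. 1 / (2 * (real n)\<^sup>2) * hcirc s)"
  proof (rule integral_le)
    show "(\<lambda>s. (hcirc s)\<^sup>2 * (exp (\<alpha> * hradius s) * flat 2 (1 - hradius s / real n) / real n)\<^sup>2) integrable_on {a..e}"
      using n by (intro integrable_continuous_real continuous_intros cr cfl continuous_on_hcirc sub) auto
    show "(\<lambda>s. 1 / (2 * (real n)\<^sup>2) * hcirc s) integrable_on {a..e}"
      by (intro integrable_continuous_real continuous_on_mult_left continuous_on_hcirc sub)
    fix s assume "s \<in> {a..e}"
    then have s: "s < 0" using a by auto
    let ?r = "hradius s" and ?h = "flat 2 (1 - hradius s / real n)"
    have c: "0 < hcirc s" by (rule hcirc_pos[OF s])
    have r: "0 < ?r" by (rule hradius_pos[OF s])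
    have "2 * \<alpha> * ?r \<le> (- 1) * ?r" using \<alpha> r by (intro mult_right_mono) auto
    then have "(exp (\<alpha> * ?r))\<^sup>2 \<le> exp (- ?r)" by (simp add: exp_double[symmetric])
    moreover have "?h\<^sup>2 \<le> 1\<^sup>2" by (intro power_mono flat_2_le_1 flat_nonneg)
    ultimately have "(exp (\<alpha> * ?r))\<^sup>2 * ?h\<^sup>2 \<le> exp (- ?r) * 1\<^sup>2" by (intro mult_mono) auto
    then have "(hcirc s)\<^sup>2 * ((exp (\<alpha> * ?r))\<^sup>2 * ?h\<^sup>2) \<le> (hcirc s)\<^sup>2 * exp (- ?r)" by (intro mult_left_mono) auto
    also have "\<dots> = hcirc s * (hcirc s * exp (- ?r))" by (simp add: power2_eq_square)
    also have "\<dots> \<le> hcirc s * (1 / 2)" using c hcirc_times_exp_le[OF s] by (intro mult_left_mono) auto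
    finally have "(hcirc s)\<^sup>2 * ((exp (\<alpha> * ?r))\<^sup>2 * ?h\<^sup>2) / (real n)\<^sup>2 \<le> hcirc s * (1 / 2) / (real n)\<^sup>2"
      by (rule divide_right_mono) simp
    then show "(hcirc s)\<^sup>2 * (exp (\<alpha> * ?r) * ?h / real n)\<^sup>2 \<le> 1 / (2 * (real n)\<^sup>2) * hcirc s"
      by (simp add: power_mult_distrib power_divide)
  qed
  also have "\<dots> = 1 / (2 * (real n)\<^sup>2) * (hradius e - hradius a)"
    using integral_unique[OF int] by simp
  also have "\<dots> \<le> 1 / (2 * (real n)\<^sup>2) * hradius e"
    using hradius_pos[of a] a by (intro mult_left_mono) auto
  finally show ?thesis by simp
qed

text \<open>On a fixed interval \<open>cosh s\<close> stays strictly below \<open>cosh a\<close>, and for large \<open>n\<close> the cutoff there is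
at least \<open>exp (- 2)\<close>. The gain is therefore independent of \<open>n\<close>.\<close>

lemma trial_gain:
  assumes a: "a < 0"
  obtains s \<tau> where "a < s" "s < 0" "0 < \<tau>"
    "\<And>e n. s \<le> e \<Longrightarrow> e < 0 \<Longrightarrow> 0 < n \<Longrightarrow> 2 * hradius s \<le> real n \<Longrightarrow>
       \<tau> \<le> integral {a..e} (\<lambda>s. (hcirc s)\<^sup>2 * ((cosh a - cosh s) * (trial_profile \<alpha> n s)\<^sup>2))"
proof -
  define s1 where "s1 = a / 2" define s2 where "s2 = a / 4"
  have s: "a < s1" "s1 < s2" "s2 < 0" using a by (auto simp: s1_def s2_def)
  define g where "g s = (hcirc s)\<^sup>2 * ((cosh a - cosh s) * (exp (\<alpha> * hradius s) * exp (- 2))\<^sup>2)" for s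
  have cr: "continuous_on {x..y} hradius" if "y < 0" for x y
    by (rule DERIV_continuous_on) (use that in \<open>auto intro!: has_real_derivative_hradius\<close>)
  have "continuous_on {s1..s2} g"
    unfolding g_def using s by (intro continuous_intros cr continuous_on_hcirc) auto
  then obtain x where x: "x \<in> {s1..s2}" "\<And>y. y \<in> {s1..s2} \<Longrightarrow> g x \<le> g y"
    using s continuous_attains_inf[of "{s1..s2}" g] by auto
  have cosh_less: "cosh y < cosh a" if "a < y" "y < 0" for y
    using that cosh_real_nonneg_less_iff[of "- y" "- a"] by simp
  have gx: "0 < g x"
    using x(1) s cosh_less[of x] hcirc_pos[of x] by (auto simp: g_def)
  show ?thesis
  proof (rule that[of s2 "g x * (s2 - s1)"])
    show "a < s2" "s2 < 0" using s by auto
    show "0 < g x * (s2 - s1)" using gx s by simp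
    fix e :: real and n :: nat
    assume e: "s2 \<le> e" "e < 0" and n: "0 < n" "2 * hradius s2 \<le> real n"
    let ?F = "\<lambda>s. (hcirc s)\<^sup>2 * ((cosh a - cosh s) * (trial_profile \<alpha> n s)\<^sup>2)"
    have cF: "continuous_on {y..z} ?F" if "z < 0" for y z
    proof -
      have "continuous_on {y..z} (trial_profile \<alpha> n)"
        by (rule DERIV_continuous_on) (use that in \<open>auto intro!: has_real_derivative_trial_profile\<close>)
      then show ?thesis using that by (intro continuous_intros continuous_on_hcirc) auto
    qed
    have "g x * (s2 - s1) = integral {s1..s2} (\<lambda>_. g x)" using s by simp
    also have "\<dots> \<le> integral {s1..s2} ?F"
    proof (rule integral_le)
      show "?F integrable_on {s1..s2}" by (intro integrable_continuous_real cF s)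
      fix y assume y: "y \<in> {s1..s2}"
      then have y0: "a < y" "y < 0" using s by auto
      have "hradius y \<le> hradius s2" using y s by (intro hradius_mono) auto
      then have "hradius y / real n \<le> 1 / 2" using n by (simp add: field_simps)
      then have half: "1 / 2 \<le> 1 - hradius y / real n" by simp
      moreover have "exp (- 2) \<le> flat 0 x" if "1 / 2 \<le> x" for x :: real
      proof -
        have "- 2 \<le> - 1 / x" using that by (simp add: field_simps)
        then show ?thesis using that by (simp add: flat_def)
      qed
      ultimately have "exp (- 2) \<le> flat 0 (1 - hradius y / real n)" by blast
      then have "exp (\<alpha> * hradius y) * exp (- 2) \<le> trial_profile \<alpha> n y"
        unfolding trial_profile_def by (intro mult_left_mono) auto
      then have "(exp (\<alpha> * hradius y) * exp (- 2))\<^sup>2 \<le> (trial_profile \<alpha> n y)\<^sup>2" by (intro power_mono) auto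
      then have "g y \<le> ?F y"
        unfolding g_def using cosh_less[OF y0] by (intro mult_left_mono) auto
      then show "g x \<le> ?F y" using x(2)[OF y] by linarith
    qed (rule integrable_const_ivl)
    also have "\<dots> \<le> integral {a..e} ?F"
    proof (rule integral_subset_le)
      show "{s1..s2} \<subseteq> {a..e}" using s e by auto
      show "?F integrable_on {s1..s2}" "?F integrable_on {a..e}"
        by (intro integrable_continuous_real cF s e)+
      show "\<forall>y\<in>{a..e}. 0 \<le> ?F y"
      proof
        fix y assume "y \<in> {a..e}"
        then have "cosh y \<le> cosh a" using e cosh_mono_neg[of a y] by auto
        then show "0 \<le> ?F y" by simp
      qed
    qed
    finally show "g x * (s2 - s1) \<le> integral {a..e} ?F" .
  qed
qed

text \<open>As the cutoff recedes to infinity its error \<open>X\<close> tends to zero while the gain \<open>G\<close> does not.\<close>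

lemma trial_beats_exponential_rate:
  assumes R: "0 < R" and a: "exp a = tanh (R / 2)" and \<alpha>: "\<alpha> \<le> - 1 / 2"
  defines "U \<equiv> exterior (geodesic_disk 0 R)"
  obtains \<phi> where "\<phi> \<in> test_functions hplane" "0 < mass U \<phi>"
    "dirichlet U \<phi> + \<alpha> * bmass U \<phi> < (- \<alpha>\<^sup>2 - \<alpha> * cosh a) * mass U \<phi>"
proof -
  have a0: "a < 0" using tanh_half_bounds[OF R] a by (metis exp_less_one_iff)
  obtain s \<tau> where s: "a < s" "s < 0" and \<tau>: "0 < \<tau>"
    "\<And>e n. s \<le> e \<Longrightarrow> e < 0 \<Longrightarrow> 0 < n \<Longrightarrow> 2 * hradius s \<le> real n \<Longrightarrow>
       \<tau> \<le> integral {a..e} (\<lambda>s. (hcirc s)\<^sup>2 * ((cosh a - cosh s) * (trial_profile \<alpha> n s)\<^sup>2))"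
    using trial_gain[OF a0, of \<alpha>] by blast
  obtain n :: nat where n: "max (2 * hradius s) (2 / \<tau>) < real n" using reals_Archimedean2 by blast
  have "0 < 2 / \<tau>" using \<tau>(1) by simp
  then have n0: "0 < n" using n by (metis less_trans max_less_iff_conj of_nat_0_less_iff)
  then have n1: "1 \<le> real n" by simp
  \<comment> \<open>Radius \<open>n + 1\<close>, hence strictly outside the support, where the partial derivatives vanish as well.\<close>
  define e where "e = ln (tanh ((real n + 1) / 2))"
  have t: "0 < tanh ((real n + 1) / 2)" "tanh ((real n + 1) / 2) < 1" using tanh_half_bounds[of "real n + 1"] by auto
  have e: "e < 0" "exp e = tanh ((real n + 1) / 2)" using t by (auto simp: e_def)
  have re: "hradius e = real n + 1" unfolding e_def by (rule hradius_ln_tanh) simp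
  have se: "s \<le> e"
  proof (rule ccontr)
    assume "\<not> s \<le> e"
    then have "hradius e \<le> hradius s" using s by (intro hradius_mono) auto
    then show False using n re hradius_pos[OF s(2)] by auto
  qed
  then have ae: "a \<le> e" using s by simp
  let ?\<phi> = "trial \<alpha> a n" and ?f = "trial_profile \<alpha> n"
  let ?A = "\<lambda>s. exp (\<alpha> * hradius s) * flat 2 (1 - hradius s / real n) / real n"
  have \<phi>: "?\<phi> \<in> test_functions hplane" by (rule trial_test_function[OF n0])
  have lt: "tanh (real n / 2) < exp e" unfolding e(2) by simp
  have supp: "?\<phi> z = 0" if "exp e \<le> cmod z" for z
    using that lt by (intro trial_eq_0[OF n0]) auto
  have supp': "partial c ?\<phi> z = 0" if "exp e \<le> cmod z" for z c
  proof (rule partial_eq_0_off_support[of "cball 0 (tanh (real n / 2))"])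
    show "trial \<alpha> a n z = 0" if "z \<notin> cball 0 (tanh (real n / 2))" for z
      using that by (intro trial_eq_0[OF n0]) auto
  qed (use that lt in auto)
  have F: "dirichlet U ?\<phi> = integral {a..e} (circle_energy ?\<phi>)"
    "mass U ?\<phi> = integral {a..e} (mass_density (circle_mean ?\<phi>))"
    "bmass U ?\<phi> = hcirc a * circle_mean ?\<phi> a"
    by (simp_all add: U_def forms_radial[OF R a \<phi> e(1) supp supp'])
  have sub: "{a..e} \<subseteq> {..<0}" using e by auto
  have cf: "continuous_on {a..e} ?f"
    by (rule DERIV_continuous_on) (use e in \<open>auto intro!: has_real_derivative_trial_profile\<close>)
  have cr: "continuous_on {a..e} hradius"
    by (rule DERIV_continuous_on) (use e in \<open>auto intro!: has_real_derivative_hradius\<close>)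
  have cfl: "continuous_on {a..e} (\<lambda>s. flat 2 (1 - hradius s / real n))"
    by (rule continuous_on_compose2[OF continuous_on_flat[of UNIV]])
       (use n0 in \<open>auto intro!: continuous_intros cr\<close>)
  have cA: "continuous_on {a..e} ?A" using n0 by (intro continuous_intros cr cfl) auto
  have ch: "continuous_on {a..e} hcirc" by (rule continuous_on_hcirc[OF sub])
  define I where "I = integral {a..e} (\<lambda>s. (hcirc s)\<^sup>2 * (?f s)\<^sup>2)"
  define G where "G = integral {a..e} (\<lambda>s. (hcirc s)\<^sup>2 * ((cosh a - cosh s) * (?f s)\<^sup>2))"
  define X where "X = integral {a..e} (\<lambda>s. (hcirc s)\<^sup>2 * (?A s)\<^sup>2)"
  have mass: "mass U ?\<phi> = 2 * pi * I"
  proof -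
    have "integral {a..e} (mass_density (circle_mean ?\<phi>)) = integral {a..e} (\<lambda>s. 2 * pi * ((hcirc s)\<^sup>2 * (?f s)\<^sup>2))"
      using e by (intro Henstock_Kurzweil_Integration.integral_cong) (simp add: mass_density_def circle_mean_trial)
    then show ?thesis unfolding F(2) I_def by simp
  qed
  have bm: "bmass U ?\<phi> = 2 * pi * (hcirc a * (?f a)\<^sup>2)"
    unfolding F(3) using a0 by (simp add: circle_mean_trial)
  have dir: "dirichlet U ?\<phi> = 2 * pi * integral {a..e} (\<lambda>s. (trial_slope \<alpha> n s)\<^sup>2)"
  proof -
    \<comment> \<open>At the end point \<open>a\<close> the trial function need not be given by its profile on both sides.\<close>
    have "integral {a..e} (circle_energy ?\<phi>) = integral {a..e} (\<lambda>s. 2 * pi * (trial_slope \<alpha> n s)\<^sup>2)"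
      by (rule integral_spike[of "{a}"]) (use e n0 in \<open>auto simp: circle_energy_trial\<close>)
    then show ?thesis unfolding F(1) by simp
  qed
  have "?f e = 0" using re n0 by (simp add: trial_profile_def flat_eq_0)
  from trial_energy[OF ae e(1) n0 this]
  have "dirichlet U ?\<phi> + \<alpha> * bmass U ?\<phi> = 2 * pi * integral {a..e} (\<lambda>s. (hcirc s)\<^sup>2 * ((?A s)\<^sup>2 - (\<alpha>\<^sup>2 + \<alpha> * cosh s) * (?f s)\<^sup>2))"
    unfolding dir bm by (simp add: distrib_left[symmetric] mult.assoc mult.left_commute[of \<alpha>])
  also have "integral {a..e} (\<lambda>s. (hcirc s)\<^sup>2 * ((?A s)\<^sup>2 - (\<alpha>\<^sup>2 + \<alpha> * cosh s) * (?f s)\<^sup>2))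
      = X + \<alpha> * G + (- \<alpha>\<^sup>2 - \<alpha> * cosh a) * I"
  proof -
    let ?k = "- \<alpha>\<^sup>2 - \<alpha> * cosh a"
    have "X + \<alpha> * G + ?k * I = integral {a..e} (\<lambda>s. (hcirc s)\<^sup>2 * (?A s)\<^sup>2)
        + integral {a..e} (\<lambda>s. \<alpha> * ((hcirc s)\<^sup>2 * ((cosh a - cosh s) * (?f s)\<^sup>2)))
        + integral {a..e} (\<lambda>s. ?k * ((hcirc s)\<^sup>2 * (?f s)\<^sup>2))"
      by (simp add: X_def G_def I_def)
    also have "\<dots> = integral {a..e} (\<lambda>s. (hcirc s)\<^sup>2 * (?A s)\<^sup>2 + \<alpha> * ((hcirc s)\<^sup>2 * ((cosh a - cosh s) * (?f s)\<^sup>2)))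
        + integral {a..e} (\<lambda>s. ?k * ((hcirc s)\<^sup>2 * (?f s)\<^sup>2))"
      by (subst Henstock_Kurzweil_Integration.integral_add)
         (intro integrable_continuous_real continuous_intros ch cA cf refl)+
    also have "\<dots> = integral {a..e} (\<lambda>s. (hcirc s)\<^sup>2 * (?A s)\<^sup>2 + \<alpha> * ((hcirc s)\<^sup>2 * ((cosh a - cosh s) * (?f s)\<^sup>2))
        + ?k * ((hcirc s)\<^sup>2 * (?f s)\<^sup>2))"
      by (subst Henstock_Kurzweil_Integration.integral_add)
         (intro integrable_continuous_real continuous_intros ch cA cf refl)+
    also have "\<dots> = integral {a..e} (\<lambda>s. (hcirc s)\<^sup>2 * ((?A s)\<^sup>2 - (\<alpha>\<^sup>2 + \<alpha> * cosh s) * (?f s)\<^sup>2))"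
      by (intro Henstock_Kurzweil_Integration.integral_cong) (simp add: algebra_simps)
    finally show ?thesis by simp
  qed
  finally have E: "dirichlet U ?\<phi> + \<alpha> * bmass U ?\<phi> = 2 * pi * (X + \<alpha> * G) + (- \<alpha>\<^sup>2 - \<alpha> * cosh a) * mass U ?\<phi>"
    by (simp add: mass algebra_simps)
  have G: "\<tau> \<le> G" unfolding G_def using n se e n0 by (intro \<tau>(2)) auto
  have "X \<le> hradius e / (2 * (real n)\<^sup>2)" unfolding X_def by (rule trial_cutoff_error[OF \<alpha> ae e(1) n0])
  also have "\<dots> \<le> 1 / real n"
  proof -
    have "real n + 1 \<le> 2 * real n" using n1 by simp
    then show ?thesis unfolding re using n0 by (simp add: field_simps power2_eq_square)
  qed
  also have "\<dots> < \<tau> / 2"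
  proof -
    have "2 / \<tau> < real n" using n by simp
    then show ?thesis using \<tau>(1) n0 by (simp add: field_simps)
  qed
  finally have X: "X < \<tau> / 2" .
  have "\<alpha> * G \<le> (- 1 / 2) * G" using \<alpha> G \<tau>(1) by (intro mult_right_mono) auto
  then have neg: "X + \<alpha> * G < 0" using X G by simp
  have "0 < I"
  proof -
    have "G \<le> integral {a..e} (\<lambda>s. cosh a * ((hcirc s)\<^sup>2 * (?f s)\<^sup>2))"
      unfolding G_def
    proof (rule integral_le)
      show "(\<lambda>s. (hcirc s)\<^sup>2 * ((cosh a - cosh s) * (?f s)\<^sup>2)) integrable_on {a..e}"
        by (intro integrable_continuous_real continuous_intros ch cf)
      show "(\<lambda>s. cosh a * ((hcirc s)\<^sup>2 * (?f s)\<^sup>2)) integrable_on {a..e}"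
        by (intro integrable_continuous_real continuous_intros ch cf)
      fix s
      have "0 \<le> cosh s * ((hcirc s)\<^sup>2 * (?f s)\<^sup>2)" by simp
      then show "(hcirc s)\<^sup>2 * ((cosh a - cosh s) * (?f s)\<^sup>2) \<le> cosh a * ((hcirc s)\<^sup>2 * (?f s)\<^sup>2)"
        by (simp add: algebra_simps)
    qed
    then have "0 < cosh a * I" using G \<tau>(1) by (simp add: I_def)
    then show ?thesis by (rule zero_less_mult_pos) (rule cosh_real_pos)
  qed
  then have "0 < mass U ?\<phi>" by (simp add: mass)
  moreover have "dirichlet U ?\<phi> + \<alpha> * bmass U ?\<phi> < (- \<alpha>\<^sup>2 - \<alpha> * cosh a) * mass U ?\<phi>"
    unfolding E using neg by (simp add: mult_less_0_iff)
  ultimately show ?thesis using that \<phi> by blast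
qed

section \<open>Strict monotonicity\<close>

lemma test_function_radius:
  assumes \<phi>: "\<phi> \<in> test_functions hplane" and x: "x < 0"
  obtains e where "x \<le> e" "e < 0" "\<And>z. exp e \<le> cmod z \<Longrightarrow> \<phi> z = 0" "\<And>z c. exp e \<le> cmod z \<Longrightarrow> partial c \<phi> z = 0"
proof -
  obtain K where K: "compact K" "K \<subseteq> hplane" "\<And>z. z \<notin> K \<Longrightarrow> \<phi> z = 0" "\<And>z c. z \<notin> K \<Longrightarrow> partial c \<phi> z = 0"
    using test_functionE[OF \<phi>] by metis
  obtain M where M: "M < 1" "\<And>z. z \<in> K \<Longrightarrow> cmod z \<le> M"
  proof (cases "K = {}")
    case True
    then show ?thesis using that[of 0] by auto
  next
    case False
    obtain w where w: "w \<in> K" "\<And>z. z \<in> K \<Longrightarrow> cmod z \<le> cmod w"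
      using continuous_attains_sup[OF K(1) False, of cmod] continuous_on_norm_id by auto
    then show ?thesis using that[of "cmod w"] K(2) by (auto simp: hplane_iff)
  qed
  define e where "e = max x (ln ((1 + max M 0) / 2))"
  have m: "max M 0 < (1 + max M 0) / 2" "(1 + max M 0) / 2 < 1" "0 < (1 + max M 0) / 2" using M by auto
  have "ln ((1 + max M 0) / 2) \<le> e" unfolding e_def by (rule max.cobounded2)
  then have "exp (ln ((1 + max M 0) / 2)) \<le> exp e" by (simp only: exp_le_cancel_iff)
  then have "(1 + max M 0) / 2 \<le> exp e" unfolding exp_ln[OF m(3)] .
  then have "z \<notin> K" if "exp e \<le> cmod z" for z using that M(2)[of z] m by auto
  then show ?thesis using K x m by (intro that[of e]) (auto simp: e_def)
qed

context
  fixes R a :: real and U :: "complex set"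
  assumes R: "0 < R" and a: "exp a = tanh (R / 2)" and U: "U = exterior (geodesic_disk 0 R)"
begin

lemma log_radius_neg: "a < 0"
  using tanh_half_bounds[OF R] a by (metis exp_less_one_iff)

lemma robin_lambda_lower_boundI:
  assumes "\<And>\<phi>. \<phi> \<in> test_functions hplane \<Longrightarrow> c * mass U \<phi> \<le> dirichlet U \<phi> + \<alpha> * bmass U \<phi>"
  shows "ereal c \<le> robin_lambda \<alpha> U"
proof -
  have 0: "0 \<in> hplane" by (simp add: hplane_iff)
  show ?thesis
    unfolding U robin_lambda_eq_INF_test[OF 0 R]
    using assms by (intro INF_greatest) (auto simp: U pos_le_divide_eq)
qed

lemma robin_lambda_le_quotient:
  assumes "\<phi> \<in> test_functions hplane" "0 < mass U \<phi>"
  shows "robin_lambda \<alpha> U \<le> ereal ((dirichlet U \<phi> + \<alpha> * bmass U \<phi>) / mass U \<phi>)"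
proof -
  have 0: "0 \<in> hplane" by (simp add: hplane_iff)
  show ?thesis unfolding U robin_lambda_eq_INF_test[OF 0 R] using assms by (intro INF_lower) (auto simp: U)
qed

lemma forms_semibounded:
  obtains C where "0 \<le> C" "\<And>\<phi>. \<phi> \<in> test_functions hplane \<Longrightarrow> - C * mass U \<phi> \<le> dirichlet U \<phi> + \<alpha> * bmass U \<phi>"
proof -
  obtain C where C: "0 \<le> C" "\<And>b N P K e. radial_profile b N P K \<Longrightarrow> a / 2 \<le> e \<Longrightarrow> b \<le> e \<Longrightarrow> e < 0 \<Longrightarrow>
       - C * integral {a..e} (mass_density N) \<le> integral {a..e} K + \<alpha> * hcirc a * N a"
    using semibounded[OF log_radius_neg, of \<alpha>] by blast
  show ?thesis
  proof (rule that[OF C(1)])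
    fix \<phi> assume \<phi>: "\<phi> \<in> test_functions hplane"
    have "a / 2 < 0" using log_radius_neg by simp
    then obtain e where e: "a / 2 \<le> e" "e < 0" "\<And>z. exp e \<le> cmod z \<Longrightarrow> \<phi> z = 0" "\<And>z c. exp e \<le> cmod z \<Longrightarrow> partial c \<phi> z = 0"
      using test_function_radius[OF \<phi>] by metis
    show "- C * mass U \<phi> \<le> dirichlet U \<phi> + \<alpha> * bmass U \<phi>"
      using C(2)[OF radial_profile_test[OF \<phi> e(2,3)] e(1) order_refl e(2)]
      by (simp add: U forms_radial[OF R a \<phi> e(2-4)] mult.assoc)
  qed
qed

lemma quarter_bound:
  assumes \<phi>: "\<phi> \<in> test_functions hplane" and \<alpha>: "- 1 / 2 \<le> \<alpha>"
  shows "1 / 4 * mass U \<phi> \<le> dirichlet U \<phi> + \<alpha> * bmass U \<phi>"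
proof -
  obtain e where e: "a \<le> e" "e < 0" "\<And>z. exp e \<le> cmod z \<Longrightarrow> \<phi> z = 0" "\<And>z c. exp e \<le> cmod z \<Longrightarrow> partial c \<phi> z = 0"
    using test_function_radius[OF \<phi> log_radius_neg] by metis
  have "bmass U \<phi> / 2 + mass U \<phi> / 4 \<le> dirichlet U \<phi>"
    using tail_bound[OF radial_profile_test[OF \<phi> e(2,3)] e(1) order_refl e(2)]
    by (simp add: U forms_radial[OF R a \<phi> e(2-4)])
  moreover have "(- 1 / 2) * bmass U \<phi> \<le> \<alpha> * bmass U \<phi>"
    using \<alpha> by (intro mult_right_mono bmass_nonneg)
  ultimately show ?thesis by simp
qed

text \<open>The Rayleigh quotient is monotone in \<open>\<alpha>\<close>, so the value below \<open>1 / 4\<close> at some larger parameter is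
inherited by \<open>\<alpha>\<close>; for parameters above \<open>- 1 / 2\<close> no such value exists.\<close>

lemma subcritical:
  assumes "ereal \<alpha> < robin_critical U"
  shows "\<alpha> < - 1 / 2" "robin_lambda \<alpha> U < ereal (1 / 4)"
proof -
  obtain \<beta> where \<beta>: "\<alpha> < \<beta>" "robin_lambda \<beta> U < ereal (1 / 4)"
    using assms unfolding robin_critical_def less_Sup_iff by auto
  have "\<not> - 1 / 2 \<le> \<beta>"
  proof
    assume "- 1 / 2 \<le> \<beta>"
    then have "ereal (1 / 4) \<le> robin_lambda \<beta> U" by (intro robin_lambda_lower_boundI quarter_bound)
    then show False using \<beta>(2) by simp
  qed
  then show "\<alpha> < - 1 / 2" using \<beta>(1) by simp
  have 0: "0 \<in> hplane" by (simp add: hplane_iff)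
  obtain \<phi> where \<phi>: "\<phi> \<in> test_functions hplane" "0 < mass U \<phi>"
    "ereal ((dirichlet U \<phi> + \<beta> * bmass U \<phi>) / mass U \<phi>) < ereal (1 / 4)"
    using \<beta>(2) unfolding U robin_lambda_eq_INF_test[OF 0 R] INF_less_iff by auto
  have "\<alpha> * bmass U \<phi> \<le> \<beta> * bmass U \<phi>" using \<beta>(1) by (intro mult_right_mono bmass_nonneg) simp
  then have "(dirichlet U \<phi> + \<alpha> * bmass U \<phi>) / mass U \<phi> \<le> (dirichlet U \<phi> + \<beta> * bmass U \<phi>) / mass U \<phi>"
    using \<phi>(2) by (intro divide_right_mono) auto
  then have "ereal ((dirichlet U \<phi> + \<alpha> * bmass U \<phi>) / mass U \<phi>) \<le> ereal ((dirichlet U \<phi> + \<beta> * bmass U \<phi>) / mass U \<phi>)" by simp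
  then show "robin_lambda \<alpha> U < ereal (1 / 4)"
    using robin_lambda_le_quotient[OF \<phi>(1,2)] \<phi>(3) by (meson le_less_trans)
qed

lemma robin_lambda_less_exponential_rate:
  assumes "\<alpha> \<le> - 1 / 2" shows "robin_lambda \<alpha> U < ereal (- \<alpha>\<^sup>2 - \<alpha> * cosh a)"
proof -
  obtain \<phi> where \<phi>: "\<phi> \<in> test_functions hplane" "0 < mass U \<phi>"
    "dirichlet U \<phi> + \<alpha> * bmass U \<phi> < (- \<alpha>\<^sup>2 - \<alpha> * cosh a) * mass U \<phi>"
    using trial_beats_exponential_rate[OF R a assms] unfolding U by blast
  have "ereal ((dirichlet U \<phi> + \<alpha> * bmass U \<phi>) / mass U \<phi>) < ereal (- \<alpha>\<^sup>2 - \<alpha> * cosh a)"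
    using \<phi>(2,3) by (simp add: pos_divide_less_eq)
  then show ?thesis using robin_lambda_le_quotient[OF \<phi>(1,2)] by (meson le_less_trans)
qed

end

text \<open>The bound for the large disk is applied to the restriction of a test function of the small one. If that
restriction has no mass, the semibounded form shows that its energy is nonnegative, so the bound
holds nevertheless.\<close>

lemma robin_lambda_enlarge:
  assumes R: "0 < R" "R < R'" and a: "exp a = tanh (R / 2)" "exp a' = tanh (R' / 2)"
    and \<alpha>: "\<alpha> \<le> - 1 / 2" and L: "L < 1 / 4" "ereal L \<le> robin_lambda \<alpha> (exterior (geodesic_disk 0 R'))"
  shows "ereal L < robin_lambda \<alpha> (exterior (geodesic_disk 0 R))"
proof -
  let ?U = "exterior (geodesic_disk 0 R)" and ?V = "exterior (geodesic_disk 0 R')"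
  have R': "0 < R'" using R by simp
  have "exp a < exp a'" using R by (simp add: a)
  then have aa: "a < a'" by simp
  have a'0: "a' < 0" by (rule log_radius_neg[OF R' a(2) refl])
  have "ereal L < ereal (- \<alpha>\<^sup>2 - \<alpha> * cosh a')"
    using robin_lambda_less_exponential_rate[OF R' a(2) refl \<alpha>] L(2) by (rule le_less_trans[rotated])
  then have L': "L < - \<alpha>\<^sup>2 - \<alpha> * cosh a'" by simp
  have \<alpha>0: "\<alpha> \<le> 0" using \<alpha> by simp
  obtain \<tau> where \<tau>: "0 < \<tau>" "\<And>b N P K e. radial_profile b N P K \<Longrightarrow> a' \<le> e \<Longrightarrow> b \<le> e \<Longrightarrow> e < 0 \<Longrightarrow>
       L * integral {a'..e} (mass_density N) \<le> integral {a'..e} K + \<alpha> * hcirc a' * N a' \<Longrightarrow>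
       (L + \<tau>) * integral {a..e} (mass_density N) \<le> integral {a..e} K + \<alpha> * hcirc a * N a"
    using enlarging_gains[OF aa a'0 \<alpha>0 L(1) L'] by blast
  have outer: "L * mass ?V \<phi> \<le> dirichlet ?V \<phi> + \<alpha> * bmass ?V \<phi>" if \<phi>: "\<phi> \<in> test_functions hplane" for \<phi>
  proof (cases "0 < mass ?V \<phi>")
    case True
    have "ereal L \<le> ereal ((dirichlet ?V \<phi> + \<alpha> * bmass ?V \<phi>) / mass ?V \<phi>)"
      using robin_lambda_le_quotient[OF R' a(2) refl \<phi> True] L(2) by (rule order_trans[rotated])
    then show ?thesis using True by (simp add: pos_le_divide_eq)
  next
    case False
    then have z: "mass ?V \<phi> = 0" using mass_nonneg[of ?V \<phi>] by simp
    obtain C where "\<And>\<phi>. \<phi> \<in> test_functions hplane \<Longrightarrow> - C * mass ?V \<phi> \<le> dirichlet ?V \<phi> + \<alpha> * bmass ?V \<phi>"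
      using forms_semibounded[OF R' a(2) refl, of \<alpha>] by blast
    from this[OF \<phi>] show ?thesis by (simp add: z)
  qed
  have "ereal (L + \<tau>) \<le> robin_lambda \<alpha> ?U"
  proof (rule robin_lambda_lower_boundI[OF R(1) a(1) refl])
    fix \<phi> assume \<phi>: "\<phi> \<in> test_functions hplane"
    obtain e where e: "a' \<le> e" "e < 0" "\<And>z. exp e \<le> cmod z \<Longrightarrow> \<phi> z = 0" "\<And>z c. exp e \<le> cmod z \<Longrightarrow> partial c \<phi> z = 0"
      using test_function_radius[OF \<phi> a'0] by metis
    show "(L + \<tau>) * mass ?U \<phi> \<le> dirichlet ?U \<phi> + \<alpha> * bmass ?U \<phi>"
      using \<tau>(2)[OF radial_profile_test[OF \<phi> e(2,3)] e(1) order_refl e(2)] outer[OF \<phi>]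
      by (simp add: forms_radial[OF R(1) a(1) \<phi> e(2-4)] forms_radial[OF R' a(2) \<phi> e(2-4)] mult.assoc)
  qed
  moreover have "ereal L < ereal (L + \<tau>)" using \<tau>(1) by simp
  ultimately show ?thesis by (rule less_le_trans[rotated])
qed

text \<open>The comparison level is the value \<open>L\<close> for the small disk itself: if the large disk did not lie below it,
\<open>robin_lambda_enlarge\<close> would give \<open>L < L\<close>.\<close>

theorem proposition4p4:
  fixes R R' \<alpha> :: real and p q :: complex
  assumes "p \<in> hplane" and "q \<in> hplane"
    and "0 < R" and "R < R'"
    and "ereal \<alpha> < robin_critical (exterior (geodesic_disk p R))"
  shows "robin_lambda \<alpha> (exterior (geodesic_disk p R))
       > robin_lambda \<alpha> (exterior (geodesic_disk q R'))"
proof -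
  let ?U = "exterior (geodesic_disk 0 R)" and ?V = "exterior (geodesic_disk 0 R')"
  have R': "0 < R'" using assms by simp
  define a a' where "a = ln (tanh (R / 2))" and "a' = ln (tanh (R' / 2))"
  have a: "exp a = tanh (R / 2)" "exp a' = tanh (R' / 2)"
    using tanh_half_bounds[OF assms(3)] tanh_half_bounds[OF R'] by (simp_all add: a_def a'_def)
  have centre: "robin_lambda \<beta> (exterior (geodesic_disk p R)) = robin_lambda \<beta> ?U" for \<beta>
    by (rule robin_lambda_centre[OF assms(1,3)])
  have "ereal \<alpha> < robin_critical ?U" using assms(5) by (simp add: robin_critical_def centre)
  note sub = subcritical[OF assms(3) a(1) refl this]
  have \<alpha>: "\<alpha> \<le> - 1 / 2" using sub(1) by simp
  have "robin_lambda \<alpha> ?V < robin_lambda \<alpha> ?U"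
  proof (rule ccontr)
    assume "\<not> ?thesis"
    then have le: "robin_lambda \<alpha> ?U \<le> robin_lambda \<alpha> ?V" by simp
    obtain C where "\<And>\<phi>. \<phi> \<in> test_functions hplane \<Longrightarrow> - C * mass ?U \<phi> \<le> dirichlet ?U \<phi> + \<alpha> * bmass ?U \<phi>"
      using forms_semibounded[OF assms(3) a(1) refl, of \<alpha>] by blast
    then have "ereal (- C) \<le> robin_lambda \<alpha> ?U" by (intro robin_lambda_lower_boundI[OF assms(3) a(1) refl])
    with sub(2) obtain L where L: "robin_lambda \<alpha> ?U = ereal L"
      by (cases "robin_lambda \<alpha> ?U") auto
    have "ereal L < robin_lambda \<alpha> ?U"
      using sub(2) le unfolding L by (intro robin_lambda_enlarge[OF assms(3,4) a \<alpha>, unfolded L]) auto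
    then show False by (simp add: L)
  qed
  then show ?thesis by (simp add: centre robin_lambda_centre[OF assms(2) R'])
qed

end
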